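(* Let $A$ be a basic and connected finite dimensional algebra over an algebraically closed field $k$, and suppose that all simple $A$-modules satisfy the socle condition (defined in the context). Then the finitistic dimension of $A$ is $0$.
   Context: All modules are finitely generated left modules. $\mathrm{add}(X)$ is the additive category of direct summands of finite direct sums of $X$. Socle condition. For a simple $A$-module $S$, let $P_S$ be its projective cover and $Q_S$ the direct sum of the indecomposable projective $A$-modules (one from each isomorphism class) not isomorphic to $P_S$. $S$ satisfies the socle condition if the socle of $P_S$ contains a simple summand $S_\circ\cong S$ such that (i) $S_{\circ}$ is not contained in the image of any homomorphism $P \to P_S$ with $P \in \mathrm{add}(Q_S)$; (ii) $S_{\circ}$ is contained in the kernel of any homomorphism $P_S \to P$ with $P \in \mathrm{add}(Q_S)$. The finitistic dimension of $A$ is the supremum of the projective dimensions of indecomposable finitely generated left $A$-modules with finite projective dimension. *)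

theory Defs
  imports
    "HOL-Algebra.Algebraic_Closure"
    "HOL-Algebra.Chinese_Remainder"
    "HOL-Library.Extended_Nat"
begin

section \<open>Algebras and left modules\<close>

text \<open>The locales \<open>module\<close> and \<open>algebra\<close> of HOL-Algebra require commutative (scalar) rings;
  the following are their noncommutative versions on the same record type.\<close>

locale left_module = R?: ring R + M?: abelian_group M
  for R :: "('a, 'c) ring_scheme" (structure) and M :: "('a, 'm, 'd) module_scheme" (structure) +
  assumes smult_closed:
      "\<lbrakk>a \<in> carrier R; x \<in> carrier M\<rbrakk> \<Longrightarrow> a \<odot>\<^bsub>M\<^esub> x \<in> carrier M"
    and smult_l_distr:
      "\<lbrakk>a \<in> carrier R; b \<in> carrier R; x \<in> carrier M\<rbrakk>
        \<Longrightarrow> (a \<oplus> b) \<odot>\<^bsub>M\<^esub> x = a \<odot>\<^bsub>M\<^esub> x \<oplus>\<^bsub>M\<^esub> b \<odot>\<^bsub>M\<^esub> x"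
    and smult_r_distr:
      "\<lbrakk>a \<in> carrier R; x \<in> carrier M; y \<in> carrier M\<rbrakk>
        \<Longrightarrow> a \<odot>\<^bsub>M\<^esub> (x \<oplus>\<^bsub>M\<^esub> y) = a \<odot>\<^bsub>M\<^esub> x \<oplus>\<^bsub>M\<^esub> a \<odot>\<^bsub>M\<^esub> y"
    and smult_assoc:
      "\<lbrakk>a \<in> carrier R; b \<in> carrier R; x \<in> carrier M\<rbrakk>
        \<Longrightarrow> (a \<otimes> b) \<odot>\<^bsub>M\<^esub> x = a \<odot>\<^bsub>M\<^esub> (b \<odot>\<^bsub>M\<^esub> x)"
    and smult_one: "x \<in> carrier M \<Longrightarrow> \<one> \<odot>\<^bsub>M\<^esub> x = x"

locale assoc_algebra = module R M + ring M
  for R :: "('k, 'c) ring_scheme" (structure) and M :: "('k, 'a, 'd) module_scheme" (structure) +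
  assumes smult_mult_left:
      "\<lbrakk>c \<in> carrier R; x \<in> carrier M; y \<in> carrier M\<rbrakk>
        \<Longrightarrow> (c \<odot>\<^bsub>M\<^esub> x) \<otimes>\<^bsub>M\<^esub> y = c \<odot>\<^bsub>M\<^esub> (x \<otimes>\<^bsub>M\<^esub> y)"
    and smult_mult_right:
      "\<lbrakk>c \<in> carrier R; x \<in> carrier M; y \<in> carrier M\<rbrakk>
        \<Longrightarrow> x \<otimes>\<^bsub>M\<^esub> (c \<odot>\<^bsub>M\<^esub> y) = c \<odot>\<^bsub>M\<^esub> (x \<otimes>\<^bsub>M\<^esub> y)"

definition fin_gen :: "('a, 'c) ring_scheme \<Rightarrow> ('a, 'm, 'd) module_scheme \<Rightarrow> bool" where
  "fin_gen A M \<longleftrightarrow> (\<exists>B. finite B \<and> B \<subseteq> carrier M \<and>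
     (\<forall>x \<in> carrier M. \<exists>c \<in> B \<rightarrow> carrier A. x = (\<Oplus>\<^bsub>M\<^esub>b\<in>B. c b \<odot>\<^bsub>M\<^esub> b)))"

definition fin_dim_algebra :: "('k, 'c) ring_scheme \<Rightarrow> ('k, 'a) module \<Rightarrow> bool" where
  "fin_dim_algebra K A \<longleftrightarrow> assoc_algebra K A \<and> fin_gen K A"

definition lmod_hom ::
  "('a, 'c) ring_scheme \<Rightarrow> ('a, 'm, 'd) module_scheme \<Rightarrow> ('a, 'n, 'e) module_scheme \<Rightarrow> ('m \<Rightarrow> 'n) set"
  where "lmod_hom A M N = {f \<in> carrier M \<rightarrow> carrier N.
     (\<forall>x \<in> carrier M. \<forall>y \<in> carrier M. f (x \<oplus>\<^bsub>M\<^esub> y) = f x \<oplus>\<^bsub>N\<^esub> f y) \<and>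
     (\<forall>a \<in> carrier A. \<forall>x \<in> carrier M. f (a \<odot>\<^bsub>M\<^esub> x) = a \<odot>\<^bsub>N\<^esub> f x)}"

definition lmod_ker :: "('a, 'm, 'd) module_scheme \<Rightarrow> ('a, 'n, 'e) module_scheme \<Rightarrow> ('m \<Rightarrow> 'n) \<Rightarrow> 'm set"
  where "lmod_ker M N f = {x \<in> carrier M. f x = \<zero>\<^bsub>N\<^esub>}"

definition lmod_iso ::
  "('a, 'c) ring_scheme \<Rightarrow> ('a, 'm, 'd) module_scheme \<Rightarrow> ('a, 'n, 'e) module_scheme \<Rightarrow> bool"
  where "lmod_iso A M N \<longleftrightarrow> (\<exists>f \<in> lmod_hom A M N. bij_betw f (carrier M) (carrier N))"

definition regular_module :: "('a, 'c) ring_scheme \<Rightarrow> ('a, 'a) module" where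
  "regular_module A = \<lparr>carrier = carrier A, monoid.mult = monoid.mult A, one = \<one>\<^bsub>A\<^esub>,
     zero = \<zero>\<^bsub>A\<^esub>, add = add A, smult = monoid.mult A\<rparr>"

text \<open>External direct sum. The fields \<open>mult\<close> and \<open>one\<close> of a module record carry no meaning.\<close>

definition direct_sum :: "'i set \<Rightarrow> ('i \<Rightarrow> ('a, 'm) module) \<Rightarrow> ('a, 'i \<Rightarrow> 'm) module" where
  "direct_sum I F =
     \<lparr>carrier = {f \<in> (\<Pi>\<^sub>E i\<in>I. carrier (F i)). finite {i \<in> I. f i \<noteq> \<zero>\<^bsub>F i\<^esub>}},
      monoid.mult = undefined, one = undefined,
      zero = (\<lambda>i\<in>I. \<zero>\<^bsub>F i\<^esub>),
      add = (\<lambda>f g. \<lambda>i\<in>I. f i \<oplus>\<^bsub>F i\<^esub> g i),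
      smult = (\<lambda>a f. \<lambda>i\<in>I. a \<odot>\<^bsub>F i\<^esub> f i)\<rparr>"

text \<open>\<open>M\<close> is the internal direct sum of its submodules \<open>U\<close> and \<open>V\<close>.\<close>

definition internal_direct_sum ::
  "('a, 'c) ring_scheme \<Rightarrow> ('a, 'm) module \<Rightarrow> 'm set \<Rightarrow> 'm set \<Rightarrow> bool" where
  "internal_direct_sum A M U V \<longleftrightarrow> submodule U A M \<and> submodule V A M \<and>
     U \<inter> V = {\<zero>\<^bsub>M\<^esub>} \<and> U <+>\<^bsub>M\<^esub> V = carrier M"

definition in_add :: "('a, 'c) ring_scheme \<Rightarrow> ('a, 'x) module \<Rightarrow> ('a, 'm) module \<Rightarrow> bool" where
  "in_add A W M \<longleftrightarrow> left_module A M \<and>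
     (\<exists>(n::nat) U V. internal_direct_sum A (direct_sum {..<n} (\<lambda>_. W)) U V \<and>
        lmod_iso A M ((direct_sum {..<n} (\<lambda>_. W))\<lparr>carrier := U\<rparr>))"

definition simple_module :: "('a, 'c) ring_scheme \<Rightarrow> ('a, 'm) module \<Rightarrow> bool" where
  "simple_module A M \<longleftrightarrow> left_module A M \<and> carrier M \<noteq> {\<zero>\<^bsub>M\<^esub>} \<and>
     (\<forall>U. submodule U A M \<longrightarrow> U = {\<zero>\<^bsub>M\<^esub>} \<or> U = carrier M)"

definition indecomposable_module :: "('a, 'c) ring_scheme \<Rightarrow> ('a, 'm) module \<Rightarrow> bool" where
  "indecomposable_module A M \<longleftrightarrow> left_module A M \<and> carrier M \<noteq> {\<zero>\<^bsub>M\<^esub>} \<and>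
     (\<forall>U V. internal_direct_sum A M U V \<longrightarrow> U = {\<zero>\<^bsub>M\<^esub>} \<or> V = {\<zero>\<^bsub>M\<^esub>})"

text \<open>The socle is the sum of all simple submodules, i.e. the smallest submodule containing them.\<close>

definition socle :: "('a, 'c) ring_scheme \<Rightarrow> ('a, 'm) module \<Rightarrow> 'm set" where
  "socle A M = \<Inter> {U. submodule U A M \<and>
     (\<forall>T. submodule T A M \<and> simple_module A (M\<lparr>carrier := T\<rparr>) \<longrightarrow> T \<subseteq> U)}"


section \<open>A universe for finitely generated modules\<close>

text \<open>Quantifiers over finitely generated \<open>A\<close>-modules need a fixed type of elements. Every such
  module is a quotient of some \<open>A\<^sup>n\<close>, so up to isomorphism it has elements in the type below;
  this is lemma \<open>fin_gen_iso_umod\<close>.\<close>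

type_synonym 'a umod = "('a, (nat \<Rightarrow> 'a) set) module"

lemma transport_left_module:
  fixes M :: "('a, 'm) module" and A :: "('a, 'c) ring_scheme"
  assumes M: "left_module A M" and inj: "inj_on h (carrier M)"
  shows "\<exists>N :: ('a, 'n) module. left_module A N \<and> h \<in> lmod_hom A M N \<and>
           bij_betw h (carrier M) (carrier N)"
proof -
  interpret M: left_module A M by fact
  define g where "g = the_inv_into (carrier M) h"
  define N :: "('a, 'n) module" where
    "N = \<lparr>carrier = h ` carrier M, monoid.mult = undefined, one = undefined,
          zero = h \<zero>\<^bsub>M\<^esub>, add = (\<lambda>x y. h (g x \<oplus>\<^bsub>M\<^esub> g y)),
          smult = (\<lambda>a x. h (a \<odot>\<^bsub>M\<^esub> g x))\<rparr>"
  have gh: "g (h x) = x" if "x \<in> carrier M" for x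
    using that inj by (simp add: g_def the_inv_into_f_f)
  have ag: "abelian_group N"
  proof (rule abelian_groupI)
    fix x assume "x \<in> carrier N"
    then obtain u where u: "u \<in> carrier M" "x = h u" by (auto simp: N_def)
    show "\<exists>y\<in>carrier N. y \<oplus>\<^bsub>N\<^esub> x = \<zero>\<^bsub>N\<^esub>"
      by (rule bexI[of _ "h (\<ominus>\<^bsub>M\<^esub> u)"]) (use u in \<open>auto simp: N_def gh M.M.l_neg\<close>)
  next
    fix x y assume "x \<in> carrier N" "y \<in> carrier N"
    then obtain u v where "u \<in> carrier M" "x = h u" "v \<in> carrier M" "y = h v"
      by (auto simp: N_def)
    then show "x \<oplus>\<^bsub>N\<^esub> y = y \<oplus>\<^bsub>N\<^esub> x"
      by (simp add: N_def gh M.M.a_comm)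
  qed (auto simp: N_def gh M.M.a_assoc)
  have "left_module_axioms A N"
  proof (rule left_module_axioms.intro)
    fix a b x assume ab: "a \<in> carrier A" "b \<in> carrier A" and "x \<in> carrier N"
    then obtain u where u: "u \<in> carrier M" "x = h u" by (auto simp: N_def)
    show "(a \<oplus>\<^bsub>A\<^esub> b) \<odot>\<^bsub>N\<^esub> x = a \<odot>\<^bsub>N\<^esub> x \<oplus>\<^bsub>N\<^esub> b \<odot>\<^bsub>N\<^esub> x"
      using ab u by (simp add: N_def gh M.smult_closed M.smult_l_distr)
    show "(a \<otimes>\<^bsub>A\<^esub> b) \<odot>\<^bsub>N\<^esub> x = a \<odot>\<^bsub>N\<^esub> (b \<odot>\<^bsub>N\<^esub> x)"
      using ab u by (simp add: N_def gh M.smult_closed M.smult_assoc)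
  next
    fix a x y assume a: "a \<in> carrier A" and "x \<in> carrier N" "y \<in> carrier N"
    then obtain u v where uv: "u \<in> carrier M" "x = h u" "v \<in> carrier M" "y = h v"
      by (auto simp: N_def)
    show "a \<odot>\<^bsub>N\<^esub> (x \<oplus>\<^bsub>N\<^esub> y) = a \<odot>\<^bsub>N\<^esub> x \<oplus>\<^bsub>N\<^esub> a \<odot>\<^bsub>N\<^esub> y"
      using a uv by (simp add: N_def gh M.smult_closed M.smult_r_distr)
  qed (auto simp: N_def gh M.smult_closed M.smult_one)
  then have "left_module A N"
    by (rule left_module.intro[OF M.R.ring_axioms ag])
  moreover have "h \<in> lmod_hom A M N"
    by (auto simp: lmod_hom_def N_def gh)
  moreover have "bij_betw h (carrier M) (carrier N)"
    using inj by (simp add: N_def bij_betw_def)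
  ultimately show ?thesis by blast
qed

lemma fin_gen_iso_umod:
  fixes M :: "('a, 'm) module"
  assumes "left_module A M" and "fin_gen A M"
  shows "\<exists>N :: 'a umod. left_module A N \<and> lmod_iso A M N"
proof -
  obtain B where B: "finite B" "B \<subseteq> carrier M"
    and gen: "\<And>x. x \<in> carrier M \<Longrightarrow> \<exists>c \<in> B \<rightarrow> carrier A. x = (\<Oplus>\<^bsub>M\<^esub>b\<in>B. c b \<odot>\<^bsub>M\<^esub> b)"
    using assms(2) unfolding fin_gen_def by blast
  obtain e :: "'m \<Rightarrow> nat" where e: "inj_on e B"
    using finite_imp_inj_to_nat_seg[OF B(1)] by blast
  interpret M: left_module A M by fact
  define h where
    "h x = {v. v \<circ> e \<in> B \<rightarrow> carrier A \<and> x = (\<Oplus>\<^bsub>M\<^esub>b\<in>B. v (e b) \<odot>\<^bsub>M\<^esub> b)}" for x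
  have "inj_on h (carrier M)"
  proof (rule inj_onI)
    fix x y assume x: "x \<in> carrier M" and eq: "h x = h y"
    obtain c where c: "c \<in> B \<rightarrow> carrier A" "x = (\<Oplus>\<^bsub>M\<^esub>b\<in>B. c b \<odot>\<^bsub>M\<^esub> b)"
      using gen[OF x] by blast
    define v where "v = c \<circ> the_inv_into B e"
    have v: "v (e b) = c b" if "b \<in> B" for b
      using that e by (simp add: v_def the_inv_into_f_f)
    have "(\<Oplus>\<^bsub>M\<^esub>b\<in>B. v (e b) \<odot>\<^bsub>M\<^esub> b) = (\<Oplus>\<^bsub>M\<^esub>b\<in>B. c b \<odot>\<^bsub>M\<^esub> b)"
    proof (rule M.M.finsum_cong'[OF refl])
      show "(\<lambda>b. c b \<odot>\<^bsub>M\<^esub> b) \<in> B \<rightarrow> carrier M"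
        using c(1) B(2) M.smult_closed by blast
    qed (simp add: v)
    then have "x = (\<Oplus>\<^bsub>M\<^esub>b\<in>B. v (e b) \<odot>\<^bsub>M\<^esub> b)"
      using c(2) by (rule trans[OF _ sym, rotated])
    moreover have "v \<circ> e \<in> B \<rightarrow> carrier A"
      using c(1) by (simp add: v Pi_iff)
    ultimately have *: "v \<in> h x" unfolding h_def by blast
    then have "v \<in> h y" unfolding eq .
    with * show "x = y" unfolding h_def by blast
  qed
  from transport_left_module[OF assms(1) this]
  show ?thesis unfolding lmod_iso_def by blast
qed


section \<open>Projective modules and homological dimensions\<close>

definition fg_projective :: "('a, 'c) ring_scheme \<Rightarrow> ('a, 'p) module \<Rightarrow> bool" where
  "fg_projective A P \<longleftrightarrow> left_module A P \<and> fin_gen A P \<and>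
     (\<forall>(N :: 'a umod) (L :: 'a umod). \<forall>g \<in> lmod_hom A N L. \<forall>f \<in> lmod_hom A P L.
        left_module A N \<and> fin_gen A N \<and> left_module A L \<and> fin_gen A L \<and>
        g ` carrier N = carrier L \<longrightarrow>
        (\<exists>f' \<in> lmod_hom A P N. \<forall>x \<in> carrier P. g (f' x) = f x))"

text \<open>\<open>p\<close> is a surjection from a projective module whose kernel is superfluous.\<close>

definition projective_cover ::
  "('a, 'c) ring_scheme \<Rightarrow> ('a, 'p) module \<Rightarrow> ('p \<Rightarrow> 's) \<Rightarrow> ('a, 's) module \<Rightarrow> bool" where
  "projective_cover A P p S \<longleftrightarrow> fg_projective A P \<and> p \<in> lmod_hom A P S \<and>
     p ` carrier P = carrier S \<and>
     (\<forall>U. submodule U A P \<and> U <+>\<^bsub>P\<^esub> lmod_ker P S p = carrier P \<longrightarrow> U = carrier P)"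

text \<open>A projective resolution
  \<open>\<dots> \<rightarrow> P 2 \<rightarrow> P 1 \<rightarrow> P 0 \<rightarrow> M \<rightarrow> 0\<close> with differentials \<open>d i : P (i + 1) \<rightarrow> P i\<close>,
  augmentation \<open>p\<close>, and \<open>P i = 0\<close> for \<open>i > n\<close>.\<close>

definition projective_resolution ::
  "('a, 'c) ring_scheme \<Rightarrow> ('a, 'm) module \<Rightarrow> nat \<Rightarrow> (nat \<Rightarrow> ('a, 'p) module) \<Rightarrow>
     (nat \<Rightarrow> 'p \<Rightarrow> 'p) \<Rightarrow> ('p \<Rightarrow> 'm) \<Rightarrow> bool" where
  "projective_resolution A M n P d p \<longleftrightarrow>
     (\<forall>i. fg_projective A (P i)) \<and> (\<forall>i>n. carrier (P i) = {\<zero>\<^bsub>P i\<^esub>}) \<and>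
     (\<forall>i. d i \<in> lmod_hom A (P (Suc i)) (P i)) \<and> p \<in> lmod_hom A (P 0) M \<and>
     p ` carrier (P 0) = carrier M \<and>
     lmod_ker (P 0) M p = d 0 ` carrier (P 1) \<and>
     (\<forall>i. lmod_ker (P (Suc i)) (P i) (d i) = d (Suc i) ` carrier (P (Suc (Suc i))))"

definition proj_dim :: "('a, 'c) ring_scheme \<Rightarrow> ('a, 'm) module \<Rightarrow> enat" where
  "proj_dim A M = Inf {enat n | n. \<exists>(P :: nat \<Rightarrow> 'a umod) d p. projective_resolution A M n P d p}"

definition finitistic_dimension :: "('a, 'c) ring_scheme \<Rightarrow> enat" where
  "finitistic_dimension A = Sup {proj_dim A M | M :: 'a umod.
     left_module A M \<and> fin_gen A M \<and> indecomposable_module A M \<and> proj_dim A M < \<infinity>}"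


section \<open>Basic and connected algebras\<close>

text \<open>The regular module is a direct sum of pairwise non-isomorphic indecomposable modules.\<close>

definition basic_algebra :: "('a, 'c) ring_scheme \<Rightarrow> bool" where
  "basic_algebra A \<longleftrightarrow> (\<exists>(n::nat) (P :: nat \<Rightarrow> 'a umod).
     (\<forall>i<n. indecomposable_module A (P i)) \<and>
     (\<forall>i<n. \<forall>j<n. i \<noteq> j \<longrightarrow> \<not> lmod_iso A (P i) (P j)) \<and>
     lmod_iso A (regular_module A) (direct_sum {..<n} P))"

definition algebra_prod :: "('k, 'a) module \<Rightarrow> ('k, 'b) module \<Rightarrow> ('k, 'a \<times> 'b) module" where
  "algebra_prod B C = ring.extend (RDirProd B C)
     (module.fields (\<lambda>c (x, y). (c \<odot>\<^bsub>B\<^esub> x, c \<odot>\<^bsub>C\<^esub> y)))"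

definition algebra_iso :: "('k, 'c) ring_scheme \<Rightarrow> ('k, 'a) module \<Rightarrow> ('k, 'b) module \<Rightarrow> bool" where
  "algebra_iso K A B \<longleftrightarrow> (\<exists>h \<in> ring_iso A B.
     \<forall>c \<in> carrier K. \<forall>x \<in> carrier A. h (c \<odot>\<^bsub>A\<^esub> x) = c \<odot>\<^bsub>B\<^esub> h x)"

text \<open>A nonzero algebra that is not a product of two nonzero algebras. The factors of \<open>A\<close>
  are isomorphic to ideals of \<open>A\<close>, so the element type of \<open>A\<close> suffices for them.\<close>

definition connected_algebra :: "('k, 'c) ring_scheme \<Rightarrow> ('k, 'a) module \<Rightarrow> bool" where
  "connected_algebra K A \<longleftrightarrow> carrier A \<noteq> {\<zero>\<^bsub>A\<^esub>} \<and>
     \<not> (\<exists>(B :: ('k, 'a) module) (C :: ('k, 'a) module).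
          assoc_algebra K B \<and> assoc_algebra K C \<and>
          carrier B \<noteq> {\<zero>\<^bsub>B\<^esub>} \<and> carrier C \<noteq> {\<zero>\<^bsub>C\<^esub>} \<and>
          algebra_iso K A (algebra_prod B C))"


section \<open>The socle condition\<close>

definition indec_projective :: "('a, 'c) ring_scheme \<Rightarrow> ('a, 'm) module \<Rightarrow> bool" where
  "indec_projective A W \<longleftrightarrow> fg_projective A W \<and> indecomposable_module A W"

text \<open>\<open>\<Q>\<close> contains exactly one module from each isomorphism class of
  indecomposable projective modules not isomorphic to \<open>P\<close>.\<close>

definition complementary_projectives ::
  "('a, 'c) ring_scheme \<Rightarrow> 'a umod \<Rightarrow> 'a umod set \<Rightarrow> bool" where
  "complementary_projectives A P \<Q> \<longleftrightarrow>
     (\<forall>W \<in> \<Q>. indec_projective A W \<and> \<not> lmod_iso A W P) \<and>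
     (\<forall>W :: 'a umod. indec_projective A W \<and> \<not> lmod_iso A W P \<longrightarrow>
        (\<exists>!Y. Y \<in> \<Q> \<and> lmod_iso A W Y))"

text \<open>Below, \<open>P\<close> is \<open>P\<^sub>S\<close> and \<open>direct_sum \<Q> (\<lambda>W. W)\<close> is \<open>Q\<^sub>S\<close>. Both exist over a
  finite dimensional algebra and are unique up to isomorphism, so the choice of
  \<open>P\<close>, \<open>p\<close> and \<open>\<Q>\<close> is immaterial.\<close>

definition socle_condition :: "('a, 'c) ring_scheme \<Rightarrow> 'a umod \<Rightarrow> bool" where
  "socle_condition A S \<longleftrightarrow>
     (\<exists>(P :: 'a umod) p \<Q>. projective_cover A P p S \<and> complementary_projectives A P \<Q> \<and>
       (\<exists>S\<^sub>0. simple_module A (P\<lparr>carrier := S\<^sub>0\<rparr>) \<and> lmod_iso A (P\<lparr>carrier := S\<^sub>0\<rparr>) S \<and>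
          (\<exists>T. internal_direct_sum A (P\<lparr>carrier := socle A P\<rparr>) S\<^sub>0 T) \<and>
          (\<forall>W :: 'a umod. in_add A (direct_sum \<Q> (\<lambda>Y. Y)) W \<longrightarrow>
             (\<forall>f \<in> lmod_hom A W P. \<not> S\<^sub>0 \<subseteq> f ` carrier W)) \<and>
          (\<forall>W :: 'a umod. in_add A (direct_sum \<Q> (\<lambda>Y. Y)) W \<longrightarrow>
             (\<forall>f \<in> lmod_hom A P W. S\<^sub>0 \<subseteq> lmod_ker P W f))))"

end

theory Submission imports Defs
begin

text \<open>
  Everything follows from one property of \<open>A\<close>: every injective homomorphism between finitely
  generated projective modules splits. Given it, let \<open>P\<^sub>n \<rightarrow> \<dots> \<rightarrow> P\<^sub>0 \<rightarrow> M\<close> be a finite projective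
  resolution and let \<open>\<Omega>\<close> be the kernel of \<open>P\<^sub>0 \<rightarrow> M\<close>. By induction on \<open>n\<close> the syzygy \<open>\<Omega>\<close> is
  projective, so its inclusion into \<open>P\<^sub>0\<close> splits and \<open>M\<close> is a direct summand of \<open>P\<^sub>0\<close>
  (\<open>fg_projective_quotient_by_projective\<close>, \<open>fg_projective_if_finite_resolution\<close>). Hence a module of
  finite projective dimension is projective.

  The splitting property is governed by simple right modules, an observation of Bass. Let
  \<open>f : P \<rightarrow> Q\<close> be injective and let \<open>N\<close> be the right submodule of \<open>P\<^sup>* = Hom(P, A)\<close> that consists of
  the functionals that extend along \<open>f\<close>. If \<open>N = P\<^sup>*\<close>, then the coordinate functionals of a
  dual basis of \<open>P\<close> extend to \<open>Q\<close>, and the extensions assemble to a retraction of \<open>f\<close>. Otherwise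
  \<open>N\<close> lies in a proper right submodule \<open>N'\<close> with \<open>P\<^sup>* = N' + vA\<close>, where \<open>v = ve\<close> for a primitive
  idempotent \<open>e\<close>. Suppose that some \<open>y \<noteq> 0\<close> in \<open>Ae\<close> is annihilated on the right by all \<open>x\<close> in \<open>eA\<close>
  that do not generate \<open>eA\<close>. Then \<open>n + va \<mapsto> ya\<close> is a well defined nonzero homomorphism of right
  modules from \<open>P\<^sup>*\<close> to \<open>A\<close> that vanishes on \<open>N'\<close>. As \<open>P\<close> is reflexive, it is evaluation at some
  \<open>z \<noteq> 0\<close> in \<open>P\<close>. All functionals in \<open>N\<close> vanish at \<open>z\<close>, so all functionals on \<open>Q\<close> vanish at \<open>f z\<close>,
  which gives \<open>f z = 0\<close> and contradicts injectivity (\<open>ex_common_zero_of_functionals\<close>,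
  \<open>injective_hom_of_projectives_splits\<close>).

  It remains to find \<open>y\<close>. A basic algebra is the direct sum of pairwise non-isomorphic
  indecomposable modules \<open>P\<^sub>i\<close> isomorphic to \<open>Ae\<^sub>i\<close>. The ring \<open>e\<^sub>iAe\<^sub>i\<close> is local, so \<open>P\<^sub>i\<close> has a largest
  proper submodule and is the projective cover of a simple module. The socle condition for this
  simple module gives a nonzero element of \<open>P\<^sub>i\<close> that is killed by all homomorphisms to the \<open>P\<^sub>j\<close> with
  \<open>j \<noteq> i\<close>; in other words, \<open>y\<^sub>0 \<noteq> 0\<close> in \<open>Ae\<^sub>i\<close> with \<open>y\<^sub>0e\<^sub>iAe\<^sub>j = 0\<close>. Now multiply \<open>y\<^sub>0\<close> on the
  right by nilpotent elements of \<open>e\<^sub>iAe\<^sub>i\<close> for as long as the product stays nonzero. In finite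
  dimension this stops (\<open>ex_multiple_killed_by_nilpotents\<close>), and the last nonzero product is the
  required \<open>y\<close> (\<open>socle_condition_imp_right_top_embeds\<close>).
\<close>

section \<open>Modules, homomorphisms and retracts\<close>

context left_module begin

lemma smult_l_null:
  assumes "x \<in> carrier M" shows "\<zero> \<odot>\<^bsub>M\<^esub> x = \<zero>\<^bsub>M\<^esub>"
proof -
  have "\<zero> \<odot>\<^bsub>M\<^esub> x \<oplus>\<^bsub>M\<^esub> \<zero> \<odot>\<^bsub>M\<^esub> x = \<zero> \<odot>\<^bsub>M\<^esub> x"
    using smult_l_distr[of \<zero> \<zero> x] assms by simp
  then show ?thesis using smult_closed[of \<zero> x] assms by simp
qed

lemma smult_r_null:
  assumes "a \<in> carrier R" shows "a \<odot>\<^bsub>M\<^esub> \<zero>\<^bsub>M\<^esub> = \<zero>\<^bsub>M\<^esub>"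
proof -
  have "a \<odot>\<^bsub>M\<^esub> \<zero>\<^bsub>M\<^esub> \<oplus>\<^bsub>M\<^esub> a \<odot>\<^bsub>M\<^esub> \<zero>\<^bsub>M\<^esub> = a \<odot>\<^bsub>M\<^esub> \<zero>\<^bsub>M\<^esub>"
    using smult_r_distr[of a "\<zero>\<^bsub>M\<^esub>" "\<zero>\<^bsub>M\<^esub>"] assms by simp
  then show ?thesis using smult_closed[of a "\<zero>\<^bsub>M\<^esub>"] assms by simp
qed

lemma smult_l_minus:
  assumes "a \<in> carrier R" "x \<in> carrier M"
  shows "(\<ominus> a) \<odot>\<^bsub>M\<^esub> x = \<ominus>\<^bsub>M\<^esub> (a \<odot>\<^bsub>M\<^esub> x)"
proof (rule M.minus_equality[symmetric])
  show "\<ominus> a \<odot>\<^bsub>M\<^esub> x \<oplus>\<^bsub>M\<^esub> a \<odot>\<^bsub>M\<^esub> x = \<zero>\<^bsub>M\<^esub>"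
    using assms by (simp add: smult_l_distr[symmetric] R.l_neg smult_l_null)
qed (use assms smult_closed in auto)

lemma smult_l_diff:
  assumes "a \<in> carrier R" "b \<in> carrier R" "x \<in> carrier M"
  shows "(a \<ominus> b) \<odot>\<^bsub>M\<^esub> x = a \<odot>\<^bsub>M\<^esub> x \<ominus>\<^bsub>M\<^esub> b \<odot>\<^bsub>M\<^esub> x"
  using assms by (simp add: a_minus_def smult_l_distr smult_l_minus)

lemma minus_eq_smult: "x \<in> carrier M \<Longrightarrow> \<ominus>\<^bsub>M\<^esub> x = (\<ominus> \<one>) \<odot>\<^bsub>M\<^esub> x"
  by (simp add: smult_l_minus smult_one)

lemma diff_eq_zero_iff:
  assumes "x \<in> carrier M" "y \<in> carrier M"
  shows "x \<ominus>\<^bsub>M\<^esub> y = \<zero>\<^bsub>M\<^esub> \<longleftrightarrow> x = y"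
proof
  assume "x \<ominus>\<^bsub>M\<^esub> y = \<zero>\<^bsub>M\<^esub>"
  moreover have "x = (x \<ominus>\<^bsub>M\<^esub> y) \<oplus>\<^bsub>M\<^esub> y"
    using assms by (simp add: a_minus_def M.a_assoc M.l_neg)
  ultimately show "x = y" using assms by simp
qed (use assms in \<open>simp add: a_minus_def M.r_neg\<close>)

lemma submoduleI:
  assumes "H \<subseteq> carrier M" and "\<zero>\<^bsub>M\<^esub> \<in> H"
    and "\<And>x y. \<lbrakk>x \<in> H; y \<in> H\<rbrakk> \<Longrightarrow> x \<oplus>\<^bsub>M\<^esub> y \<in> H"
    and smult: "\<And>a x. \<lbrakk>a \<in> carrier R; x \<in> H\<rbrakk> \<Longrightarrow> a \<odot>\<^bsub>M\<^esub> x \<in> H"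
  shows "submodule H R M"
proof -
  have "\<ominus>\<^bsub>M\<^esub> x \<in> H" if "x \<in> H" for x
    using smult[of "\<ominus> \<one>" x] that assms(1) by (auto simp: minus_eq_smult)
  then show ?thesis
    using assms
    by (intro submodule.intro subgroup.intro submodule_axioms.intro) (auto simp: a_inv_def)
qed

lemma submodule_facts:
  assumes "submodule H R M"
  shows "H \<subseteq> carrier M" and "\<zero>\<^bsub>M\<^esub> \<in> H"
    and "\<And>x y. \<lbrakk>x \<in> H; y \<in> H\<rbrakk> \<Longrightarrow> x \<oplus>\<^bsub>M\<^esub> y \<in> H"
    and "\<And>a x. \<lbrakk>a \<in> carrier R; x \<in> H\<rbrakk> \<Longrightarrow> a \<odot>\<^bsub>M\<^esub> x \<in> H"
    and "\<And>x y. \<lbrakk>x \<in> H; y \<in> H\<rbrakk> \<Longrightarrow> x \<ominus>\<^bsub>M\<^esub> y \<in> H"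
proof -
  interpret H: submodule H R M by fact
  show sub: "H \<subseteq> carrier M" and "\<zero>\<^bsub>M\<^esub> \<in> H"
    and add: "\<And>x y. \<lbrakk>x \<in> H; y \<in> H\<rbrakk> \<Longrightarrow> x \<oplus>\<^bsub>M\<^esub> y \<in> H"
    and "\<And>a x. \<lbrakk>a \<in> carrier R; x \<in> H\<rbrakk> \<Longrightarrow> a \<odot>\<^bsub>M\<^esub> x \<in> H"
    using H.subset H.one_closed H.m_closed by auto
  fix x y assume xy: "x \<in> H" "y \<in> H"
  then have "\<ominus>\<^bsub>M\<^esub> y = (\<ominus> \<one>) \<odot>\<^bsub>M\<^esub> y" using sub minus_eq_smult by blast
  then show "x \<ominus>\<^bsub>M\<^esub> y \<in> H" using xy add by (simp add: a_minus_def)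
qed

lemma left_module_submodule:
  assumes "submodule H R M"
  shows "left_module R (M\<lparr>carrier := H\<rparr>)"
proof -
  note H = submodule_facts[OF assms]
  have *: "x \<in> carrier M" if "x \<in> H" for x using that H(1) by blast
  have "abelian_group (M\<lparr>carrier := H\<rparr>)"
  proof (rule abelian_groupI)
    fix x assume x: "x \<in> carrier (M\<lparr>carrier := H\<rparr>)"
    then show "\<exists>y\<in>carrier (M\<lparr>carrier := H\<rparr>). y \<oplus>\<^bsub>M\<lparr>carrier := H\<rparr>\<^esub> x = \<zero>\<^bsub>M\<lparr>carrier := H\<rparr>\<^esub>"
      using H(2) H(5)[of "\<zero>\<^bsub>M\<^esub>" x] * by (auto intro!: bexI[of _ "\<zero>\<^bsub>M\<^esub> \<ominus>\<^bsub>M\<^esub> x"] simp: a_minus_def M.l_neg)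
  qed (auto simp: H * M.a_assoc intro: M.a_comm)
  moreover have "left_module_axioms R (M\<lparr>carrier := H\<rparr>)"
    by (rule left_module_axioms.intro)
      (auto simp: H * smult_l_distr smult_r_distr smult_assoc smult_one)
  ultimately show ?thesis by (rule left_module.intro[OF R.ring_axioms])
qed

lemma submodule_carrier: "submodule (carrier M) R M"
  by (rule submoduleI) (auto simp: smult_closed)

lemma submodule_zero: "submodule {\<zero>\<^bsub>M\<^esub>} R M"
  by (rule submoduleI) (auto simp: smult_r_null)

lemma finsum_in_submodule:
  assumes "submodule H R M" "\<And>i. i \<in> I \<Longrightarrow> f i \<in> H"
  shows "(\<Oplus>\<^bsub>M\<^esub>i\<in>I. f i) \<in> H"
  using assms(2)
proof (induction I rule: infinite_finite_induct)
  case (infinite I)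
  then show ?case using submodule_facts(2)[OF assms(1)] by (simp add: M.finsum_infinite)
next
  case empty
  then show ?case using submodule_facts(2)[OF assms(1)] by simp
next
  case (insert i I)
  have "f \<in> insert i I \<rightarrow> carrier M" using insert.prems submodule_facts(1)[OF assms(1)] by blast
  then show ?case using insert submodule_facts(3)[OF assms(1)] by (auto simp: M.finsum_insert Pi_def)
qed

end

lemma lmod_homI:
  assumes "\<And>x. x \<in> carrier M \<Longrightarrow> f x \<in> carrier N"
    and "\<And>x y. \<lbrakk>x \<in> carrier M; y \<in> carrier M\<rbrakk> \<Longrightarrow> f (x \<oplus>\<^bsub>M\<^esub> y) = f x \<oplus>\<^bsub>N\<^esub> f y"
    and "\<And>a x. \<lbrakk>a \<in> carrier A; x \<in> carrier M\<rbrakk> \<Longrightarrow> f (a \<odot>\<^bsub>M\<^esub> x) = a \<odot>\<^bsub>N\<^esub> f x"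
  shows "f \<in> lmod_hom A M N"
  using assms by (auto simp: lmod_hom_def)

lemma lmod_homD:
  assumes "f \<in> lmod_hom A M N"
  shows "\<And>x. x \<in> carrier M \<Longrightarrow> f x \<in> carrier N"
    and "\<And>x y. \<lbrakk>x \<in> carrier M; y \<in> carrier M\<rbrakk> \<Longrightarrow> f (x \<oplus>\<^bsub>M\<^esub> y) = f x \<oplus>\<^bsub>N\<^esub> f y"
    and "\<And>a x. \<lbrakk>a \<in> carrier A; x \<in> carrier M\<rbrakk> \<Longrightarrow> f (a \<odot>\<^bsub>M\<^esub> x) = a \<odot>\<^bsub>N\<^esub> f x"
  using assms by (auto simp: lmod_hom_def)

lemma lmod_hom_comp:
  assumes "left_module A M" "f \<in> lmod_hom A M N" "g \<in> lmod_hom A N L"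
  shows "(\<lambda>x. g (f x)) \<in> lmod_hom A M L"
  using assms(2,3) by (auto simp: lmod_hom_def Pi_def)

locale lmod_hom_pair = M: left_module A M + N: left_module A N
  for A :: "('a, 'c) ring_scheme" and M :: "('a, 'm) module" and N :: "('a, 'n) module" +
  fixes f
  assumes hom: "f \<in> lmod_hom A M N"
begin

lemmas hom_closed = lmod_homD(1)[OF hom]
lemmas hom_add = lmod_homD(2)[OF hom]
lemmas hom_smult = lmod_homD(3)[OF hom]

lemma hom_zero: "f \<zero>\<^bsub>M\<^esub> = \<zero>\<^bsub>N\<^esub>"
  using hom_smult[of "\<zero>\<^bsub>A\<^esub>" "\<zero>\<^bsub>M\<^esub>"] hom_closed[of "\<zero>\<^bsub>M\<^esub>"]
  by (simp add: M.smult_l_null N.smult_l_null)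

lemma hom_diff:
  assumes "x \<in> carrier M" "y \<in> carrier M"
  shows "f (x \<ominus>\<^bsub>M\<^esub> y) = f x \<ominus>\<^bsub>N\<^esub> f y"
  using assms hom_closed
  by (simp add: a_minus_def hom_add hom_smult M.minus_eq_smult N.minus_eq_smult M.smult_closed)

lemma inj_on_iff: "inj_on f (carrier M) \<longleftrightarrow> (\<forall>x \<in> carrier M. f x = \<zero>\<^bsub>N\<^esub> \<longrightarrow> x = \<zero>\<^bsub>M\<^esub>)"
proof
  show "inj_on f (carrier M) \<Longrightarrow> \<forall>x \<in> carrier M. f x = \<zero>\<^bsub>N\<^esub> \<longrightarrow> x = \<zero>\<^bsub>M\<^esub>"
    using hom_zero by (metis M.M.zero_closed inj_onD)
  assume *: "\<forall>x \<in> carrier M. f x = \<zero>\<^bsub>N\<^esub> \<longrightarrow> x = \<zero>\<^bsub>M\<^esub>"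
  show "inj_on f (carrier M)"
  proof (rule inj_onI)
    fix x y assume xy: "x \<in> carrier M" "y \<in> carrier M" "f x = f y"
    then have "f (x \<ominus>\<^bsub>M\<^esub> y) = \<zero>\<^bsub>N\<^esub>"
      using hom_closed by (simp add: hom_diff N.diff_eq_zero_iff)
    then show "x = y" using * xy by (metis M.M.minus_closed M.diff_eq_zero_iff)
  qed
qed

lemma submodule_ker: "submodule (lmod_ker M N f) A M"
  by (rule M.submoduleI)
    (auto simp: lmod_ker_def hom_zero hom_add hom_smult M.smult_closed N.smult_r_null)

lemma submodule_image:
  assumes "submodule U A M"
  shows "submodule (f ` U) A N"
proof (rule N.submoduleI)
  note U = M.submodule_facts[OF assms]
  show "f ` U \<subseteq> carrier N" using U(1) hom_closed by blast
  show "\<zero>\<^bsub>N\<^esub> \<in> f ` U" using U(2) hom_zero by (metis imageI)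
  fix x y assume "x \<in> f ` U" "y \<in> f ` U"
  then obtain u v where "u \<in> U" "v \<in> U" "x = f u" "y = f v" by blast
  then have "x \<oplus>\<^bsub>N\<^esub> y = f (u \<oplus>\<^bsub>M\<^esub> v)" "u \<oplus>\<^bsub>M\<^esub> v \<in> U"
    using U by (auto simp: hom_add subset_iff)
  then show "x \<oplus>\<^bsub>N\<^esub> y \<in> f ` U" by blast
next
  note U = M.submodule_facts[OF assms]
  fix a x assume "a \<in> carrier A" "x \<in> f ` U"
  then obtain u where "u \<in> U" "x = f u" "a \<in> carrier A" by blast
  then have "a \<odot>\<^bsub>N\<^esub> x = f (a \<odot>\<^bsub>M\<^esub> u)" "a \<odot>\<^bsub>M\<^esub> u \<in> U"
    using U by (auto simp: hom_smult subset_iff)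
  then show "a \<odot>\<^bsub>N\<^esub> x \<in> f ` U" by blast
qed

lemma hom_finsum:
  assumes "g \<in> I \<rightarrow> carrier M"
  shows "f (\<Oplus>\<^bsub>M\<^esub>i\<in>I. g i) = (\<Oplus>\<^bsub>N\<^esub>i\<in>I. f (g i))"
  using assms
proof (induction I rule: infinite_finite_induct)
  case (insert i I)
  then have "(\<lambda>i. f (g i)) \<in> insert i I \<rightarrow> carrier N" using hom_closed by blast
  then show ?case
    using insert by (simp add: M.M.finsum_insert N.M.finsum_insert hom_add Pi_def)
qed (auto simp: hom_zero M.M.finsum_infinite N.M.finsum_infinite)

end

lemma lmod_hom_pairI:
  "\<lbrakk>left_module A M; left_module A N; f \<in> lmod_hom A M N\<rbrakk> \<Longrightarrow> lmod_hom_pair A M N f"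
  by (simp add: lmod_hom_pair_def lmod_hom_pair_axioms_def)

lemma fin_genE:
  assumes "fin_gen A M"
  obtains B where "finite B" "B \<subseteq> carrier M"
    "\<forall>x \<in> carrier M. \<exists>c \<in> B \<rightarrow> carrier A. x = (\<Oplus>\<^bsub>M\<^esub>b\<in>B. c b \<odot>\<^bsub>M\<^esub> b)"
proof -
  from assms obtain B where "finite B \<and> B \<subseteq> carrier M \<and>
     (\<forall>x \<in> carrier M. \<exists>c \<in> B \<rightarrow> carrier A. x = (\<Oplus>\<^bsub>M\<^esub>b\<in>B. c b \<odot>\<^bsub>M\<^esub> b))"
    unfolding fin_gen_def by (rule exE)
  then show thesis by (intro that[of B]) simp_all
qed

text \<open>In \<open>fin_gen\<close> the generators form a set, so a family with repetitions needs the
  coefficients of equal members to be added up.\<close>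

lemma fin_genI_family:
  fixes M :: "('a, 'm) module" and g :: "'i \<Rightarrow> 'm"
  assumes "left_module A M" and I: "finite I" "g \<in> I \<rightarrow> carrier M"
    and gen: "\<And>x. x \<in> carrier M \<Longrightarrow> \<exists>c \<in> I \<rightarrow> carrier A. x = (\<Oplus>\<^bsub>M\<^esub>i\<in>I. c i \<odot>\<^bsub>M\<^esub> g i)"
  shows "fin_gen A M"
proof -
  interpret left_module A M by fact
  have B: "finite (g ` I)" "g ` I \<subseteq> carrier M" using I by auto
  have collect: "\<exists>c' \<in> g ` I \<rightarrow> carrier A.
      (\<Oplus>\<^bsub>M\<^esub>i\<in>J. c i \<odot>\<^bsub>M\<^esub> g i) = (\<Oplus>\<^bsub>M\<^esub>b\<in>g ` I. c' b \<odot>\<^bsub>M\<^esub> b)"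
    if "finite J" "J \<subseteq> I" "c \<in> I \<rightarrow> carrier A" for J c
    using that(1,2)
  proof (induction J)
    case empty
    have "(\<Oplus>\<^bsub>M\<^esub>b\<in>g ` I. \<zero>\<^bsub>A\<^esub> \<odot>\<^bsub>M\<^esub> b) = (\<Oplus>\<^bsub>M\<^esub>b\<in>g ` I. \<zero>\<^bsub>M\<^esub>)"
      using B(2) by (intro M.finsum_cong') (auto simp: smult_l_null subset_iff)
    then show ?case by (intro bexI[of _ "\<lambda>_. \<zero>\<^bsub>A\<^esub>"]) (auto simp: M.finsum_zero)
  next
    case (insert j J)
    then obtain c' where c': "c' \<in> g ` I \<rightarrow> carrier A"
      "(\<Oplus>\<^bsub>M\<^esub>i\<in>J. c i \<odot>\<^bsub>M\<^esub> g i) = (\<Oplus>\<^bsub>M\<^esub>b\<in>g ` I. c' b \<odot>\<^bsub>M\<^esub> b)" by auto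
    define B' where "B' = g ` I - {g j}"
    have gB: "g ` I = insert (g j) B'" "g j \<notin> B'" "finite B'"
      using insert.prems I(1) by (auto simp: B'_def)
    have gj: "g j \<in> carrier M" "c j \<in> carrier A" "c' (g j) \<in> carrier A"
      using insert.prems I(2) that(3) c'(1) by auto
    define c'' where "c'' = c'(g j := c j \<oplus>\<^bsub>A\<^esub> c' (g j))"
    have c''j: "c'' (g j) = c j \<oplus>\<^bsub>A\<^esub> c' (g j)" by (simp add: c''_def)
    have B'M: "(\<lambda>b. c' b \<odot>\<^bsub>M\<^esub> b) \<in> B' \<rightarrow> carrier M"
      using c'(1) B(2) by (auto simp: B'_def intro!: smult_closed)
    have cj: "(\<lambda>i. c i \<odot>\<^bsub>M\<^esub> g i) \<in> J \<rightarrow> carrier M"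
      using that(3) I(2) insert.prems by (auto intro!: smult_closed)
    have same: "(\<Oplus>\<^bsub>M\<^esub>b\<in>B'. c'' b \<odot>\<^bsub>M\<^esub> b) = (\<Oplus>\<^bsub>M\<^esub>b\<in>B'. c' b \<odot>\<^bsub>M\<^esub> b)"
      by (rule M.finsum_cong'[OF refl B'M]) (use gB(2) in \<open>auto simp: c''_def\<close>)
    have B''M: "(\<lambda>b. c'' b \<odot>\<^bsub>M\<^esub> b) \<in> B' \<rightarrow> carrier M"
      using B'M gB(2) by (auto simp: c''_def Pi_def)
    have "(\<Oplus>\<^bsub>M\<^esub>i\<in>insert j J. c i \<odot>\<^bsub>M\<^esub> g i) =
        c j \<odot>\<^bsub>M\<^esub> g j \<oplus>\<^bsub>M\<^esub> (c' (g j) \<odot>\<^bsub>M\<^esub> g j \<oplus>\<^bsub>M\<^esub> (\<Oplus>\<^bsub>M\<^esub>b\<in>B'. c' b \<odot>\<^bsub>M\<^esub> b))"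
      using insert.hyps insert.prems gj c'(2) gB B'M cj
      by (simp add: M.finsum_insert smult_closed)
    also have "\<dots> = c'' (g j) \<odot>\<^bsub>M\<^esub> g j \<oplus>\<^bsub>M\<^esub> (\<Oplus>\<^bsub>M\<^esub>b\<in>B'. c'' b \<odot>\<^bsub>M\<^esub> b)"
      unfolding same using gj B'M c''j by (simp add: smult_l_distr M.a_assoc smult_closed M.finsum_closed)
    also have "\<dots> = (\<Oplus>\<^bsub>M\<^esub>b\<in>g ` I. c'' b \<odot>\<^bsub>M\<^esub> b)"
      unfolding gB(1) using gB(2,3) B''M gj
      by (simp add: M.finsum_insert smult_closed c''j)
    finally have eq: "(\<Oplus>\<^bsub>M\<^esub>i\<in>insert j J. c i \<odot>\<^bsub>M\<^esub> g i) = (\<Oplus>\<^bsub>M\<^esub>b\<in>g ` I. c'' b \<odot>\<^bsub>M\<^esub> b)" .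
    moreover have "c'' \<in> g ` I \<rightarrow> carrier A"
      using c'(1) gj by (auto simp: c''_def)
    ultimately show ?case by blast
  qed
  have "\<exists>c' \<in> g ` I \<rightarrow> carrier A. x = (\<Oplus>\<^bsub>M\<^esub>b\<in>g ` I. c' b \<odot>\<^bsub>M\<^esub> b)" if x: "x \<in> carrier M" for x
  proof -
    obtain c where "c \<in> I \<rightarrow> carrier A" "x = (\<Oplus>\<^bsub>M\<^esub>i\<in>I. c i \<odot>\<^bsub>M\<^esub> g i)"
      using gen[OF x] by (rule bexE)
    then show ?thesis using collect[OF I(1) subset_refl] by simp
  qed
  then show ?thesis using B unfolding fin_gen_def by blast
qed

lemma fin_gen_image:
  fixes M :: "('a, 'm) module" and N :: "('a, 'n) module"
  assumes "left_module A M" "left_module A N" "fin_gen A M" "f \<in> lmod_hom A M N"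
    and surj: "f ` carrier M = carrier N"
  shows "fin_gen A N"
proof -
  interpret lmod_hom_pair A M N f using assms by (simp add: lmod_hom_pairI)
  obtain B where B: "finite B" "B \<subseteq> carrier M"
    "\<forall>x \<in> carrier M. \<exists>c \<in> B \<rightarrow> carrier A. x = (\<Oplus>\<^bsub>M\<^esub>b\<in>B. c b \<odot>\<^bsub>M\<^esub> b)"
    by (rule fin_genE[OF assms(3)])
  show ?thesis
  proof (rule fin_genI_family[OF assms(2) B(1)])
    show "f \<in> B \<rightarrow> carrier N" using B(2) hom_closed by blast
    fix y assume "y \<in> carrier N"
    then obtain x where x: "x \<in> carrier M" "y = f x" using surj by blast
    obtain c where c: "c \<in> B \<rightarrow> carrier A" "x = (\<Oplus>\<^bsub>M\<^esub>b\<in>B. c b \<odot>\<^bsub>M\<^esub> b)" using bspec[OF B(3) x(1)] by blast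
    have "y = (\<Oplus>\<^bsub>N\<^esub>b\<in>B. f (c b \<odot>\<^bsub>M\<^esub> b))"
      unfolding x(2) c(2) by (rule hom_finsum) (use B(2) c(1) in \<open>auto intro!: M.smult_closed\<close>)
    also have "\<dots> = (\<Oplus>\<^bsub>N\<^esub>b\<in>B. c b \<odot>\<^bsub>N\<^esub> f b)"
      using B(2) c(1) hom_closed
      by (intro N.M.finsum_cong') (auto simp: hom_smult Pi_iff subset_iff intro!: N.smult_closed)
    finally show "\<exists>c \<in> B \<rightarrow> carrier A. y = (\<Oplus>\<^bsub>N\<^esub>b\<in>B. c b \<odot>\<^bsub>N\<^esub> f b)" using c(1) by blast
  qed
qed

lemma fin_gen_cyclic:
  fixes M :: "('a, 'm) module"
  assumes "left_module A M" "c \<in> carrier M"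
    and "\<And>x. x \<in> carrier M \<Longrightarrow> \<exists>a \<in> carrier A. x = a \<odot>\<^bsub>M\<^esub> c"
  shows "fin_gen A M"
proof -
  interpret left_module A M by fact
  show ?thesis
  proof (rule fin_genI_family[OF assms(1), of "{()}" "\<lambda>_. c"])
    fix x assume "x \<in> carrier M"
    then obtain a where "a \<in> carrier A" "x = a \<odot>\<^bsub>M\<^esub> c" using assms(3) by blast
    then show "\<exists>f \<in> {()} \<rightarrow> carrier A. x = (\<Oplus>\<^bsub>M\<^esub>i\<in>{()}. f i \<odot>\<^bsub>M\<^esub> c)"
      using assms(2) by (intro bexI[of _ "\<lambda>_. a"]) (auto simp: M.finsum_insert smult_closed)
  qed (use assms(2) in auto)
qed

lemma fg_projective_lift:
  fixes P :: "('a, 'p) module" and N L :: "'a umod"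
  assumes P: "fg_projective A P" and "left_module A N" "fin_gen A N" "left_module A L" "fin_gen A L"
    and g: "g \<in> lmod_hom A N L" and f: "f \<in> lmod_hom A P L" and surj: "g ` carrier N = carrier L"
  obtains f' where "f' \<in> lmod_hom A P N" "\<And>x. x \<in> carrier P \<Longrightarrow> g (f' x) = f x"
proof -
  have "\<forall>(N :: 'a umod) (L :: 'a umod). \<forall>g \<in> lmod_hom A N L. \<forall>f \<in> lmod_hom A P L.
        left_module A N \<and> fin_gen A N \<and> left_module A L \<and> fin_gen A L \<and>
        g ` carrier N = carrier L \<longrightarrow>
        (\<exists>f' \<in> lmod_hom A P N. \<forall>x \<in> carrier P. g (f' x) = f x)"
    using P by (simp add: fg_projective_def)
  from this[rule_format, OF g f] assms(2-5) surj that show ?thesis by blast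
qed

text \<open>Lift \<open>f \<circ> r\<close> through \<open>g\<close> and compose the lift with \<open>s\<close>.\<close>

lemma fg_projective_retract:
  fixes P :: "('a, 'p) module" and M :: "('a, 'm) module"
  assumes P: "fg_projective A P" and M: "left_module A M"
    and s: "s \<in> lmod_hom A M P" and r: "r \<in> lmod_hom A P M"
    and rs: "\<And>x. x \<in> carrier M \<Longrightarrow> r (s x) = x"
  shows "fg_projective A M"
  unfolding fg_projective_def
proof (intro conjI allI ballI impI; (elim conjE)?)
  have lP: "left_module A P" and gP: "fin_gen A P" using P by (auto simp: fg_projective_def)
  have surj: "r ` carrier P = carrier M"
    using rs lmod_homD(1)[OF s] lmod_homD(1)[OF r] by force
  show "left_module A M" "fin_gen A M" using M fin_gen_image[OF lP M gP r surj] by auto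
  fix N L :: "'a umod" and g f
  assume asm: "g \<in> lmod_hom A N L" "f \<in> lmod_hom A M L" "left_module A N" "fin_gen A N"
    "left_module A L" "fin_gen A L" "g ` carrier N = carrier L"
  obtain f' where f': "f' \<in> lmod_hom A P N" "\<And>x. x \<in> carrier P \<Longrightarrow> g (f' x) = f (r x)"
    using fg_projective_lift[OF P asm(3-6) asm(1) lmod_hom_comp[OF lP r asm(2)] asm(7)] by blast
  show "\<exists>f' \<in> lmod_hom A M N. \<forall>x \<in> carrier M. g (f' x) = f x"
    by (rule bexI[of _ "\<lambda>x. f' (s x)"])
      (use f'(2) lmod_homD(1)[OF s] rs lmod_hom_comp[OF M s f'(1)] in auto)
qed

text \<open>Cosets would live in another type. Choosing a representative of each coset realises the
  quotient on elements of \<open>M\<close>, so that quotients of modules of type \<open>umod\<close> are again of that type.\<close>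

lemma ex_quotient_module:
  fixes M :: "('a, 'm) module"
  assumes "left_module A M" "submodule U A M"
  shows "\<exists>(S :: ('a, 'm) module) q. left_module A S \<and> q \<in> lmod_hom A M S \<and>
           q ` carrier M = carrier S \<and> lmod_ker M S q = U"
proof -
  interpret left_module A M by fact
  note U = submodule_facts[OF assms(2)]
  define q where "q x = (SOME z. z \<in> carrier M \<and> x \<ominus>\<^bsub>M\<^esub> z \<in> U)" for x
  have q: "q x \<in> carrier M \<and> x \<ominus>\<^bsub>M\<^esub> q x \<in> U" if "x \<in> carrier M" for x
    unfolding q_def by (rule someI[of _ x]) (use that U(2) in \<open>auto simp: a_minus_def M.r_neg\<close>)
  have split: "x \<ominus>\<^bsub>M\<^esub> z = (x \<ominus>\<^bsub>M\<^esub> y) \<oplus>\<^bsub>M\<^esub> (y \<ominus>\<^bsub>M\<^esub> z)"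
    if "x \<in> carrier M" "y \<in> carrier M" "z \<in> carrier M" for x y z
    using that by (simp add: a_minus_def M.a_assoc M.r_neg2 M.r_neg1)
  have qI: "q x = q y" if xy: "x \<in> carrier M" "y \<in> carrier M" "x \<ominus>\<^bsub>M\<^esub> y \<in> U" for x y
  proof -
    have "y \<ominus>\<^bsub>M\<^esub> x \<in> U"
      using U(5)[OF U(2) xy(3)] xy by (simp add: a_minus_def M.minus_add M.a_comm)
    then have "x \<ominus>\<^bsub>M\<^esub> z \<in> U \<longleftrightarrow> y \<ominus>\<^bsub>M\<^esub> z \<in> U" if "z \<in> carrier M" for z
      using split[of x y z] split[of y x z] U(3) that xy by metis
    then show ?thesis unfolding q_def by metis
  qed
  have qD: "x \<ominus>\<^bsub>M\<^esub> y \<in> U" if "x \<in> carrier M" "y \<in> carrier M" "q x = q y" for x y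
  proof -
    have "x \<ominus>\<^bsub>M\<^esub> y = (x \<ominus>\<^bsub>M\<^esub> q x) \<ominus>\<^bsub>M\<^esub> (y \<ominus>\<^bsub>M\<^esub> q y)"
      using that q[of x] q[of y] split[of x "q x" y]
      by (simp add: a_minus_def M.minus_add M.a_comm)
    then show ?thesis using q[of x] q[of y] that U(5) by simp
  qed
  have qq: "q (q x) = q x" if "x \<in> carrier M" for x
    using q[OF that] qI[of x "q x"] that by auto
  have qadd: "q (q x \<oplus>\<^bsub>M\<^esub> q y) = q (x \<oplus>\<^bsub>M\<^esub> y)" if "x \<in> carrier M" "y \<in> carrier M" for x y
  proof (rule qI[symmetric])
    have "x \<oplus>\<^bsub>M\<^esub> y \<ominus>\<^bsub>M\<^esub> (q x \<oplus>\<^bsub>M\<^esub> q y) = (x \<ominus>\<^bsub>M\<^esub> q x) \<oplus>\<^bsub>M\<^esub> (y \<ominus>\<^bsub>M\<^esub> q y)"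
      using that q[of x] q[of y] by (simp add: a_minus_def M.minus_add M.a_ac)
    then show "x \<oplus>\<^bsub>M\<^esub> y \<ominus>\<^bsub>M\<^esub> (q x \<oplus>\<^bsub>M\<^esub> q y) \<in> U" using that q U(3) by simp
  qed (use that q in auto)
  have qsm: "q (a \<odot>\<^bsub>M\<^esub> q x) = q (a \<odot>\<^bsub>M\<^esub> x)" if "a \<in> carrier A" "x \<in> carrier M" for a x
  proof (rule qI[symmetric])
    have "a \<odot>\<^bsub>M\<^esub> (x \<ominus>\<^bsub>M\<^esub> q x) = a \<odot>\<^bsub>M\<^esub> x \<ominus>\<^bsub>M\<^esub> a \<odot>\<^bsub>M\<^esub> q x"
      using that q[of x]
      by (simp add: a_minus_def smult_r_distr minus_eq_smult smult_closed smult_assoc[symmetric]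
          R.l_minus R.r_minus)
    then show "a \<odot>\<^bsub>M\<^esub> x \<ominus>\<^bsub>M\<^esub> a \<odot>\<^bsub>M\<^esub> q x \<in> U" using that q U(4) by metis
  qed (use that q smult_closed in auto)
  define S :: "('a, 'm) module" where
    "S = \<lparr>carrier = q ` carrier M, monoid.mult = undefined, one = undefined,
          zero = q \<zero>\<^bsub>M\<^esub>, add = (\<lambda>x y. q (x \<oplus>\<^bsub>M\<^esub> y)), smult = (\<lambda>a x. q (a \<odot>\<^bsub>M\<^esub> x))\<rparr>"
  have qadd1: "q (q x \<oplus>\<^bsub>M\<^esub> y) = q (x \<oplus>\<^bsub>M\<^esub> y)" "q (y \<oplus>\<^bsub>M\<^esub> q x) = q (y \<oplus>\<^bsub>M\<^esub> x)"
    if "x \<in> carrier M" "y \<in> carrier M" for x y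
    using that q qadd[of "q x" y] qadd[of y "q x"] qadd[of x y] qadd[of y x] qq by auto
  have ag: "abelian_group S"
  proof (rule abelian_groupI)
    fix x assume "x \<in> carrier S"
    then obtain u where u: "u \<in> carrier M" "x = q u" by (auto simp: S_def)
    show "\<exists>y\<in>carrier S. y \<oplus>\<^bsub>S\<^esub> x = \<zero>\<^bsub>S\<^esub>"
      by (rule bexI[of _ "q (\<ominus>\<^bsub>M\<^esub> u)"]) (use u in \<open>auto simp: S_def qadd M.l_neg\<close>)
  next
    fix x y assume "x \<in> carrier S" "y \<in> carrier S"
    then show "x \<oplus>\<^bsub>S\<^esub> y = y \<oplus>\<^bsub>S\<^esub> x" by (auto simp: S_def qadd M.a_comm)
  qed (auto simp: S_def qadd qadd1 M.a_assoc)
  have "left_module_axioms A S"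
    by (rule left_module_axioms.intro)
      (auto simp: S_def qadd qsm qq smult_closed smult_l_distr smult_r_distr smult_assoc smult_one)
  then have "left_module A S" by (rule left_module.intro[OF R.ring_axioms ag])
  moreover have "q \<in> lmod_hom A M S"
    by (rule lmod_homI) (auto simp: S_def qadd qsm)
  moreover have "lmod_ker M S q = U"
  proof -
    have z: "x \<ominus>\<^bsub>M\<^esub> \<zero>\<^bsub>M\<^esub> = x" if "x \<in> carrier M" for x using that by (simp add: a_minus_def)
    show ?thesis
    proof (rule equalityI; rule subsetI)
      fix x assume "x \<in> lmod_ker M S q"
      then have x: "x \<in> carrier M" "q x = q \<zero>\<^bsub>M\<^esub>" by (auto simp: lmod_ker_def S_def)
      then show "x \<in> U" using qD[OF x(1) M.zero_closed x(2)] z[OF x(1)] by simp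
    next
      fix x assume x: "x \<in> U"
      then have xM: "x \<in> carrier M" using U(1) by blast
      then have "q x = q \<zero>\<^bsub>M\<^esub>" using qI[OF xM M.zero_closed] z[OF xM] x by simp
      then show "x \<in> lmod_ker M S q" using xM by (simp add: lmod_ker_def S_def)
    qed
  qed
  moreover have "q ` carrier M = carrier S" by (simp add: S_def)
  ultimately show ?thesis by blast
qed

section \<open>Direct sums and dual bases\<close>

lemma lmod_hom_inv:
  fixes M :: "('a, 'm) module" and N :: "('a, 'n) module"
  assumes "left_module A M" "f \<in> lmod_hom A M N" and bij: "bij_betw f (carrier M) (carrier N)"
  shows "inv_into (carrier M) f \<in> lmod_hom A N M"
proof -
  interpret left_module A M by fact
  note f = lmod_homD[OF assms(2)]
  have inv: "inv_into (carrier M) f (f x) = x" if "x \<in> carrier M" for x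
    using bij that by (simp add: bij_betw_inv_into_left)
  have ex: "\<exists>x \<in> carrier M. y = f x" if "y \<in> carrier N" for y
    using bij that by (auto simp: bij_betw_def)
  show ?thesis
  proof (rule lmod_homI)
    fix y assume "y \<in> carrier N"
    then show "inv_into (carrier M) f y \<in> carrier M" using ex inv by metis
  next
    fix y z assume "y \<in> carrier N" "z \<in> carrier N"
    then obtain u v where "u \<in> carrier M" "v \<in> carrier M" "y = f u" "z = f v" using ex by meson
    then show "inv_into (carrier M) f (y \<oplus>\<^bsub>N\<^esub> z) =
        inv_into (carrier M) f y \<oplus>\<^bsub>M\<^esub> inv_into (carrier M) f z"
      by (simp add: f(2)[symmetric] inv)
  next
    fix a y assume "a \<in> carrier A" "y \<in> carrier N"
    then obtain u where "u \<in> carrier M" "y = f u" "a \<in> carrier A" using ex by meson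
    then show "inv_into (carrier M) f (a \<odot>\<^bsub>N\<^esub> y) = a \<odot>\<^bsub>M\<^esub> inv_into (carrier M) f y"
      by (simp add: f(3)[symmetric] inv smult_closed)
  qed
qed

lemma (in left_module) smult_finsum:
  assumes "a \<in> carrier R" "g \<in> I \<rightarrow> carrier M"
  shows "a \<odot>\<^bsub>M\<^esub> (\<Oplus>\<^bsub>M\<^esub>i\<in>I. g i) = (\<Oplus>\<^bsub>M\<^esub>i\<in>I. a \<odot>\<^bsub>M\<^esub> g i)"
  using assms(2)
proof (induction I rule: infinite_finite_induct)
  case (insert i I)
  then have "(\<lambda>i. a \<odot>\<^bsub>M\<^esub> g i) \<in> insert i I \<rightarrow> carrier M" using assms(1) smult_closed by blast
  then show ?case
    using insert assms(1) by (simp add: M.finsum_insert smult_r_distr Pi_def M.finsum_closed)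
qed (auto simp: smult_r_null assms(1) M.finsum_infinite)

lemma regular_module_simps:
  "carrier (regular_module A) = carrier A" "\<zero>\<^bsub>regular_module A\<^esub> = \<zero>\<^bsub>A\<^esub>"
  "add (regular_module A) = add A" "smult (regular_module A) = monoid.mult A"
  by (simp_all add: regular_module_def)

lemma left_module_regular:
  assumes "ring A" shows "left_module A (regular_module A)"
proof -
  interpret ring A by fact
  have "abelian_group (regular_module A)"
    by (rule abelian_groupI) (auto simp: regular_module_simps a_ac intro: bexI[of _ "\<ominus>\<^bsub>A\<^esub> _"] l_neg)
  moreover have "left_module_axioms A (regular_module A)"
    by (rule left_module_axioms.intro) (auto simp: regular_module_simps l_distr r_distr m_assoc)
  ultimately show ?thesis by (rule left_module.intro[OF assms])
qed

lemma direct_sum_simps: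
  "carrier (direct_sum I F) = {f \<in> (\<Pi>\<^sub>E i\<in>I. carrier (F i)). finite {i \<in> I. f i \<noteq> \<zero>\<^bsub>F i\<^esub>}}"
  "\<zero>\<^bsub>direct_sum I F\<^esub> = (\<lambda>i\<in>I. \<zero>\<^bsub>F i\<^esub>)"
  "f \<oplus>\<^bsub>direct_sum I F\<^esub> g = (\<lambda>i\<in>I. f i \<oplus>\<^bsub>F i\<^esub> g i)"
  "a \<odot>\<^bsub>direct_sum I F\<^esub> f = (\<lambda>i\<in>I. a \<odot>\<^bsub>F i\<^esub> f i)"
  by (simp_all add: direct_sum_def)

lemma left_module_direct_sum:
  fixes F :: "'i \<Rightarrow> ('a, 'm) module"
  assumes "ring A" and F: "\<And>i. i \<in> I \<Longrightarrow> left_module A (F i)"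
  shows "left_module A (direct_sum I F)"
proof -
  interpret ring A by fact
  let ?D = "direct_sum I F"
  have mem: "f i \<in> carrier (F i)" if "f \<in> carrier ?D" "i \<in> I" for f i
    using that by (auto simp: direct_sum_simps PiE_def Pi_def)
  have ext: "f = (\<lambda>i\<in>I. f i)" if "f \<in> carrier ?D" for f
    using that by (auto simp: direct_sum_simps)
  have ag: "abelian_group (F i)" if "i \<in> I" for i
    using F[OF that] by (simp add: left_module_def)
  have z: "\<zero>\<^bsub>F i\<^esub> \<in> carrier (F i)" if "i \<in> I" for i
    using ag[OF that] by (simp add: abelian_groupE(2))
  have add: "f \<oplus>\<^bsub>?D\<^esub> g \<in> carrier ?D" if fg: "f \<in> carrier ?D" "g \<in> carrier ?D" for f g
  proof -
    have "{i \<in> I. f i \<oplus>\<^bsub>F i\<^esub> g i \<noteq> \<zero>\<^bsub>F i\<^esub>} \<subseteq>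
        {i \<in> I. f i \<noteq> \<zero>\<^bsub>F i\<^esub>} \<union> {i \<in> I. g i \<noteq> \<zero>\<^bsub>F i\<^esub>}"
    proof (rule subsetI, rule ccontr)
      fix i assume i: "i \<in> {i \<in> I. f i \<oplus>\<^bsub>F i\<^esub> g i \<noteq> \<zero>\<^bsub>F i\<^esub>}"
        "i \<notin> {i \<in> I. f i \<noteq> \<zero>\<^bsub>F i\<^esub>} \<union> {i \<in> I. g i \<noteq> \<zero>\<^bsub>F i\<^esub>}"
      then show False using abelian_groupE(5)[OF ag z] by auto
    qed
    moreover have "finite ({i \<in> I. f i \<noteq> \<zero>\<^bsub>F i\<^esub>} \<union> {i \<in> I. g i \<noteq> \<zero>\<^bsub>F i\<^esub>})"
      using fg by (auto simp: direct_sum_simps)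
    ultimately have "finite {i \<in> I. f i \<oplus>\<^bsub>F i\<^esub> g i \<noteq> \<zero>\<^bsub>F i\<^esub>}" by (rule finite_subset)
    then have "finite {i \<in> I. (f \<oplus>\<^bsub>?D\<^esub> g) i \<noteq> \<zero>\<^bsub>F i\<^esub>}"
      by (rule finite_subset[rotated]) (auto simp: direct_sum_simps)
    then show ?thesis
      using mem[OF fg(1)] mem[OF fg(2)] abelian_groupE(1)[OF ag]
      by (auto simp: direct_sum_simps(1,3))
  qed
  have smult: "a \<odot>\<^bsub>?D\<^esub> f \<in> carrier ?D" if a: "a \<in> carrier A" "f \<in> carrier ?D" for a f
  proof -
    have "finite {i \<in> I. f i \<noteq> \<zero>\<^bsub>F i\<^esub>}" using a(2) by (simp add: direct_sum_simps)
    then have "finite {i \<in> I. (a \<odot>\<^bsub>?D\<^esub> f) i \<noteq> \<zero>\<^bsub>F i\<^esub>}"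
      by (rule finite_subset[rotated])
        (use a(1) left_module.smult_r_null[OF F] in \<open>auto simp: direct_sum_simps\<close>)
    then show ?thesis
      using mem[OF a(2)] left_module.smult_closed[OF F a(1)]
      by (auto simp: direct_sum_simps(1,4))
  qed
  have zero: "\<zero>\<^bsub>?D\<^esub> \<in> carrier ?D"
  proof -
    have "{i \<in> I. \<zero>\<^bsub>?D\<^esub> i \<noteq> \<zero>\<^bsub>F i\<^esub>} = {}" by (auto simp: direct_sum_simps)
    then show ?thesis using z unfolding direct_sum_simps(1) by (auto simp: direct_sum_simps(2))
  qed
  have ag': "abelian_group ?D"
  proof (rule abelian_groupI)
    fix f assume f: "f \<in> carrier ?D"
    show "\<zero>\<^bsub>?D\<^esub> \<oplus>\<^bsub>?D\<^esub> f = f"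
      using mem[OF f] abelian_groupE(5)[OF ag] ext[OF f]
      by (simp add: direct_sum_simps cong: restrict_cong)
    have "(\<ominus>\<^bsub>A\<^esub> \<one>\<^bsub>A\<^esub>) \<odot>\<^bsub>?D\<^esub> f \<oplus>\<^bsub>?D\<^esub> f = \<zero>\<^bsub>?D\<^esub>"
      using mem[OF f] left_module.minus_eq_smult[OF F] abelian_group.l_neg[OF ag]
      by (auto simp: direct_sum_simps intro!: restrict_ext)
    then show "\<exists>g\<in>carrier ?D. g \<oplus>\<^bsub>?D\<^esub> f = \<zero>\<^bsub>?D\<^esub>" using smult[OF _ f] by blast
  next
    fix f g h assume f: "f \<in> carrier ?D" and g: "g \<in> carrier ?D"
    show "f \<oplus>\<^bsub>?D\<^esub> g = g \<oplus>\<^bsub>?D\<^esub> f"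
      unfolding direct_sum_simps by (rule restrict_ext) (use mem f g abelian_groupE(4)[OF ag] in blast)
    assume h: "h \<in> carrier ?D"
    show "f \<oplus>\<^bsub>?D\<^esub> g \<oplus>\<^bsub>?D\<^esub> h = f \<oplus>\<^bsub>?D\<^esub> (g \<oplus>\<^bsub>?D\<^esub> h)"
      unfolding direct_sum_simps
      by (rule restrict_ext) (simp add: abelian_groupE(3)[OF ag] mem[OF f] mem[OF g] mem[OF h])
  qed (use add zero in auto)
  have "left_module_axioms A ?D"
  proof (rule left_module_axioms.intro)
    fix a b f assume ab: "a \<in> carrier A" "b \<in> carrier A" and f: "f \<in> carrier ?D"
    show "(a \<oplus>\<^bsub>A\<^esub> b) \<odot>\<^bsub>?D\<^esub> f = a \<odot>\<^bsub>?D\<^esub> f \<oplus>\<^bsub>?D\<^esub> b \<odot>\<^bsub>?D\<^esub> f"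
      unfolding direct_sum_simps
      by (rule restrict_ext) (simp add: left_module.smult_l_distr[OF F] ab mem[OF f])
    show "(a \<otimes>\<^bsub>A\<^esub> b) \<odot>\<^bsub>?D\<^esub> f = a \<odot>\<^bsub>?D\<^esub> (b \<odot>\<^bsub>?D\<^esub> f)"
      unfolding direct_sum_simps
      by (rule restrict_ext) (simp add: left_module.smult_assoc[OF F] ab mem[OF f])
  next
    fix a f g assume a: "a \<in> carrier A" and f: "f \<in> carrier ?D" and g: "g \<in> carrier ?D"
    show "a \<odot>\<^bsub>?D\<^esub> (f \<oplus>\<^bsub>?D\<^esub> g) = a \<odot>\<^bsub>?D\<^esub> f \<oplus>\<^bsub>?D\<^esub> a \<odot>\<^bsub>?D\<^esub> g"
      unfolding direct_sum_simps
      by (rule restrict_ext) (simp add: left_module.smult_r_distr[OF F] a mem[OF f] mem[OF g])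
  next
    fix f assume f: "f \<in> carrier ?D"
    show "\<one>\<^bsub>A\<^esub> \<odot>\<^bsub>?D\<^esub> f = f"
      using mem[OF f] left_module.smult_one[OF F] ext[OF f]
      by (simp add: direct_sum_simps cong: restrict_cong)
  qed (use smult in auto)
  then show ?thesis by (rule left_module.intro[OF assms(1) ag'])
qed

lemma direct_sum_component_hom:
  "i \<in> I \<Longrightarrow> (\<lambda>f. f i) \<in> lmod_hom A (direct_sum I F) (F i)"
  by (rule lmod_homI) (auto simp: direct_sum_simps PiE_def Pi_def)

lemma carrier_direct_sum_finite:
  "finite I \<Longrightarrow> carrier (direct_sum I F) = (\<Pi>\<^sub>E i\<in>I. carrier (F i))"
  by (simp add: direct_sum_simps)

lemma lmod_hom_combination:
  fixes M :: "('a, 'm) module" and P :: "('a, 'p) module"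
  assumes M: "left_module A M" and P: "left_module A P"
    and \<chi>: "\<And>k. k \<in> I \<Longrightarrow> \<chi> k \<in> lmod_hom A M (regular_module A)"
    and p: "\<And>k. k \<in> I \<Longrightarrow> p k \<in> carrier P"
  shows "(\<lambda>x. \<Oplus>\<^bsub>P\<^esub>k\<in>I. \<chi> k x \<odot>\<^bsub>P\<^esub> p k) \<in> lmod_hom A M P"
proof -
  interpret M: left_module A M by (rule M)
  interpret P: left_module A P by (rule P)
  note \<chi>' = lmod_homD[OF \<chi>, unfolded regular_module_simps]
  have inP: "(\<lambda>k. \<chi> k x \<odot>\<^bsub>P\<^esub> p k) \<in> I \<rightarrow> carrier P" if "x \<in> carrier M" for x
    using that \<chi>'(1) p by (auto intro!: P.smult_closed)
  show ?thesis
  proof (rule lmod_homI)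
    show "(\<Oplus>\<^bsub>P\<^esub>k\<in>I. \<chi> k x \<odot>\<^bsub>P\<^esub> p k) \<in> carrier P" if "x \<in> carrier M" for x
      by (rule P.M.finsum_closed[OF inP[OF that]])
    show "(\<Oplus>\<^bsub>P\<^esub>k\<in>I. \<chi> k (x \<oplus>\<^bsub>M\<^esub> y) \<odot>\<^bsub>P\<^esub> p k) =
        (\<Oplus>\<^bsub>P\<^esub>k\<in>I. \<chi> k x \<odot>\<^bsub>P\<^esub> p k) \<oplus>\<^bsub>P\<^esub> (\<Oplus>\<^bsub>P\<^esub>k\<in>I. \<chi> k y \<odot>\<^bsub>P\<^esub> p k)"
      if xy: "x \<in> carrier M" "y \<in> carrier M" for x y
    proof -
      have "(\<Oplus>\<^bsub>P\<^esub>k\<in>I. \<chi> k (x \<oplus>\<^bsub>M\<^esub> y) \<odot>\<^bsub>P\<^esub> p k) =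
          (\<Oplus>\<^bsub>P\<^esub>k\<in>I. \<chi> k x \<odot>\<^bsub>P\<^esub> p k \<oplus>\<^bsub>P\<^esub> \<chi> k y \<odot>\<^bsub>P\<^esub> p k)"
        using inP[OF xy(1)] inP[OF xy(2)] xy \<chi>' p
        by (intro P.M.finsum_cong') (auto simp: P.smult_l_distr)
      then show ?thesis using P.M.finsum_addf[OF inP[OF xy(1)] inP[OF xy(2)]] by simp
    qed
    show "(\<Oplus>\<^bsub>P\<^esub>k\<in>I. \<chi> k (a \<odot>\<^bsub>M\<^esub> x) \<odot>\<^bsub>P\<^esub> p k) = a \<odot>\<^bsub>P\<^esub> (\<Oplus>\<^bsub>P\<^esub>k\<in>I. \<chi> k x \<odot>\<^bsub>P\<^esub> p k)"
      if a: "a \<in> carrier A" "x \<in> carrier M" for a x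
    proof -
      have "(\<Oplus>\<^bsub>P\<^esub>k\<in>I. \<chi> k (a \<odot>\<^bsub>M\<^esub> x) \<odot>\<^bsub>P\<^esub> p k) = (\<Oplus>\<^bsub>P\<^esub>k\<in>I. a \<odot>\<^bsub>P\<^esub> (\<chi> k x \<odot>\<^bsub>P\<^esub> p k))"
        using inP[OF a(2)] a \<chi>' p
        by (intro P.M.finsum_cong') (auto simp: P.smult_assoc intro!: P.smult_closed)
      then show ?thesis using P.smult_finsum[OF a(1) inP[OF a(2)]] by simp
    qed
  qed
qed

text \<open>The identity of \<open>P\<close> factors as \<open>P \<rightarrow> A\<^sup>m \<rightarrow> P\<close>: the \<open>\<pi> k\<close> are the coordinates of the first
  map and the \<open>p k\<close> are the images of the standard basis under the second one.\<close>

definition dual_basis :: "('a, 'c) ring_scheme \<Rightarrow> ('a, 'm) module \<Rightarrow> nat \<Rightarrow> (nat \<Rightarrow> 'm) \<Rightarrow>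
    (nat \<Rightarrow> 'm \<Rightarrow> 'a) \<Rightarrow> bool" where
  "dual_basis A P m p \<pi> \<longleftrightarrow>
     (\<forall>k<m. p k \<in> carrier P \<and> \<pi> k \<in> lmod_hom A P (regular_module A)) \<and>
     (\<forall>x \<in> carrier P. x = (\<Oplus>\<^bsub>P\<^esub>k\<in>{..<m}. \<pi> k x \<odot>\<^bsub>P\<^esub> p k))"

lemma dual_basisD:
  assumes "dual_basis A P m p \<pi>"
  shows "\<And>k. k < m \<Longrightarrow> p k \<in> carrier P"
    and "\<And>k. k < m \<Longrightarrow> \<pi> k \<in> lmod_hom A P (regular_module A)"
    and "\<And>x. x \<in> carrier P \<Longrightarrow> x = (\<Oplus>\<^bsub>P\<^esub>k\<in>{..<m}. \<pi> k x \<odot>\<^bsub>P\<^esub> p k)"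
proof -
  show "p k \<in> carrier P" "\<pi> k \<in> lmod_hom A P (regular_module A)" if "k < m" for k
    using assms that by (simp_all add: dual_basis_def)
  have "\<forall>x \<in> carrier P. x = (\<Oplus>\<^bsub>P\<^esub>k\<in>{..<m}. \<pi> k x \<odot>\<^bsub>P\<^esub> p k)"
    using assms unfolding dual_basis_def by (rule conjunct2)
  then show "\<And>x. x \<in> carrier P \<Longrightarrow> x = (\<Oplus>\<^bsub>P\<^esub>k\<in>{..<m}. \<pi> k x \<odot>\<^bsub>P\<^esub> p k)" by (rule bspec)
qed

text \<open>A finite generating set gives a surjection from some \<open>A\<^sup>m\<close> onto \<open>P\<close>; by projectivity it has
  a section, whose coordinates are the functionals.\<close>

lemma fg_projective_dual_basis:
  fixes P :: "'a umod"
  assumes P: "fg_projective A P"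
  obtains m p \<pi> where "dual_basis A P m p \<pi>"
proof -
  have lP: "left_module A P" and gP: "fin_gen A P" using P by (auto simp: fg_projective_def)
  interpret P: left_module A P by fact
  obtain B where B: "finite B" "B \<subseteq> carrier P"
    "\<forall>x \<in> carrier P. \<exists>c \<in> B \<rightarrow> carrier A. x = (\<Oplus>\<^bsub>P\<^esub>b\<in>B. c b \<odot>\<^bsub>P\<^esub> b)"
    by (rule fin_genE[OF gP])
  define m where "m = card B"
  obtain p where p: "bij_betw p {..<m} B"
    using ex_bij_betw_nat_finite[OF B(1)] by (auto simp: m_def atLeast0LessThan)
  have pP: "p k \<in> carrier P" if "k < m" for k
    using that p B(2) by (auto simp: bij_betw_def)
  have gen: "\<exists>c \<in> {..<m} \<rightarrow> carrier A. x = (\<Oplus>\<^bsub>P\<^esub>k\<in>{..<m}. c k \<odot>\<^bsub>P\<^esub> p k)"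
    if x: "x \<in> carrier P" for x
  proof -
    obtain c where c: "c \<in> B \<rightarrow> carrier A" "x = (\<Oplus>\<^bsub>P\<^esub>b\<in>B. c b \<odot>\<^bsub>P\<^esub> b)" using bspec[OF B(3) x] by blast
    have "B = p ` {..<m}" using p by (simp add: bij_betw_def)
    moreover have "(\<lambda>b. c b \<odot>\<^bsub>P\<^esub> b) \<in> B \<rightarrow> carrier P"
      using c(1) B(2) by (auto intro!: P.smult_closed)
    ultimately have "x = (\<Oplus>\<^bsub>P\<^esub>k\<in>{..<m}. c (p k) \<odot>\<^bsub>P\<^esub> p k)"
      using c(2) p P.M.finsum_reindex[of "\<lambda>b. c b \<odot>\<^bsub>P\<^esub> b" p "{..<m}"]
      by (simp add: bij_betw_def)
    moreover have "(\<lambda>k. c (p k)) \<in> {..<m} \<rightarrow> carrier A"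
      using c(1) p by (auto simp: bij_betw_def)
    ultimately show ?thesis by (rule bexI[of _ "\<lambda>k. c (p k)"])
  qed
  let ?R = "regular_module A"
  define F where "F = direct_sum {..<m} (\<lambda>_. ?R)"
  have lR: "left_module A ?R" by (rule left_module_regular) (rule P.R.ring_axioms)
  interpret R: left_module A ?R by (rule lR)
  have lF: "left_module A F"
    unfolding F_def by (rule left_module_direct_sum[OF P.R.ring_axioms lR])
  interpret F: left_module A F by (rule lF)
  have cF: "carrier F = {..<m} \<rightarrow>\<^sub>E carrier A"
    by (simp add: F_def carrier_direct_sum_finite regular_module_simps)
  have addF: "v \<oplus>\<^bsub>F\<^esub> w = (\<lambda>k\<in>{..<m}. v k \<oplus>\<^bsub>A\<^esub> w k)" for v w
    by (simp add: F_def direct_sum_simps regular_module_simps)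
  have smF: "a \<odot>\<^bsub>F\<^esub> v = (\<lambda>k\<in>{..<m}. a \<otimes>\<^bsub>A\<^esub> v k)" for a v
    by (simp add: F_def direct_sum_simps regular_module_simps)
  have comp: "(\<lambda>v. v k) \<in> lmod_hom A F ?R" if "k < m" for k
    using that unfolding F_def by (intro direct_sum_component_hom) auto
  define \<delta> where "\<delta> k = (\<lambda>j\<in>{..<m}. if j = k then \<one>\<^bsub>A\<^esub> else \<zero>\<^bsub>A\<^esub>)" for k
  have \<delta>: "\<delta> k \<in> carrier F" if "k < m" for k
    using that by (auto simp: cF \<delta>_def)
  have gF: "fin_gen A F"
  proof (rule fin_genI_family[OF lF, of "{..<m}" \<delta>])
    fix v assume v: "v \<in> carrier F"
    let ?s = "\<Oplus>\<^bsub>F\<^esub>k\<in>{..<m}. v k \<odot>\<^bsub>F\<^esub> \<delta> k"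
    have vA: "v \<in> {..<m} \<rightarrow> carrier A" using v by (auto simp: cF)
    have inF: "(\<lambda>k. v k \<odot>\<^bsub>F\<^esub> \<delta> k) \<in> {..<m} \<rightarrow> carrier F"
      using vA \<delta> by (auto intro!: F.smult_closed)
    have sF: "?s \<in> carrier F" by (rule F.M.finsum_closed[OF inF])
    have "v = ?s"
    proof (rule PiE_ext[of _ "{..<m}" "\<lambda>_. carrier A"])
      fix j assume j: "j \<in> {..<m}"
      interpret h: lmod_hom_pair A F ?R "\<lambda>v. v j"
        using lF lR comp j by (simp add: lmod_hom_pairI)
      have "?s j = (\<Oplus>\<^bsub>?R\<^esub>k\<in>{..<m}. (v k \<odot>\<^bsub>F\<^esub> \<delta> k) j)" by (rule h.hom_finsum[OF inF])
      also have "\<dots> = (\<Oplus>\<^bsub>?R\<^esub>k\<in>{..<m}. if j = k then v k else \<zero>\<^bsub>?R\<^esub>)"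
        by (rule R.M.finsum_cong')
          (use j vA in \<open>auto simp: smF \<delta>_def regular_module_simps Pi_def\<close>)
      also have "\<dots> = v j"
        by (rule R.M.finsum_singleton) (use j vA in \<open>auto simp: regular_module_simps\<close>)
      finally show "v j = ?s j" by simp
    qed (use v sF in \<open>auto simp: cF\<close>)
    then show "\<exists>c \<in> {..<m} \<rightarrow> carrier A. v = (\<Oplus>\<^bsub>F\<^esub>k\<in>{..<m}. c k \<odot>\<^bsub>F\<^esub> \<delta> k)"
      using vA by blast
  qed (use \<delta> in auto)
  define \<phi> where "\<phi> v = (\<Oplus>\<^bsub>P\<^esub>k\<in>{..<m}. v k \<odot>\<^bsub>P\<^esub> p k)" for v
  have inP: "(\<lambda>k. v k \<odot>\<^bsub>P\<^esub> p k) \<in> {..<m} \<rightarrow> carrier P" if "v \<in> carrier F" for v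
    using that pP by (auto simp: cF intro!: P.smult_closed)
  have \<phi>: "\<phi> \<in> lmod_hom A F P"
    unfolding \<phi>_def by (rule lmod_hom_combination[OF lF lP]) (use comp pP in auto)
  have \<phi>surj: "\<exists>v \<in> carrier F. \<phi> v = x" if x: "x \<in> carrier P" for x
  proof -
    obtain c where c: "c \<in> {..<m} \<rightarrow> carrier A" "x = (\<Oplus>\<^bsub>P\<^esub>k\<in>{..<m}. c k \<odot>\<^bsub>P\<^esub> p k)"
      using gen[OF x] by blast
    have r: "restrict c {..<m} \<in> carrier F" using c(1) by (simp add: cF)
    have "\<phi> (restrict c {..<m}) = x"
      unfolding \<phi>_def c(2) using inP[OF r]
      by (intro P.M.finsum_cong') (use c(1) pP in \<open>auto intro!: P.smult_closed\<close>)
    then show ?thesis using r by blast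
  qed
  \<comment> \<open>The lifting property speaks about modules of type \<open>umod\<close> only; singletons embed \<open>A\<^sup>m\<close> there.\<close>
  obtain N :: "'a umod" where N: "left_module A N" "(\<lambda>v. {v}) \<in> lmod_hom A F N"
    "bij_betw (\<lambda>v. {v}) (carrier F) (carrier N)"
    using transport_left_module[OF lF, of "\<lambda>v. {v}"] by auto
  have gN: "fin_gen A N"
    using fin_gen_image[OF lF N(1) gF N(2)] N(3) by (simp add: bij_betw_def)
  define u where "u = inv_into (carrier F) (\<lambda>v. {v})"
  have u: "u \<in> lmod_hom A N F" unfolding u_def by (rule lmod_hom_inv[OF lF N(2,3)])
  have uv: "u {v} = v" if "v \<in> carrier F" for v
    using bij_betw_inv_into_left[OF N(3) that] by (simp add: u_def)
  have surj: "(\<lambda>n. \<phi> (u n)) ` carrier N = carrier P"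
  proof
    show "(\<lambda>n. \<phi> (u n)) ` carrier N \<subseteq> carrier P"
      using lmod_homD(1)[OF lmod_hom_comp[OF N(1) u \<phi>]] by blast
    show "carrier P \<subseteq> (\<lambda>n. \<phi> (u n)) ` carrier N"
    proof
      fix x assume "x \<in> carrier P"
      then obtain v where v: "v \<in> carrier F" "\<phi> v = x" using \<phi>surj by blast
      have "{v} \<in> carrier N" using N(3) v(1) by (auto simp: bij_betw_def)
      then show "x \<in> (\<lambda>n. \<phi> (u n)) ` carrier N" using uv[OF v(1)] v(2) by (intro image_eqI) auto
    qed
  qed
  have id: "(\<lambda>x. x) \<in> lmod_hom A P P" by (rule lmod_homI) simp_all
  obtain \<sigma> where \<sigma>: "\<sigma> \<in> lmod_hom A P N" "\<And>x. x \<in> carrier P \<Longrightarrow> \<phi> (u (\<sigma> x)) = x"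
    using fg_projective_lift[OF P N(1) gN lP gP lmod_hom_comp[OF N(1) u \<phi>] id surj] by blast
  have "dual_basis A P m p (\<lambda>k x. u (\<sigma> x) k)"
    unfolding dual_basis_def
  proof (intro conjI allI impI ballI)
    show "p k \<in> carrier P" if "k < m" for k by (rule pP[OF that])
    show "(\<lambda>x. u (\<sigma> x) k) \<in> lmod_hom A P ?R" if "k < m" for k
      by (rule lmod_hom_comp[OF lP lmod_hom_comp[OF lP \<sigma>(1) u] comp[OF that]])
    show "x = (\<Oplus>\<^bsub>P\<^esub>k\<in>{..<m}. u (\<sigma> x) k \<odot>\<^bsub>P\<^esub> p k)" if "x \<in> carrier P" for x
      using \<sigma>(2)[OF that] unfolding \<phi>_def by simp
  qed
  then show thesis by (rule that)
qed

section \<open>Linear dependence and local corner rings\<close>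

definition lin_span :: "('k, 'c) ring_scheme \<Rightarrow> ('k, 'v, 'd) module_scheme \<Rightarrow> 'v set \<Rightarrow> 'v set" where
  "lin_span K V T = \<Inter> {H. submodule H K V \<and> T \<subseteq> H}"

lemma lin_span_mono: "T \<subseteq> Y \<Longrightarrow> lin_span K V T \<subseteq> lin_span K V Y"
  unfolding lin_span_def by blast

lemma lin_span_base: "x \<in> T \<Longrightarrow> x \<in> lin_span K V T"
  unfolding lin_span_def by blast

lemma lin_span_least: "\<lbrakk>submodule H K V; T \<subseteq> H\<rbrakk> \<Longrightarrow> lin_span K V T \<subseteq> H"
  unfolding lin_span_def by blast

context left_module begin

lemma submodule_lin_span:
  assumes "T \<subseteq> carrier M" shows "submodule (lin_span R M T) R M"
proof (rule submoduleI)
  show "lin_span R M T \<subseteq> carrier M" by (rule lin_span_least[OF submodule_carrier assms])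
qed (auto simp: lin_span_def submodule_facts)

lemmas lin_span_facts = submodule_facts[OF submodule_lin_span]

lemma lin_span_insert:
  assumes T: "T \<subseteq> carrier M" "b \<in> carrier M" and x: "x \<in> lin_span R M (insert b T)"
  obtains k w where "k \<in> carrier R" "w \<in> lin_span R M T" "x = k \<odot>\<^bsub>M\<^esub> b \<oplus>\<^bsub>M\<^esub> w"
proof -
  define H where "H = {k \<odot>\<^bsub>M\<^esub> b \<oplus>\<^bsub>M\<^esub> w | k w. k \<in> carrier R \<and> w \<in> lin_span R M T}"
  note span = lin_span_facts[OF T(1)]
  have HI: "k \<odot>\<^bsub>M\<^esub> b \<oplus>\<^bsub>M\<^esub> w \<in> H" if "k \<in> carrier R" "w \<in> lin_span R M T" for k w
    using that by (auto simp: H_def)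
  have "submodule H R M"
  proof (rule submoduleI)
    show "H \<subseteq> carrier M" using span(1) T(2) smult_closed by (auto simp: H_def)
    show "\<zero>\<^bsub>M\<^esub> \<in> H" using HI[OF R.zero_closed span(2)] T(2) by (simp add: smult_l_null)
  next
    fix y z assume "y \<in> H" "z \<in> H"
    then obtain k w l v where *: "k \<in> carrier R" "w \<in> lin_span R M T" "y = k \<odot>\<^bsub>M\<^esub> b \<oplus>\<^bsub>M\<^esub> w"
      "l \<in> carrier R" "v \<in> lin_span R M T" "z = l \<odot>\<^bsub>M\<^esub> b \<oplus>\<^bsub>M\<^esub> v"
      by (auto simp: H_def)
    moreover have "w \<in> carrier M" "v \<in> carrier M" using * span(1) by auto
    ultimately have "y \<oplus>\<^bsub>M\<^esub> z = (k \<oplus> l) \<odot>\<^bsub>M\<^esub> b \<oplus>\<^bsub>M\<^esub> (w \<oplus>\<^bsub>M\<^esub> v)"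
      using T(2) smult_closed by (simp add: smult_l_distr M.a_ac)
    then show "y \<oplus>\<^bsub>M\<^esub> z \<in> H" using HI * span(3) by simp
  next
    fix a y assume a: "a \<in> carrier R" and "y \<in> H"
    then obtain k w where *: "k \<in> carrier R" "w \<in> lin_span R M T" "y = k \<odot>\<^bsub>M\<^esub> b \<oplus>\<^bsub>M\<^esub> w"
      by (auto simp: H_def)
    moreover have "w \<in> carrier M" using * span(1) by auto
    ultimately have "a \<odot>\<^bsub>M\<^esub> y = (a \<otimes> k) \<odot>\<^bsub>M\<^esub> b \<oplus>\<^bsub>M\<^esub> a \<odot>\<^bsub>M\<^esub> w"
      using T(2) a smult_closed by (simp add: smult_r_distr smult_assoc)
    then show "a \<odot>\<^bsub>M\<^esub> y \<in> H" using HI * a span(4) by simp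
  qed
  moreover have "insert b T \<subseteq> H"
  proof
    fix y assume "y \<in> insert b T"
    then show "y \<in> H"
    proof
      assume "y = b"
      then show ?thesis using HI[OF R.one_closed span(2)] T(2) by (simp add: smult_one)
    next
      assume y: "y \<in> T"
      then have "y \<in> carrier M" using T(1) by blast
      then show ?thesis using HI[OF R.zero_closed lin_span_base[OF y]] T(2) by (simp add: smult_l_null)
    qed
  qed
  ultimately have "x \<in> H" using lin_span_least x by blast
  then show thesis using that by (auto simp: H_def)
qed

text \<open>This takes the place of dimension theory: in an infinite sequence, some term depends
  linearly on terms after it. The induction removes one spanning vector \<open>b\<close>. If the coefficients at \<open>b\<close>
  are zero from some point on, pass to that tail. Otherwise every term has a later one with
  nonzero coefficient at \<open>b\<close>, and subtracting a multiple of it cancels \<open>b\<close>.\<close>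

lemma ex_in_span_of_later_terms:
  fixes u :: "nat \<Rightarrow> _"
  assumes "field R" and "finite B" "B \<subseteq> carrier M" "\<And>i. u i \<in> lin_span R M B"
  shows "\<exists>n. u n \<in> lin_span R M {u j | j. j > n}"
  using assms(2-)
proof (induction B arbitrary: u rule: finite_induct)
  case empty
  have "lin_span R M {} \<subseteq> {\<zero>\<^bsub>M\<^esub>}" by (rule lin_span_least[OF submodule_zero]) simp
  then have u0: "u i = \<zero>\<^bsub>M\<^esub>" for i using empty by blast
  have "{u j | j. j > 0} \<subseteq> carrier M" by (auto simp: u0)
  from lin_span_facts(2)[OF this] show ?case using u0[of 0] by (intro exI[of _ 0]) simp
next
  case (insert b B)
  interpret field R by fact
  have B: "B \<subseteq> carrier M" "b \<in> carrier M" using insert.prems by auto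
  have "\<forall>i. \<exists>k w. k \<in> carrier R \<and> w \<in> lin_span R M B \<and> u i = k \<odot>\<^bsub>M\<^esub> b \<oplus>\<^bsub>M\<^esub> w"
    using lin_span_insert[OF B insert.prems(2)] by metis
  then obtain \<beta> w where \<beta>: "\<And>i. \<beta> i \<in> carrier R" and w: "\<And>i. w i \<in> lin_span R M B"
    and u: "\<And>i. u i = \<beta> i \<odot>\<^bsub>M\<^esub> b \<oplus>\<^bsub>M\<^esub> w i"
    by metis
  have wM: "w i \<in> carrier M" for i using lin_span_facts(1)[OF B(1)] w by blast
  have uM: "u i \<in> carrier M" for i using u \<beta> wM B smult_closed by simp
  have tailM: "{u j | j. j > n} \<subseteq> carrier M" for n using uM by blast
  show ?case
  proof (cases "\<exists>n. \<forall>j\<ge>n. \<beta> j = \<zero>")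
    case True
    then obtain n where n: "\<And>j. j \<ge> n \<Longrightarrow> \<beta> j = \<zero>" by blast
    define v where "v i = u (n + i)" for i
    have "v i \<in> lin_span R M B" for i
      unfolding v_def u using n[of "n + i"] w[of "n + i"] wM B by (simp add: smult_l_null)
    then obtain m where m: "v m \<in> lin_span R M {v j | j. j > m}" using insert.IH[OF B(1)] by blast
    have "{v j | j. j > m} \<subseteq> {u j | j. j > n + m}" by (auto simp: v_def)
    then show ?thesis using m lin_span_mono unfolding v_def by blast
  next
    case False
    have "\<exists>j>n. \<beta> j \<noteq> \<zero>" for n
      using False Suc_le_lessD by metis
    then obtain s where s: "\<And>n. s n > n" "\<And>n. \<beta> (s n) \<noteq> \<zero>" by metis
    define \<gamma> where "\<gamma> n = \<beta> n \<otimes> inv (\<beta> (s n))" for n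
    have inv: "inv (\<beta> (s n)) \<in> carrier R" "inv (\<beta> (s n)) \<otimes> \<beta> (s n) = \<one>" for n
      using \<beta> s(2) field_Units by auto
    have \<gamma>: "\<gamma> n \<in> carrier R" for n using \<beta> inv by (simp add: \<gamma>_def)
    have \<gamma>\<beta>: "\<gamma> n \<otimes> \<beta> (s n) = \<beta> n" for n
      using \<beta> inv by (simp add: \<gamma>_def m_assoc)
    define v where "v n = (\<ominus> \<gamma> n) \<odot>\<^bsub>M\<^esub> u (s n) \<oplus>\<^bsub>M\<^esub> u n" for n
    have v: "v n = (\<ominus> \<gamma> n) \<odot>\<^bsub>M\<^esub> w (s n) \<oplus>\<^bsub>M\<^esub> w n" for n
    proof -
      have "(\<ominus> \<gamma> n) \<odot>\<^bsub>M\<^esub> u (s n) = (\<ominus> \<beta> n) \<odot>\<^bsub>M\<^esub> b \<oplus>\<^bsub>M\<^esub> (\<ominus> \<gamma> n) \<odot>\<^bsub>M\<^esub> w (s n)"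
        using \<gamma> \<beta> wM B smult_closed \<gamma>\<beta>[of n]
        by (simp add: u smult_r_distr smult_assoc[symmetric] R.l_minus)
      then have "v n = ((\<ominus> \<beta> n) \<odot>\<^bsub>M\<^esub> b \<oplus>\<^bsub>M\<^esub> \<beta> n \<odot>\<^bsub>M\<^esub> b) \<oplus>\<^bsub>M\<^esub> ((\<ominus> \<gamma> n) \<odot>\<^bsub>M\<^esub> w (s n) \<oplus>\<^bsub>M\<^esub> w n)"
        unfolding v_def u[of n] using \<gamma> \<beta> wM B smult_closed
        by (simp add: M.a_ac)
      then show ?thesis
        using \<gamma> \<beta> wM B smult_closed
        by (simp add: smult_l_distr[symmetric] R.l_neg smult_l_null)
    qed
    have "v n \<in> lin_span R M B" for n
      unfolding v using \<gamma> w by (intro lin_span_facts(3,4)[OF B(1)]) auto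
    then obtain m where m: "v m \<in> lin_span R M {v j | j. j > m}" using insert.IH[OF B(1)] by blast
    have "{v j | j. j > m} \<subseteq> lin_span R M {u j | j. j > m}"
    proof
      fix x assume "x \<in> {v j | j. j > m}"
      then obtain j where j: "j > m" "x = v j" by blast
      have "u j \<in> {u j | j. j > m}" "u (s j) \<in> {u j | j. j > m}"
        using j s(1)[of j] less_trans by blast+
      then show "x \<in> lin_span R M {u j | j. j > m}"
        unfolding j v_def
        by (intro lin_span_facts(3,4)[OF tailM] lin_span_base) (simp_all add: \<gamma>)
    qed
    then have vm: "v m \<in> lin_span R M {u j | j. j > m}" using m lin_span_least[OF submodule_lin_span[OF tailM]] by blast
    have us: "\<gamma> m \<odot>\<^bsub>M\<^esub> u (s m) \<in> lin_span R M {u j | j. j > m}"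
      by (intro lin_span_facts(4)[OF tailM] lin_span_base \<gamma>) (use s(1) in blast)
    have "\<gamma> m \<odot>\<^bsub>M\<^esub> u (s m) \<oplus>\<^bsub>M\<^esub> v m = u m"
      unfolding v_def using \<gamma> uM smult_closed
      by (simp add: M.a_assoc[symmetric] smult_l_distr[symmetric] R.r_neg smult_l_null)
    then show ?thesis using lin_span_facts(3)[OF tailM us vm] by metis
  qed
qed

lemma fin_gen_ex_span:
  assumes "fin_gen R M"
  obtains B where "finite B" "B \<subseteq> carrier M" "carrier M \<subseteq> lin_span R M B"
proof -
  obtain B where B: "finite B" "B \<subseteq> carrier M"
    "\<forall>x \<in> carrier M. \<exists>c \<in> B \<rightarrow> carrier R. x = (\<Oplus>\<^bsub>M\<^esub>b\<in>B. c b \<odot>\<^bsub>M\<^esub> b)"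
    by (rule fin_genE[OF assms])
  have "x \<in> lin_span R M B" if x: "x \<in> carrier M" for x
  proof -
    obtain c where c: "c \<in> B \<rightarrow> carrier R" "x = (\<Oplus>\<^bsub>M\<^esub>b\<in>B. c b \<odot>\<^bsub>M\<^esub> b)" using bspec[OF B(3) x] by blast
    show ?thesis unfolding c(2)
      by (rule finsum_in_submodule[OF submodule_lin_span[OF B(2)]])
        (use c(1) in \<open>auto intro!: lin_span_facts(4)[OF B(2) _ lin_span_base]\<close>)
  qed
  then show thesis using that[OF B(1,2)] by blast
qed

end

lemma left_module_if_module:
  assumes "module R M" shows "left_module R M"
proof -
  interpret module R M by fact
  show ?thesis
    by (intro left_module.intro left_module_axioms.intro R.ring_axioms M.abelian_group_axioms)
      (simp_all add: smult_l_distr smult_r_distr smult_assoc1)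
qed

locale fin_dim_algebra_over_field =
  fixes K :: "('k, 'c) ring_scheme" and A :: "('k, 'a) module" (structure)
  assumes fin_dim: "fin_dim_algebra K A" and field: "field K"
begin

sublocale KA: assoc_algebra K A
  using fin_dim by (simp add: fin_dim_algebra_def)

sublocale KV: left_module K A
  by (rule left_module_if_module) (rule KA.module_axioms)

lemma ex_in_span_of_later_elements:
  fixes u :: "nat \<Rightarrow> 'a"
  assumes "\<And>i. u i \<in> carrier A"
  shows "\<exists>n. u n \<in> lin_span K A {u j | j. j > n}"
proof -
  have "fin_gen K A" using fin_dim by (simp add: fin_dim_algebra_def)
  then obtain B where B: "finite B" "B \<subseteq> carrier A" "carrier A \<subseteq> lin_span K A B"
    by (rule KV.fin_gen_ex_span)
  then show ?thesis using KV.ex_in_span_of_later_terms[OF field B(1,2)] assms by blast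
qed

text \<open>Some power of \<open>x\<close> is a linear combination of higher powers. Factoring out the
  lowest of these leaves a polynomial in \<open>x\<close>, which commutes with \<open>x\<close>.\<close>

lemma strongly_pi_regular:
  assumes x: "x \<in> carrier A"
  obtains m :: nat and q where "m > 0" "q \<in> carrier A" "q \<otimes> x = x \<otimes> q" "x [^] m = x [^] Suc m \<otimes> q"
proof -
  obtain n where n: "x [^] Suc n \<in> lin_span K A {x [^] Suc j | j. j > n}"
    using ex_in_span_of_later_elements[of "\<lambda>i. x [^] Suc i"] x by auto
  define H where "H = {x [^] Suc (Suc n) \<otimes> q | q. q \<in> carrier A \<and> q \<otimes> x = x \<otimes> q}"
  have HI: "x [^] Suc (Suc n) \<otimes> q \<in> H" if "q \<in> carrier A" "q \<otimes> x = x \<otimes> q" for q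
    using that by (auto simp: H_def)
  have "submodule H K A"
  proof (rule KV.submoduleI)
    show "H \<subseteq> carrier A" using x by (auto simp: H_def)
    show "\<zero> \<in> H" using HI[of \<zero>] x by simp
  next
    fix y z assume "y \<in> H" "z \<in> H"
    then obtain q r where *: "q \<in> carrier A" "q \<otimes> x = x \<otimes> q" "y = x [^] Suc (Suc n) \<otimes> q"
      "r \<in> carrier A" "r \<otimes> x = x \<otimes> r" "z = x [^] Suc (Suc n) \<otimes> r"
      by (auto simp: H_def)
    then have "y \<oplus> z = x [^] Suc (Suc n) \<otimes> (q \<oplus> r)"
      using x by (simp add: KA.r_distr del: KA.nat_pow_Suc)
    then show "y \<oplus> z \<in> H" using HI[of "q \<oplus> r"] * x by (simp add: KA.r_distr KA.l_distr)
  next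
    fix k y assume k: "k \<in> carrier K" and "y \<in> H"
    then obtain q where *: "q \<in> carrier A" "q \<otimes> x = x \<otimes> q" "y = x [^] Suc (Suc n) \<otimes> q"
      by (auto simp: H_def)
    then have "k \<odot>\<^bsub>A\<^esub> y = x [^] Suc (Suc n) \<otimes> (k \<odot>\<^bsub>A\<^esub> q)"
      using x k by (simp add: KA.smult_mult_right del: KA.nat_pow_Suc)
    then show "k \<odot>\<^bsub>A\<^esub> y \<in> H"
      using HI[of "k \<odot>\<^bsub>A\<^esub> q"] * x k KV.smult_closed
      by (simp add: KA.smult_mult_left KA.smult_mult_right)
  qed
  moreover have "{x [^] Suc j | j. j > n} \<subseteq> H"
  proof
    fix y assume "y \<in> {x [^] Suc j | j. j > n}"
    then obtain j where j: "y = x [^] Suc j" "j > n" by blast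
    define l where "l = j - Suc n"
    have "Suc j = Suc (Suc n) + l" using j by (simp add: l_def)
    then have "y = x [^] Suc (Suc n) \<otimes> x [^] l" unfolding j using x by (metis KA.nat_pow_mult)
    moreover have "x [^] l \<otimes> x = x \<otimes> x [^] l" using x by (metis KA.nat_pow_Suc KA.nat_pow_Suc2)
    ultimately show "y \<in> H" using HI[of "x [^] l"] x by simp
  qed
  ultimately have "x [^] Suc n \<in> H" using lin_span_least n by blast
  then show thesis using that[of "Suc n"] by (auto simp: H_def)
qed

text \<open>All terms after the \<open>n\<close>-th lie in \<open>y (Suc n) A\<close>, which is a subspace; so does
  a term that is a combination of later ones.\<close>

lemma product_sequence_stabilizes:
  fixes y x :: "nat \<Rightarrow> 'a"
  assumes y: "\<And>i. y i \<in> carrier A" and x: "\<And>i. x i \<in> carrier A"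
    and yx: "\<And>i. y (Suc i) = y i \<otimes> x i"
  shows "\<exists>n. \<exists>z \<in> carrier A. y n = y (Suc n) \<otimes> z"
proof -
  obtain n where n: "y n \<in> lin_span K A {y j | j. j > n}"
    using ex_in_span_of_later_elements[of y] y by blast
  have later: "\<exists>z \<in> carrier A. y (Suc n + l) = y (Suc n) \<otimes> z" for l
  proof (induction l)
    case 0
    show ?case by (rule bexI[of _ \<one>]) (use y in auto)
  next
    case (Suc l)
    then obtain z where "z \<in> carrier A" "y (Suc n + l) = y (Suc n) \<otimes> z" by blast
    then show ?case by (intro bexI[of _ "z \<otimes> x (Suc n + l)"]) (use x y in \<open>auto simp: yx KA.m_assoc\<close>)
  qed
  define H where "H = {y (Suc n) \<otimes> z | z. z \<in> carrier A}"
  have HI: "y (Suc n) \<otimes> z \<in> H" if "z \<in> carrier A" for z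
    using that by (auto simp: H_def)
  have "submodule H K A"
  proof (rule KV.submoduleI)
    show "H \<subseteq> carrier A" using y by (auto simp: H_def)
    show "\<zero> \<in> H" using HI[of \<zero>] y by simp
  next
    fix v w assume "v \<in> H" "w \<in> H"
    then obtain z z' where *: "z \<in> carrier A" "v = y (Suc n) \<otimes> z" "z' \<in> carrier A" "w = y (Suc n) \<otimes> z'"
      by (auto simp: H_def)
    then have "v \<oplus> w = y (Suc n) \<otimes> (z \<oplus> z')" using y by (simp add: KA.r_distr)
    then show "v \<oplus> w \<in> H" using HI * by simp
  next
    fix k v assume k: "k \<in> carrier K" and "v \<in> H"
    then obtain z where *: "z \<in> carrier A" "v = y (Suc n) \<otimes> z" by (auto simp: H_def)
    then have "k \<odot>\<^bsub>A\<^esub> v = y (Suc n) \<otimes> (k \<odot>\<^bsub>A\<^esub> z)" using y k by (simp add: KA.smult_mult_right)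
    then show "k \<odot>\<^bsub>A\<^esub> v \<in> H" using HI * k KV.smult_closed by simp
  qed
  moreover have "{y j | j. j > n} \<subseteq> H"
  proof
    fix v assume "v \<in> {y j | j. j > n}"
    then obtain j where "v = y j" "j > n" by blast
    then show "v \<in> H" using later[of "j - Suc n"] HI by auto
  qed
  ultimately have "y n \<in> H" using lin_span_least n by blast
  then show ?thesis by (auto simp: H_def)
qed

end

definition primitive_idempotent :: "('a, 'c) ring_scheme \<Rightarrow> 'a \<Rightarrow> bool" where
  "primitive_idempotent A e \<longleftrightarrow> e \<in> carrier A \<and> e \<noteq> \<zero>\<^bsub>A\<^esub> \<and> e \<otimes>\<^bsub>A\<^esub> e = e \<and>
     (\<forall>g \<in> carrier A. g \<otimes>\<^bsub>A\<^esub> g = g \<and> e \<otimes>\<^bsub>A\<^esub> g = g \<and> g \<otimes>\<^bsub>A\<^esub> e = g \<longrightarrow> g = \<zero>\<^bsub>A\<^esub> \<or> g = e)"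

text \<open>The corner ring \<open>eAe\<close> of an idempotent \<open>e\<close>, whose unit is \<open>e\<close>.\<close>

definition corner :: "('a, 'c) ring_scheme \<Rightarrow> 'a \<Rightarrow> 'a set" where
  "corner A e = {x \<in> carrier A. e \<otimes>\<^bsub>A\<^esub> x = x \<and> x \<otimes>\<^bsub>A\<^esub> e = x}"

definition nilpotent :: "('a, 'c) ring_scheme \<Rightarrow> 'a \<Rightarrow> bool" where
  "nilpotent A x \<longleftrightarrow> (\<exists>m::nat. x [^]\<^bsub>A\<^esub> m = \<zero>\<^bsub>A\<^esub>)"

context fin_dim_algebra_over_field begin

text \<open>Fitting's lemma. If \<open>x\<^sup>m = x\<^sup>m\<^sup>+\<^sup>1q\<close> with \<open>q\<close> commuting with \<open>x\<close>, then \<open>g = x\<^sup>mq\<^sup>m\<close> is an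
  idempotent of \<open>eAe\<close> with \<open>x\<^sup>mg = x\<^sup>m\<close>. As \<open>e\<close> is primitive, either \<open>g = 0\<close> and \<open>x\<^sup>m = 0\<close>, or \<open>g = e\<close> and
  \<open>x\<^sup>m\<^sup>-\<^sup>1q\<^sup>m\<close> is inverse to \<open>x\<close> up to multiplication with \<open>e\<close>.\<close>

lemma corner_nilpotent_or_unit:
  assumes e: "primitive_idempotent A e" and x: "x \<in> corner A e"
  shows "nilpotent A x \<or> (\<exists>b \<in> corner A e. x \<otimes> b = e \<and> b \<otimes> x = e)"
proof -
  have eA: "e \<in> carrier A" "e \<otimes> e = e" using e by (auto simp: primitive_idempotent_def)
  have xA: "x \<in> carrier A" "e \<otimes> x = x" "x \<otimes> e = x" using x by (auto simp: corner_def)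
  obtain m :: nat and q where m: "m > 0" and q: "q \<in> carrier A" "q \<otimes> x = x \<otimes> q"
    and mq: "x [^] m = x [^] Suc m \<otimes> q"
    by (rule strongly_pi_regular[OF xA(1)])
  obtain l where l: "m = Suc l" using m gr0_conv_Suc by blast
  have comm: "q [^] j \<otimes> x = x \<otimes> q [^] j" for j :: nat
    using KA.group_commutes_pow[OF q(2)] q(1) xA(1) by simp
  have comm2: "q [^] j \<otimes> x [^] i = x [^] i \<otimes> q [^] j" for i j :: nat
    using KA.group_commutes_pow[OF comm[symmetric]] q(1) xA(1) by simp
  have iter: "x [^] m = x [^] (m + j) \<otimes> q [^] j" for j :: nat
  proof (induction j)
    case (Suc j)
    have "x [^] (m + j) = x [^] j \<otimes> (x [^] Suc m \<otimes> q)"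
      unfolding mq[symmetric] using xA(1) by (simp add: KA.nat_pow_mult add.commute)
    also have "\<dots> = x [^] (m + Suc j) \<otimes> q"
      using xA(1) q(1) KA.nat_pow_mult[of x j "Suc m"]
      by (simp add: KA.m_assoc[symmetric] add.commute del: KA.nat_pow_Suc)
    finally have "x [^] (m + j) \<otimes> q [^] j = x [^] (m + Suc j) \<otimes> q \<otimes> q [^] j"
      by (rule arg_cong)
    also have "\<dots> = x [^] (m + Suc j) \<otimes> q [^] Suc j"
      unfolding KA.nat_pow_Suc2[OF q(1)] using xA(1) q(1) by (simp add: KA.m_assoc)
    finally show ?case using Suc by simp
  qed (use xA in simp)
  have "x [^] m \<otimes> (x [^] m \<otimes> q [^] m) = x [^] (m + m) \<otimes> q [^] m"
    using xA(1) q(1) by (simp add: KA.nat_pow_mult KA.m_assoc[symmetric])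
  also have "\<dots> = x [^] m" by (rule iter[symmetric])
  finally have sq: "x [^] m \<otimes> (x [^] m \<otimes> q [^] m) = x [^] m" .
  define g where "g = x [^] m \<otimes> q [^] m"
  have gA: "g \<in> carrier A" using xA(1) q(1) by (simp add: g_def)
  have g2: "g = q [^] m \<otimes> x [^] m" by (simp add: g_def comm2)
  have "g \<otimes> g = q [^] m \<otimes> (x [^] m \<otimes> g)"
    using gA xA(1) q(1) by (subst (1) g2) (simp add: KA.m_assoc)
  then have "g \<otimes> g = g" using sq g2 by (simp add: g_def[symmetric])
  moreover have "e \<otimes> x [^] m = x [^] m"
    unfolding l KA.nat_pow_Suc2[OF xA(1)] using eA xA by (simp add: KA.m_assoc[symmetric])
  then have "e \<otimes> g = g"
    unfolding g_def using eA xA(1) q(1) by (simp add: KA.m_assoc[symmetric])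
  moreover have "x [^] m \<otimes> e = x [^] m"
    unfolding l KA.nat_pow_Suc using eA xA by (simp add: KA.m_assoc)
  then have "g \<otimes> e = g" unfolding g2 using eA xA(1) q(1) by (simp add: KA.m_assoc)
  ultimately have "g = \<zero> \<or> g = e" using e gA unfolding primitive_idempotent_def by blast
  then show ?thesis
  proof
    assume "g = \<zero>"
    then have "x [^] m = \<zero>" using sq xA(1) by (simp add: g_def[symmetric])
    then show ?thesis by (auto simp: nilpotent_def)
  next
    assume ge: "g = e"
    define b where "b = e \<otimes> (x [^] l \<otimes> q [^] m) \<otimes> e"
    have "x \<otimes> b = x \<otimes> (x [^] l \<otimes> q [^] m) \<otimes> e"
      unfolding b_def using eA xA q(1) by (simp add: KA.m_assoc[symmetric])
    also have "x \<otimes> (x [^] l \<otimes> q [^] m) = g"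
      unfolding g_def using xA(1) q(1) KA.nat_pow_Suc2[OF xA(1), of l]
      by (simp add: l KA.m_assoc[symmetric])
    finally have 1: "x \<otimes> b = e" using ge eA by simp
    have "b \<otimes> x = e \<otimes> ((x [^] l \<otimes> q [^] m) \<otimes> x)"
      unfolding b_def using eA xA q(1) by (simp add: KA.m_assoc)
    also have "(x [^] l \<otimes> q [^] m) \<otimes> x = g"
      unfolding g_def using xA(1) q(1) comm[of m] by (simp add: l KA.m_assoc)
    finally have 2: "b \<otimes> x = e" using ge eA by simp
    have "b \<in> corner A e"
      unfolding corner_def b_def using eA xA(1) q(1) by (simp add: KA.m_assoc[symmetric]) (simp add: KA.m_assoc)
    then show ?thesis using 1 2 by blast
  qed
qed

text \<open>If \<open>xa\<close> were a unit, then \<open>x\<close> could be cancelled on the right in \<open>x\<^sup>k\<^sup>+\<^sup>1 = 0\<close>, and a descent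
  from a vanishing power of \<open>x\<close> would end at \<open>e = 0\<close>.\<close>

lemma corner_nilpotent_mult:
  assumes e: "primitive_idempotent A e" and x: "x \<in> corner A e" "nilpotent A x" and a: "a \<in> corner A e"
  shows "nilpotent A (x \<otimes> a)"
proof (rule ccontr)
  assume nn: "\<not> nilpotent A (x \<otimes> a)"
  have eA: "e \<in> carrier A" "e \<noteq> \<zero>" using e by (auto simp: primitive_idempotent_def)
  have xA: "x \<in> carrier A" "e \<otimes> x = x" "x \<otimes> e = x" using x by (auto simp: corner_def)
  have aA: "a \<in> carrier A" "e \<otimes> a = a" "a \<otimes> e = a" using a by (auto simp: corner_def)
  have "x \<otimes> a \<in> corner A e"
    using xA aA eA by (auto simp: corner_def KA.m_assoc) (simp add: KA.m_assoc[symmetric])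
  then obtain b where b: "b \<in> corner A e" "x \<otimes> a \<otimes> b = e"
    using corner_nilpotent_or_unit[OF e] nn by blast
  have bA: "b \<in> carrier A" using b by (simp add: corner_def)
  have "x [^] k \<otimes> e \<noteq> \<zero>" for k :: nat
  proof (induction k)
    case (Suc k)
    show ?case
    proof
      assume "x [^] Suc k \<otimes> e = \<zero>"
      then have "x [^] k \<otimes> x = \<zero>" using xA eA by (simp add: KA.m_assoc)
      then have "x [^] k \<otimes> (x \<otimes> a \<otimes> b) = \<zero>"
        using xA(1) aA(1) bA by (simp add: KA.m_assoc[symmetric])
      then show False using Suc b(2) by simp
    qed
  qed (use eA in simp)
  moreover obtain m :: nat where "x [^] m = \<zero>" using x(2) by (auto simp: nilpotent_def)
  ultimately show False using eA by (metis KA.l_null)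
qed

text \<open>This is locality of \<open>eAe\<close>. If \<open>s\<close> and \<open>t\<close> are both nilpotent, let \<open>z\<close> be the last nonzero
  power of \<open>t\<close> (times \<open>e\<close>). Then \<open>tz = 0\<close>, so \<open>sz = ez = z\<close>, which is impossible for nilpotent \<open>s\<close>.\<close>

lemma corner_sum_unit:
  assumes e: "primitive_idempotent A e" and s: "s \<in> corner A e" and t: "t \<in> corner A e"
    and st: "s \<oplus> t = e"
  shows "\<not> nilpotent A s \<or> \<not> nilpotent A t"
proof (rule ccontr)
  assume nil: "\<not> (\<not> nilpotent A s \<or> \<not> nilpotent A t)"
  have eA: "e \<in> carrier A" "e \<noteq> \<zero>" "e \<otimes> e = e" using e by (auto simp: primitive_idempotent_def)
  have sA: "s \<in> carrier A" and tA: "t \<in> carrier A" "e \<otimes> t = t"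
    using s t by (auto simp: corner_def)
  have no: "t [^] k \<otimes> e \<noteq> \<zero>" for k :: nat
  proof (induction k)
    case (Suc k)
    define z where "z = t [^] k \<otimes> e"
    have zA: "z \<in> carrier A" using tA eA by (simp add: z_def)
    show ?case
    proof
      assume "t [^] Suc k \<otimes> e = \<zero>"
      then have tz: "t \<otimes> z = \<zero>"
        unfolding z_def using tA(1) eA KA.nat_pow_Suc2[OF tA(1), of k]
        by (simp add: KA.m_assoc[symmetric])
      have ez: "e \<otimes> z = z"
      proof (cases k)
        case 0
        then show ?thesis using eA by (simp add: z_def)
      next
        case (Suc j)
        then show ?thesis
          unfolding z_def using tA eA KA.nat_pow_Suc2[OF tA(1), of j] by (simp add: KA.m_assoc[symmetric])
      qed
      have "s \<otimes> z \<oplus> t \<otimes> z = z" using sA tA(1) zA ez st by (simp add: KA.l_distr[symmetric])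
      then have sz: "s \<otimes> z = z" using tz sA zA by simp
      have "s [^] j \<otimes> z = z" for j :: nat
        by (induction j) (use zA sA sz in \<open>auto simp: KA.m_assoc\<close>)
      moreover obtain j :: nat where "s [^] j = \<zero>" using nil by (auto simp: nilpotent_def)
      ultimately have "z = \<zero>" using zA by (metis KA.l_null)
      then show False using Suc by (simp add: z_def)
    qed
  qed (use eA in simp)
  moreover obtain m :: nat where "t [^] m = \<zero>" using nil by (auto simp: nilpotent_def)
  ultimately show False using eA by (metis KA.l_null)
qed

text \<open>Otherwise \<open>y\<close> could be multiplied on the right by nilpotent elements of \<open>eAe\<close> forever
  without reaching \<open>0\<close>. The resulting sequence has a term \<open>Y n\<close> with \<open>Y n = Y n w\<close>, where \<open>w\<close> is the
  product of a nilpotent factor with an element of \<open>eAe\<close> and hence nilpotent; this forces \<open>Y n = 0\<close>.\<close>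

lemma ex_multiple_killed_by_nilpotents:
  assumes e: "primitive_idempotent A e" and y: "y \<in> carrier A" "y \<otimes> e = y" "y \<noteq> \<zero>"
  shows "\<exists>r \<in> carrier A. y \<otimes> r \<noteq> \<zero> \<and> e \<otimes> r = r \<and> y \<otimes> r \<otimes> e = y \<otimes> r \<and>
           (\<forall>x \<in> corner A e. nilpotent A x \<longrightarrow> y \<otimes> r \<otimes> x = \<zero>)"
proof (rule ccontr)
  assume neg: "\<not> ?thesis"
  have eA: "e \<in> carrier A" "e \<otimes> e = e" using e by (auto simp: primitive_idempotent_def)
  define good where
    "good v \<longleftrightarrow> v \<noteq> \<zero> \<and> v \<otimes> e = v \<and> (\<exists>r \<in> carrier A. e \<otimes> r = r \<and> v = y \<otimes> r)" for v
  have "\<exists>x. good v \<longrightarrow> x \<in> corner A e \<and> nilpotent A x \<and> v \<otimes> x \<noteq> \<zero>" for v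
    using neg unfolding good_def by blast
  then obtain f where f: "\<And>v. good v \<Longrightarrow> f v \<in> corner A e \<and> nilpotent A (f v) \<and> v \<otimes> f v \<noteq> \<zero>"
    by metis
  define Y where "Y = rec_nat y (\<lambda>_ v. v \<otimes> f v)"
  have Y: "Y 0 = y" "\<And>n. Y (Suc n) = Y n \<otimes> f (Y n)" by (simp_all add: Y_def)
  have good: "good (Y n)" for n
  proof (induction n)
    case 0
    then show ?case using y eA unfolding good_def Y by (intro conjI bexI[of _ e]) auto
  next
    case (Suc n)
    obtain r where r: "r \<in> carrier A" "e \<otimes> r = r" "Y n = y \<otimes> r" using Suc by (auto simp: good_def)
    have x: "f (Y n) \<in> carrier A" "f (Y n) \<otimes> e = f (Y n)" "Y n \<otimes> f (Y n) \<noteq> \<zero>"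
      using f[OF Suc] by (auto simp: corner_def)
    have "Y (Suc n) \<otimes> e = Y (Suc n)"
      unfolding Y using r y x eA by (simp add: KA.m_assoc)
    moreover have "Y (Suc n) = y \<otimes> (r \<otimes> f (Y n))" "e \<otimes> (r \<otimes> f (Y n)) = r \<otimes> f (Y n)"
      unfolding Y using r y x eA by (simp_all add: KA.m_assoc[symmetric])
    ultimately show ?case unfolding good_def using x r Y by auto
  qed
  have YA: "Y n \<in> carrier A" "Y n \<otimes> e = Y n" "Y n \<noteq> \<zero>" for n
    using good[of n] y by (auto simp: good_def)
  have fA: "f (Y n) \<in> carrier A" "f (Y n) \<otimes> e = f (Y n)" for n
    using f[OF good] by (auto simp: corner_def)
  obtain n z where n: "z \<in> carrier A" "Y n = Y (Suc n) \<otimes> z"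
    using product_sequence_stabilizes[of Y "\<lambda>i. f (Y i)"] YA fA Y(2) by blast
  define w where "w = f (Y n) \<otimes> (e \<otimes> z \<otimes> e)"
  have "e \<otimes> z \<otimes> e \<in> corner A e"
    using eA n(1) by (simp add: corner_def KA.m_assoc[symmetric]) (simp add: KA.m_assoc)
  then have "nilpotent A w" unfolding w_def using corner_nilpotent_mult[OF e] f[OF good] by blast
  then obtain m :: nat where m: "w [^] m = \<zero>" by (auto simp: nilpotent_def)
  have wA: "w \<in> carrier A" using fA eA n(1) by (simp add: w_def)
  have "Y n \<otimes> w = Y n \<otimes> (f (Y n) \<otimes> e) \<otimes> z \<otimes> e"
    unfolding w_def using fA(1) YA(1) eA n(1) by (simp add: KA.m_assoc)
  also have "\<dots> = Y (Suc n) \<otimes> z \<otimes> e" by (simp only: fA(2) Y(2))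
  also have "\<dots> = Y n" by (simp only: n(2)[symmetric] YA(2))
  finally have Yw: "Y n \<otimes> w = Y n" .
  have "Y n \<otimes> w [^] j = Y n" for j :: nat
    by (induction j) (use YA wA Yw in \<open>auto simp: KA.m_assoc[symmetric]\<close>)
  from this[of m] m show False using YA(1,3)[of n] by simp
qed

end

section \<open>Indecomposable projective modules and the socle condition\<close>

lemma mem_set_add:
  "x \<in> U <+>\<^bsub>M\<^esub> V \<longleftrightarrow> (\<exists>u \<in> U. \<exists>v \<in> V. x = u \<oplus>\<^bsub>M\<^esub> v)"
  by (auto simp: set_add_def set_mult_def)

lemma (in left_module) decompose_diff:
  assumes "x \<in> carrier M" "y \<in> carrier M"
  shows "x = y \<oplus>\<^bsub>M\<^esub> (x \<ominus>\<^bsub>M\<^esub> y)"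
  using assms by (simp add: a_minus_def M.a_lcomm M.r_neg)

text \<open>Every \<open>x\<close> is the sum of \<open>\<phi> x\<close> and \<open>x - \<phi> x\<close>.\<close>

lemma internal_direct_sum_idempotent:
  fixes M :: "('a, 'm) module"
  assumes M: "left_module A M" and \<phi>: "\<phi> \<in> lmod_hom A M M"
    and idem: "\<And>x. x \<in> carrier M \<Longrightarrow> \<phi> (\<phi> x) = \<phi> x"
  shows "internal_direct_sum A M (\<phi> ` carrier M) (lmod_ker M M \<phi>)"
proof -
  interpret lmod_hom_pair A M M \<phi> using assms by (simp add: lmod_hom_pairI)
  have "x \<in> \<phi> ` carrier M <+>\<^bsub>M\<^esub> lmod_ker M M \<phi>" if x: "x \<in> carrier M" for x
  proof -
    have "\<phi> (x \<ominus>\<^bsub>M\<^esub> \<phi> x) = \<zero>\<^bsub>M\<^esub>"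
      using x by (simp add: hom_diff hom_closed idem M.diff_eq_zero_iff)
    then have "x \<ominus>\<^bsub>M\<^esub> \<phi> x \<in> lmod_ker M M \<phi>" using x hom_closed by (simp add: lmod_ker_def)
    then show ?thesis
      unfolding mem_set_add using M.decompose_diff[OF x hom_closed[OF x]] x by blast
  qed
  moreover have "\<phi> ` carrier M <+>\<^bsub>M\<^esub> lmod_ker M M \<phi> \<subseteq> carrier M"
    using hom_closed by (auto simp: mem_set_add lmod_ker_def)
  moreover have "\<phi> ` carrier M \<inter> lmod_ker M M \<phi> = {\<zero>\<^bsub>M\<^esub>}"
  proof
    show "\<phi> ` carrier M \<inter> lmod_ker M M \<phi> \<subseteq> {\<zero>\<^bsub>M\<^esub>}" by (auto simp: lmod_ker_def idem)
    have "\<zero>\<^bsub>M\<^esub> \<in> \<phi> ` carrier M" by (rule image_eqI[of _ _ "\<zero>\<^bsub>M\<^esub>"]) (simp_all add: hom_zero)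
    then show "{\<zero>\<^bsub>M\<^esub>} \<subseteq> \<phi> ` carrier M \<inter> lmod_ker M M \<phi>" by (simp add: lmod_ker_def hom_zero)
  qed
  ultimately show ?thesis
    unfolding internal_direct_sum_def
    using submodule_image[OF M.submodule_carrier] submodule_ker by blast
qed

lemma in_add_retract:
  fixes W :: "('a, 'm) module" and D :: "('a, 'x) module"
  assumes "ring A" and W: "left_module A W" and D: "left_module A D"
    and \<iota>: "\<iota> \<in> lmod_hom A W D" and \<rho>: "\<rho> \<in> lmod_hom A D W"
    and \<rho>\<iota>: "\<And>x. x \<in> carrier W \<Longrightarrow> \<rho> (\<iota> x) = x"
  shows "in_add A D W"
proof -
  let ?D = "direct_sum {..<1::nat} (\<lambda>_. D)"
  have lD: "left_module A ?D" by (rule left_module_direct_sum[OF assms(1) D])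
  define j where "j x = (\<lambda>i\<in>{..<1::nat}. \<iota> x)" for x
  have j: "j \<in> lmod_hom A W ?D"
    by (rule lmod_homI)
      (use lmod_homD[OF \<iota>] in \<open>auto simp: j_def direct_sum_simps intro!: restrict_ext\<close>)
  define r where "r f = \<rho> (f (0::nat))" for f
  have comp: "(\<lambda>f. f 0) \<in> lmod_hom A ?D D" by (rule direct_sum_component_hom) simp
  have r: "r \<in> lmod_hom A ?D W" unfolding r_def by (rule lmod_hom_comp[OF lD comp \<rho>])
  have rj: "r (j x) = x" if "x \<in> carrier W" for x
    using \<rho>\<iota>[OF that] by (simp add: r_def j_def)
  have \<phi>: "(\<lambda>f. j (r f)) \<in> lmod_hom A ?D ?D" by (rule lmod_hom_comp[OF lD r j])
  have "internal_direct_sum A ?D ((\<lambda>f. j (r f)) ` carrier ?D) (lmod_ker ?D ?D (\<lambda>f. j (r f)))"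
    by (rule internal_direct_sum_idempotent[OF lD \<phi>]) (simp add: rj lmod_homD(1)[OF r])
  moreover have im: "(\<lambda>f. j (r f)) ` carrier ?D = j ` carrier W"
  proof
    show "(\<lambda>f. j (r f)) ` carrier ?D \<subseteq> j ` carrier W" using lmod_homD(1)[OF r] by blast
    show "j ` carrier W \<subseteq> (\<lambda>f. j (r f)) ` carrier ?D"
    proof
      fix y assume "y \<in> j ` carrier W"
      then obtain x where x: "x \<in> carrier W" "y = j x" by blast
      then have "y = j (r (j x))" by (simp add: rj)
      then show "y \<in> (\<lambda>f. j (r f)) ` carrier ?D" using lmod_homD(1)[OF j x(1)] by blast
    qed
  qed
  moreover have "lmod_iso A W (?D\<lparr>carrier := j ` carrier W\<rparr>)"
  proof -
    have "j \<in> lmod_hom A W (?D\<lparr>carrier := j ` carrier W\<rparr>)"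
      by (rule lmod_homI) (use lmod_homD[OF j] in auto)
    moreover have "inj_on j (carrier W)" by (rule inj_on_inverseI[of _ r]) (rule rj)
    ultimately show ?thesis unfolding lmod_iso_def bij_betw_def by force
  qed
  ultimately have "internal_direct_sum A ?D (j ` carrier W) (lmod_ker ?D ?D (\<lambda>f. j (r f))) \<and>
      lmod_iso A W (?D\<lparr>carrier := j ` carrier W\<rparr>)" by simp
  then show ?thesis unfolding in_add_def using W by blast
qed

lemma direct_sum_inclusion_hom:
  assumes F: "\<And>i. i \<in> I \<Longrightarrow> left_module A (F i)" and i: "i \<in> I"
  shows "(\<lambda>x. \<lambda>j\<in>I. if j = i then x else \<zero>\<^bsub>F j\<^esub>) \<in> lmod_hom A (F i) (direct_sum I F)"
proof -
  have z: "\<zero>\<^bsub>F j\<^esub> \<in> carrier (F j)" "\<zero>\<^bsub>F j\<^esub> \<oplus>\<^bsub>F j\<^esub> \<zero>\<^bsub>F j\<^esub> = \<zero>\<^bsub>F j\<^esub>"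
    "\<And>a. a \<in> carrier A \<Longrightarrow> a \<odot>\<^bsub>F j\<^esub> \<zero>\<^bsub>F j\<^esub> = \<zero>\<^bsub>F j\<^esub>" if "j \<in> I" for j
  proof -
    interpret left_module A "F j" by (rule F[OF that])
    show "\<zero>\<^bsub>F j\<^esub> \<in> carrier (F j)" "\<zero>\<^bsub>F j\<^esub> \<oplus>\<^bsub>F j\<^esub> \<zero>\<^bsub>F j\<^esub> = \<zero>\<^bsub>F j\<^esub>" by simp_all
    show "a \<odot>\<^bsub>F j\<^esub> \<zero>\<^bsub>F j\<^esub> = \<zero>\<^bsub>F j\<^esub>" if "a \<in> carrier A" for a using that by (rule smult_r_null)
  qed
  show ?thesis
  proof (rule lmod_homI)
    fix x assume "x \<in> carrier (F i)"
    moreover have "finite {j \<in> I. (\<lambda>j\<in>I. if j = i then x else \<zero>\<^bsub>F j\<^esub>) j \<noteq> \<zero>\<^bsub>F j\<^esub>}"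
      by (rule finite_subset[of _ "{i}"]) auto
    ultimately show "(\<lambda>j\<in>I. if j = i then x else \<zero>\<^bsub>F j\<^esub>) \<in> carrier (direct_sum I F)"
      using z(1) unfolding direct_sum_simps(1) by auto
  qed (auto simp: direct_sum_simps z intro!: restrict_ext)
qed

lemma in_add_direct_sum:
  fixes W :: "('a, 'm) module" and \<Q> :: "('a, 'm) module set"
  assumes "ring A" and W: "left_module A W"
    and \<Q>: "\<And>Y. Y \<in> \<Q> \<Longrightarrow> left_module A Y" and Y: "Y \<in> \<Q>" and iso: "lmod_iso A W Y"
  shows "in_add A (direct_sum \<Q> (\<lambda>Y. Y)) W"
proof -
  let ?D = "direct_sum \<Q> (\<lambda>Y. Y)"
  obtain f where f: "f \<in> lmod_hom A W Y" "bij_betw f (carrier W) (carrier Y)"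
    using iso by (auto simp: lmod_iso_def)
  have lD: "left_module A ?D" by (rule left_module_direct_sum[OF assms(1) \<Q>])
  have \<iota>: "(\<lambda>x. \<lambda>Z\<in>\<Q>. if Z = Y then f x else \<zero>\<^bsub>Z\<^esub>) \<in> lmod_hom A W ?D"
    using lmod_hom_comp[OF W f(1)
        direct_sum_inclusion_hom[where F = "\<lambda>Y. Y", where A = A, where I = \<Q>, OF \<Q> Y]]
    by simp
  have \<rho>: "(\<lambda>g. inv_into (carrier W) f (g Y)) \<in> lmod_hom A ?D W"
    by (rule lmod_hom_comp[OF lD direct_sum_component_hom[OF Y] lmod_hom_inv[OF W f]])
  show ?thesis
    by (rule in_add_retract[OF assms(1) W lD \<iota> \<rho>]) (use Y f(2) in \<open>simp add: bij_betw_inv_into_left\<close>)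
qed

text \<open>An isomorphism of the module with \<open>Re\<close>, recorded by the element \<open>c\<close> that corresponds to \<open>e\<close>.
  The two have the same annihilator, and the generator determines the isomorphism. This keeps the
  module on its own type while all computations take place in the ring.\<close>

locale idempotent_presentation = left_module R M
  for R :: "('a, 'c) ring_scheme" (structure) and M :: "('a, 'm) module" +
  fixes e c
  assumes e_closed: "e \<in> carrier R" and c_closed: "c \<in> carrier M" and e_c: "e \<odot>\<^bsub>M\<^esub> c = c"
    and generates: "\<And>w. w \<in> carrier M \<Longrightarrow> \<exists>a \<in> carrier R. w = a \<odot>\<^bsub>M\<^esub> c"
    and annihilates: "\<And>a. \<lbrakk>a \<in> carrier R; a \<odot>\<^bsub>M\<^esub> c = \<zero>\<^bsub>M\<^esub>\<rbrakk> \<Longrightarrow> a \<otimes> e = \<zero>"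
begin

lemma smult_c_closed: "a \<in> carrier R \<Longrightarrow> a \<odot>\<^bsub>M\<^esub> c \<in> carrier M"
  using c_closed smult_closed by blast

lemma smult_e_c: "a \<in> carrier R \<Longrightarrow> (a \<otimes> e) \<odot>\<^bsub>M\<^esub> c = a \<odot>\<^bsub>M\<^esub> c"
  using e_c e_closed c_closed by (simp add: smult_assoc)

lemma smult_c_eqD:
  assumes "a \<in> carrier R" "b \<in> carrier R" "a \<odot>\<^bsub>M\<^esub> c = b \<odot>\<^bsub>M\<^esub> c"
  shows "a \<otimes> e = b \<otimes> e"
proof -
  have "(a \<ominus> b) \<odot>\<^bsub>M\<^esub> c = \<zero>\<^bsub>M\<^esub>"
    using assms c_closed smult_c_closed by (simp add: smult_l_diff diff_eq_zero_iff)
  then have "(a \<ominus> b) \<otimes> e = \<zero>" using assms annihilates by simp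
  then have "a \<otimes> e \<ominus> b \<otimes> e = \<zero>"
    using assms e_closed by (simp add: a_minus_def R.l_distr R.l_minus)
  then show ?thesis using assms e_closed by simp
qed

lemma idem: "e \<otimes> e = e"
  using smult_c_eqD[of e \<one>] e_closed e_c c_closed by (simp add: smult_one)

text \<open>Homomorphisms out of \<open>Re\<close> are determined by the image \<open>u\<close> of \<open>e\<close>, which can be any element with
  \<open>eu = u\<close>.\<close>

lemma ex_hom:
  fixes N :: "('a, 'n) module"
  assumes "left_module R N" "u \<in> carrier N" "e \<odot>\<^bsub>N\<^esub> u = u"
  obtains f where "f \<in> lmod_hom R M N" "\<And>a. a \<in> carrier R \<Longrightarrow> f (a \<odot>\<^bsub>M\<^esub> c) = a \<odot>\<^bsub>N\<^esub> u"
proof -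
  interpret N: left_module R N by fact
  define f where "f w = (SOME a. a \<in> carrier R \<and> w = a \<odot>\<^bsub>M\<^esub> c) \<odot>\<^bsub>N\<^esub> u" for w
  have f: "f (a \<odot>\<^bsub>M\<^esub> c) = a \<odot>\<^bsub>N\<^esub> u" if a: "a \<in> carrier R" for a
  proof -
    define b where "b = (SOME b. b \<in> carrier R \<and> a \<odot>\<^bsub>M\<^esub> c = b \<odot>\<^bsub>M\<^esub> c)"
    have b: "b \<in> carrier R" "a \<odot>\<^bsub>M\<^esub> c = b \<odot>\<^bsub>M\<^esub> c"
      using someI[of "\<lambda>b. b \<in> carrier R \<and> a \<odot>\<^bsub>M\<^esub> c = b \<odot>\<^bsub>M\<^esub> c" a] a by (auto simp: b_def)
    have "f (a \<odot>\<^bsub>M\<^esub> c) = b \<odot>\<^bsub>N\<^esub> (e \<odot>\<^bsub>N\<^esub> u)" by (simp add: f_def b_def assms(3))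
    also have "\<dots> = (a \<otimes> e) \<odot>\<^bsub>N\<^esub> u"
      using smult_c_eqD[OF a b] b(1) e_closed assms(2) by (simp add: N.smult_assoc)
    also have "\<dots> = a \<odot>\<^bsub>N\<^esub> u" using a e_closed assms(2,3) by (simp add: N.smult_assoc)
    finally show ?thesis .
  qed
  have "f \<in> lmod_hom R M N"
  proof (rule lmod_homI)
    fix x assume "x \<in> carrier M"
    then obtain a where a: "a \<in> carrier R" "x = a \<odot>\<^bsub>M\<^esub> c" using generates by blast
    then show "f x \<in> carrier N" using f assms(2) N.smult_closed by simp
    fix y assume "y \<in> carrier M"
    then obtain b where b: "b \<in> carrier R" "y = b \<odot>\<^bsub>M\<^esub> c" using generates by blast
    have "x \<oplus>\<^bsub>M\<^esub> y = (a \<oplus> b) \<odot>\<^bsub>M\<^esub> c" using a b c_closed by (simp add: smult_l_distr)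
    then show "f (x \<oplus>\<^bsub>M\<^esub> y) = f x \<oplus>\<^bsub>N\<^esub> f y" using a b assms(2) by (simp add: f N.smult_l_distr)
  next
    fix r x assume r: "r \<in> carrier R" "x \<in> carrier M"
    then obtain a where a: "a \<in> carrier R" "x = a \<odot>\<^bsub>M\<^esub> c" using generates by blast
    then have "r \<odot>\<^bsub>M\<^esub> x = (r \<otimes> a) \<odot>\<^bsub>M\<^esub> c" using r c_closed by (simp add: smult_assoc)
    then show "f (r \<odot>\<^bsub>M\<^esub> x) = r \<odot>\<^bsub>N\<^esub> f x" using a r assms(2) by (simp add: f N.smult_assoc)
  qed
  then show thesis using that f by blast
qed

lemma fin_gen: "fin_gen R M"
  by (rule fin_gen_cyclic[OF left_module_axioms c_closed generates])

lemma fg_projective: "fg_projective R M"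
  unfolding fg_projective_def
proof (intro conjI allI ballI impI; (elim conjE)?)
  show "left_module R M" "fin_gen R M" by (rule left_module_axioms, rule fin_gen)
  fix N L :: "'a umod" and g f
  assume g: "g \<in> lmod_hom R N L" and f: "f \<in> lmod_hom R M L"
    and N: "left_module R N" and L: "left_module R L" and surj: "g ` carrier N = carrier L"
  interpret N: left_module R N by fact
  have "f c \<in> carrier L" using lmod_homD(1)[OF f c_closed] .
  then obtain n where n: "n \<in> carrier N" "g n = f c" using surj by (metis imageE)
  have en: "e \<odot>\<^bsub>N\<^esub> n \<in> carrier N" "e \<odot>\<^bsub>N\<^esub> (e \<odot>\<^bsub>N\<^esub> n) = e \<odot>\<^bsub>N\<^esub> n"
    using n e_closed N.smult_closed by (simp_all add: N.smult_assoc[symmetric] idem)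
  obtain h where h: "h \<in> lmod_hom R M N" "\<And>a. a \<in> carrier R \<Longrightarrow> h (a \<odot>\<^bsub>M\<^esub> c) = a \<odot>\<^bsub>N\<^esub> (e \<odot>\<^bsub>N\<^esub> n)"
    using ex_hom[OF N en] by blast
  have gen: "g (e \<odot>\<^bsub>N\<^esub> n) = f c"
    using lmod_homD(3)[OF g e_closed n(1)] lmod_homD(3)[OF f e_closed c_closed] n e_c by simp
  have "g (h x) = f x" if x: "x \<in> carrier M" for x
  proof -
    obtain a where a: "a \<in> carrier R" "x = a \<odot>\<^bsub>M\<^esub> c" using generates[OF x] by blast
    then show ?thesis
      using h(2) gen lmod_homD(3)[OF g a(1) en(1)] lmod_homD(3)[OF f a(1) c_closed] by simp
  qed
  then show "\<exists>f' \<in> lmod_hom R M N. \<forall>x \<in> carrier M. g (f' x) = f x" using h(1) by blast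
qed

text \<open>An idempotent \<open>g\<close> of \<open>eRe\<close> splits \<open>Re\<close> into \<open>Rg\<close> and \<open>R(e - g)\<close>.\<close>

lemma primitive:
  assumes "indecomposable_module R M"
  shows "primitive_idempotent R e"
  unfolding primitive_idempotent_def
proof (intro conjI ballI impI; (elim conjE)?)
  show "e \<in> carrier R" "e \<otimes> e = e" by (rule e_closed, rule idem)
  show "e \<noteq> \<zero>"
  proof
    assume "e = \<zero>"
    then have "a \<odot>\<^bsub>M\<^esub> c = \<zero>\<^bsub>M\<^esub>" if "a \<in> carrier R" for a
      using smult_e_c[OF that] that c_closed by (simp add: smult_l_null)
    then have "carrier M \<subseteq> {\<zero>\<^bsub>M\<^esub>}" using generates by blast
    then show False using assms by (auto simp: indecomposable_module_def)
  qed
  fix g assume g: "g \<in> carrier R" "g \<otimes> g = g" "e \<otimes> g = g" "g \<otimes> e = g"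
  have gc: "g \<odot>\<^bsub>M\<^esub> c \<in> carrier M" "e \<odot>\<^bsub>M\<^esub> (g \<odot>\<^bsub>M\<^esub> c) = g \<odot>\<^bsub>M\<^esub> c"
    using g e_closed c_closed smult_c_closed by (simp_all add: smult_assoc[symmetric])
  obtain \<phi> where \<phi>: "\<phi> \<in> lmod_hom R M M"
      "\<And>a. a \<in> carrier R \<Longrightarrow> \<phi> (a \<odot>\<^bsub>M\<^esub> c) = a \<odot>\<^bsub>M\<^esub> (g \<odot>\<^bsub>M\<^esub> c)"
    using ex_hom[OF left_module_axioms gc] by blast
  have idem': "\<phi> (\<phi> x) = \<phi> x" if "x \<in> carrier M" for x
  proof -
    obtain a where a: "a \<in> carrier R" "x = a \<odot>\<^bsub>M\<^esub> c" using generates[OF \<open>x \<in> _\<close>] by blast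
    then have \<phi>x: "\<phi> x = (a \<otimes> g) \<odot>\<^bsub>M\<^esub> c" using g c_closed \<phi>(2) by (simp add: smult_assoc)
    have "\<phi> (\<phi> x) = (a \<otimes> g) \<odot>\<^bsub>M\<^esub> (g \<odot>\<^bsub>M\<^esub> c)" unfolding \<phi>x using a g \<phi>(2)[of "a \<otimes> g"] by simp
    also have "\<dots> = ((a \<otimes> g) \<otimes> g) \<odot>\<^bsub>M\<^esub> c" using a g c_closed by (simp add: smult_assoc)
    finally show ?thesis unfolding \<phi>x using a g by (simp add: R.m_assoc)
  qed
  have "internal_direct_sum R M (\<phi> ` carrier M) (lmod_ker M M \<phi>)"
    by (rule internal_direct_sum_idempotent[OF left_module_axioms \<phi>(1) idem'])
  then have "\<phi> ` carrier M = {\<zero>\<^bsub>M\<^esub>} \<or> lmod_ker M M \<phi> = {\<zero>\<^bsub>M\<^esub>}"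
    using assms unfolding indecomposable_module_def by blast
  then show "g = \<zero> \<or> g = e"
  proof
    assume "\<phi> ` carrier M = {\<zero>\<^bsub>M\<^esub>}"
    then have "\<phi> (\<one> \<odot>\<^bsub>M\<^esub> c) = \<zero>\<^bsub>M\<^esub>" using smult_c_closed[of \<one>] by blast
    then have "g \<odot>\<^bsub>M\<^esub> c = \<zero>\<^bsub>M\<^esub>" using \<phi>(2)[of \<one>] gc(1) by (simp add: smult_one)
    then show ?thesis using annihilates[OF g(1)] g(4) by simp
  next
    assume ker: "lmod_ker M M \<phi> = {\<zero>\<^bsub>M\<^esub>}"
    have "\<phi> ((e \<ominus> g) \<odot>\<^bsub>M\<^esub> c) = ((e \<ominus> g) \<otimes> g) \<odot>\<^bsub>M\<^esub> c"
      using \<phi>(2) g(1) e_closed c_closed by (simp add: smult_assoc)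
    also have "(e \<ominus> g) \<otimes> g = \<zero>"
      using g e_closed by (simp add: a_minus_def R.l_distr R.l_minus R.r_neg)
    finally have "(e \<ominus> g) \<odot>\<^bsub>M\<^esub> c \<in> lmod_ker M M \<phi>"
      using g(1) e_closed c_closed smult_c_closed by (simp add: lmod_ker_def smult_l_null)
    then have "(e \<ominus> g) \<odot>\<^bsub>M\<^esub> c = \<zero>\<^bsub>M\<^esub>" using ker by blast
    then have "(e \<ominus> g) \<otimes> e = \<zero>" using annihilates g(1) e_closed by simp
    then have "e \<ominus> g = \<zero>"
      using g e_closed idem by (simp add: a_minus_def R.l_distr R.l_minus)
    then show ?thesis using g(1) e_closed by simp
  qed
qed

end

lemma finsum_regular_module: "finsum (regular_module A) f I = finsum A f I"
  by (simp add: finsum_def finprod_def regular_module_simps)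

definition basic_decomposition :: "('a, 'c) ring_scheme \<Rightarrow> nat \<Rightarrow> (nat \<Rightarrow> ('a, 'm) module) \<Rightarrow>
    (nat \<Rightarrow> 'a) \<Rightarrow> (nat \<Rightarrow> 'm) \<Rightarrow> bool" where
  "basic_decomposition A n P e c \<longleftrightarrow>
     (\<forall>i<n. indecomposable_module A (P i)) \<and>
     (\<forall>i<n. \<forall>j<n. i \<noteq> j \<longrightarrow> \<not> lmod_iso A (P i) (P j)) \<and>
     (\<forall>i<n. idempotent_presentation A (P i) (e i) (c i)) \<and> (\<Oplus>\<^bsub>A\<^esub>i\<in>{..<n}. e i) = \<one>\<^bsub>A\<^esub>"

lemma basic_decompositionD:
  assumes "basic_decomposition A n P e c"
  shows "\<And>i. i < n \<Longrightarrow> indecomposable_module A (P i)"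
    and "\<And>i j. \<lbrakk>i < n; j < n; i \<noteq> j\<rbrakk> \<Longrightarrow> \<not> lmod_iso A (P i) (P j)"
    and "\<And>i. i < n \<Longrightarrow> idempotent_presentation A (P i) (e i) (c i)"
    and "(\<Oplus>\<^bsub>A\<^esub>i\<in>{..<n}. e i) = \<one>\<^bsub>A\<^esub>"
  using assms by (simp_all add: basic_decomposition_def)

text \<open>Let \<open>c i\<close> be the \<open>i\<close>-th component of \<open>1\<close> in the direct sum. The elements of \<open>A\<close> that correspond to
  the tuples with \<open>c i\<close> at place \<open>i\<close> and zeros elsewhere are the idempotents.\<close>

lemma ex_basic_decomposition:
  fixes A :: "('a, 'c) ring_scheme"
  assumes "ring A" "basic_algebra A"
  obtains n and P :: "nat \<Rightarrow> 'a umod" and e c where "basic_decomposition A n P e c"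
proof -
  obtain n :: nat and P :: "nat \<Rightarrow> 'a umod" where
    indec: "\<And>i. i < n \<Longrightarrow> indecomposable_module A (P i)" and
    noniso: "\<And>i j. \<lbrakk>i < n; j < n; i \<noteq> j\<rbrakk> \<Longrightarrow> \<not> lmod_iso A (P i) (P j)" and
    iso: "lmod_iso A (regular_module A) (direct_sum {..<n} P)"
    using assms(2) unfolding basic_algebra_def by blast
  let ?R = "regular_module A" and ?D = "direct_sum {..<n} P"
  interpret ring A by fact
  have lP: "left_module A (P i)" if "i < n" for i
    using indec[OF that] by (simp add: indecomposable_module_def)
  have lD: "left_module A ?D" by (rule left_module_direct_sum[OF assms(1)]) (simp add: lP)
  have lR: "left_module A ?R" by (rule left_module_regular[OF assms(1)])
  interpret D: left_module A ?D by (rule lD)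
  obtain h where h: "h \<in> lmod_hom A ?R ?D" "bij_betw h (carrier ?R) (carrier ?D)"
    using iso by (auto simp: lmod_iso_def)
  interpret h: lmod_hom_pair A ?R ?D h using lR lD h(1) by (rule lmod_hom_pairI)
  have inj: "x = y" if "x \<in> carrier A" "y \<in> carrier A" "h x = h y" for x y
    using h(2) that by (auto simp: bij_betw_def inj_on_def regular_module_simps)
  have surj: "\<exists>x \<in> carrier A. h x = v" if "v \<in> carrier ?D" for v
    using h(2) that by (metis bij_betw_def imageE regular_module_simps(1))
  have hD: "h x \<in> carrier ?D" if "x \<in> carrier A" for x
    using h.hom_closed that by (simp add: regular_module_simps)
  have memD: "v i \<in> carrier (P i)" if "v \<in> carrier ?D" "i < n" for v i
    using that by (auto simp: carrier_direct_sum_finite)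
  have extD: "v = w" if "v \<in> carrier ?D" "w \<in> carrier ?D" "\<And>i. i < n \<Longrightarrow> v i = w i" for v w
    using that by (intro PiE_ext[of v "{..<n}" "\<lambda>i. carrier (P i)" w])
      (auto simp: carrier_direct_sum_finite)
  define c where "c i = h \<one>\<^bsub>A\<^esub> i" for i
  have c: "c i \<in> carrier (P i)" if "i < n" for i
    unfolding c_def using memD[OF hD[OF one_closed] that] .
  have hc: "h a i = a \<odot>\<^bsub>P i\<^esub> c i" if "a \<in> carrier A" "i < n" for a i
  proof -
    have "h a = a \<odot>\<^bsub>?D\<^esub> h \<one>\<^bsub>A\<^esub>"
      using h.hom_smult[of a "\<one>\<^bsub>A\<^esub>"] that(1) by (simp add: regular_module_simps)
    then show ?thesis using that(2) by (simp add: direct_sum_simps c_def)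
  qed
  define inc where "inc i = (\<lambda>x. \<lambda>j\<in>{..<n}. if j = i then x else \<zero>\<^bsub>P j\<^esub>)" for i
  have incD: "inc i x \<in> carrier ?D" if "i < n" "x \<in> carrier (P i)" for i x
    using lmod_homD(1)[OF direct_sum_inclusion_hom[of "{..<n}" A P i]] lP that by (simp add: inc_def)
  have "\<exists>x \<in> carrier A. h x = inc i (c i)" if "i < n" for i
    using surj incD that c by blast
  then have "\<forall>i. \<exists>x. i < n \<longrightarrow> x \<in> carrier A \<and> h x = inc i (c i)" by blast
  then obtain e where e: "\<And>i. i < n \<Longrightarrow> e i \<in> carrier A" "\<And>i. i < n \<Longrightarrow> h (e i) = inc i (c i)"
    by metis
  have pres: "idempotent_presentation A (P i) (e i) (c i)" if i: "i < n" for i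
  proof -
    interpret P: left_module A "P i" by (rule lP[OF i])
    show ?thesis
    proof (unfold_locales)
      show "e i \<in> carrier A" "c i \<in> carrier (P i)" using e(1) c i by auto
      show "e i \<odot>\<^bsub>P i\<^esub> c i = c i"
        using hc[OF e(1)[OF i] i] e(2)[OF i] i by (simp add: inc_def)
      show "\<exists>a \<in> carrier A. w = a \<odot>\<^bsub>P i\<^esub> c i" if w: "w \<in> carrier (P i)" for w
      proof -
        obtain a where a: "a \<in> carrier A" "h a = inc i w" using surj incD[OF i w] by blast
        then have "w = a \<odot>\<^bsub>P i\<^esub> c i" using hc[OF a(1) i] i by (simp add: inc_def)
        then show ?thesis using a(1) by blast
      qed
      show "a \<otimes>\<^bsub>A\<^esub> e i = \<zero>\<^bsub>A\<^esub>" if a: "a \<in> carrier A" "a \<odot>\<^bsub>P i\<^esub> c i = \<zero>\<^bsub>P i\<^esub>" for a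
      proof -
        have "h (a \<otimes>\<^bsub>A\<^esub> e i) = a \<odot>\<^bsub>?D\<^esub> inc i (c i)"
          using h.hom_smult[of a "e i"] a(1) e i by (simp add: regular_module_simps)
        also have "\<dots> = \<zero>\<^bsub>?D\<^esub>"
          unfolding direct_sum_simps
          by (rule restrict_ext)
            (use a left_module.smult_r_null[OF lP] in \<open>auto simp: inc_def\<close>)
        also have "\<dots> = h \<zero>\<^bsub>A\<^esub>" using h.hom_zero by (simp add: regular_module_simps)
        finally show ?thesis by (rule inj[OF m_closed[OF a(1) e(1)[OF i]] zero_closed])
      qed
    qed
  qed
  have eR: "e \<in> {..<n} \<rightarrow> carrier ?R" using e(1) by (auto simp: regular_module_simps)
  have eA: "(\<Oplus>\<^bsub>A\<^esub>i\<in>{..<n}. e i) \<in> carrier A" using e(1) by (intro finsum_closed) auto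
  have sum: "h (\<Oplus>\<^bsub>A\<^esub>i\<in>{..<n}. e i) j = c j" if j: "j < n" for j
  proof -
    interpret P: left_module A "P j" by (rule lP[OF j])
    have comp: "(\<lambda>v. v j) \<in> lmod_hom A ?D (P j)" by (rule direct_sum_component_hom) (use j in simp)
    interpret pr: lmod_hom_pair A ?D "P j" "\<lambda>v. v j" using lD lP[OF j] comp by (rule lmod_hom_pairI)
    have heD: "(\<lambda>i. h (e i)) \<in> {..<n} \<rightarrow> carrier ?D" using e(1) hD by auto
    have "h (\<Oplus>\<^bsub>A\<^esub>i\<in>{..<n}. e i) j = (\<Oplus>\<^bsub>P j\<^esub>i\<in>{..<n}. h (e i) j)"
      using h.hom_finsum[OF eR] pr.hom_finsum[OF heD] by (simp add: finsum_regular_module)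
    also have "\<dots> = (\<Oplus>\<^bsub>P j\<^esub>i\<in>{..<n}. if j = i then c i else \<zero>\<^bsub>P j\<^esub>)"
      by (rule P.M.finsum_cong') (use e(2) c j in \<open>auto simp: inc_def\<close>)
    also have "\<dots> = (\<Oplus>\<^bsub>P j\<^esub>i\<in>{..<n}. if j = i then c j else \<zero>\<^bsub>P j\<^esub>)"
      by (rule P.M.finsum_cong') (use c j in auto)
    also have "\<dots> = c j"
      by (rule P.M.finsum_singleton[of j "{..<n}" "\<lambda>_. c j"]) (use c j in auto)
    finally show ?thesis .
  qed
  have "h (\<Oplus>\<^bsub>A\<^esub>i\<in>{..<n}. e i) = h \<one>\<^bsub>A\<^esub>"
    by (rule extD[OF hD[OF eA] hD[OF one_closed]]) (simp add: sum c_def[symmetric])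
  then have one: "(\<Oplus>\<^bsub>A\<^esub>i\<in>{..<n}. e i) = \<one>\<^bsub>A\<^esub>" using inj[OF eA one_closed] by blast
  show thesis
    by (rule that[of n P e c], unfold basic_decomposition_def)
      (intro conjI allI impI indec noniso pres one; assumption)
qed


context fin_dim_algebra_over_field begin

text \<open>The elements of \<open>P\<close> that do not generate \<open>P\<close> are closed under addition because the corner
  ring at \<open>e\<close> is local. So they form the largest proper submodule, and the quotient by it is simple.\<close>

lemma ex_simple_top:
  fixes P :: "('a, 'm) module"
  assumes pres: "idempotent_presentation A P e c" and prim: "primitive_idempotent A e"
  obtains S :: "('a, 'm) module" and q where "simple_module A S" "q \<in> lmod_hom A P S"
    "q ` carrier P = carrier S" "\<And>w. w \<in> carrier P \<Longrightarrow> q w = \<zero>\<^bsub>S\<^esub> \<longleftrightarrow> (\<forall>b \<in> carrier A. b \<odot>\<^bsub>P\<^esub> w \<noteq> c)"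
proof -
  interpret P: idempotent_presentation A P e c by fact
  have e0: "e \<noteq> \<zero>" using prim by (simp add: primitive_idempotent_def)
  define U where "U = {w \<in> carrier P. \<forall>b \<in> carrier A. b \<odot>\<^bsub>P\<^esub> w \<noteq> c}"
  have c0: "c \<noteq> \<zero>\<^bsub>P\<^esub>"
  proof
    assume "c = \<zero>\<^bsub>P\<^esub>"
    then have "\<one> \<odot>\<^bsub>P\<^esub> c = \<zero>\<^bsub>P\<^esub>" by (simp add: P.smult_one)
    then have "\<one> \<otimes> e = \<zero>" using P.annihilates by blast
    then show False using e0 P.e_closed by simp
  qed
  have unit_notin: "w \<notin> U"
    if w: "w = a \<odot>\<^bsub>P\<^esub> c" "a \<in> carrier A" "b \<in> carrier A"
      and nn: "\<not> nilpotent A (e \<otimes> b \<otimes> a \<otimes> e)" for w a b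
  proof -
    define s where "s = e \<otimes> b \<otimes> a \<otimes> e"
    have sA: "s \<in> carrier A" using P.e_closed w by (simp add: s_def)
    have "e \<otimes> s = (e \<otimes> e) \<otimes> b \<otimes> a \<otimes> e" "s \<otimes> e = e \<otimes> b \<otimes> a \<otimes> (e \<otimes> e)"
      unfolding s_def using P.e_closed w by (simp_all add: KA.m_assoc)
    then have "s \<in> corner A e" using sA by (simp add: corner_def P.idem s_def)
    then obtain u where u: "u \<in> corner A e" "u \<otimes> s = e"
      using corner_nilpotent_or_unit[OF prim, of s] nn s_def by blast
    have uA: "u \<in> carrier A" using u by (simp add: corner_def)
    have "(u \<otimes> e \<otimes> b) \<odot>\<^bsub>P\<^esub> w = (u \<otimes> e \<otimes> b \<otimes> a) \<odot>\<^bsub>P\<^esub> c"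
      unfolding w(1) using uA w P.e_closed P.c_closed by (simp add: P.smult_assoc P.smult_closed)
    also have "\<dots> = (u \<otimes> s) \<odot>\<^bsub>P\<^esub> c"
      using P.smult_e_c[of "u \<otimes> e \<otimes> b \<otimes> a"] uA w P.e_closed by (simp add: s_def KA.m_assoc)
    finally have "(u \<otimes> e \<otimes> b) \<odot>\<^bsub>P\<^esub> w = c" using u(2) P.e_c by simp
    then show ?thesis using uA w P.e_closed unfolding U_def by blast
  qed
  have subU: "submodule U A P"
  proof (rule P.submoduleI)
    show "U \<subseteq> carrier P" by (auto simp: U_def)
    show "\<zero>\<^bsub>P\<^esub> \<in> U" using c0 by (auto simp: U_def P.smult_r_null)
  next
    fix x y assume x: "x \<in> U" and y: "y \<in> U"
    then have xy: "x \<in> carrier P" "y \<in> carrier P" by (auto simp: U_def)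
    obtain a where a: "a \<in> carrier A" "x = a \<odot>\<^bsub>P\<^esub> c" using P.generates[OF xy(1)] by blast
    obtain a' where a': "a' \<in> carrier A" "y = a' \<odot>\<^bsub>P\<^esub> c" using P.generates[OF xy(2)] by blast
    show "x \<oplus>\<^bsub>P\<^esub> y \<in> U"
    proof (rule ccontr)
      assume "x \<oplus>\<^bsub>P\<^esub> y \<notin> U"
      then obtain b where b: "b \<in> carrier A" "b \<odot>\<^bsub>P\<^esub> (x \<oplus>\<^bsub>P\<^esub> y) = c"
        using xy by (auto simp: U_def)
      define s where "s = e \<otimes> b \<otimes> a \<otimes> e"
      define t where "t = e \<otimes> b \<otimes> a' \<otimes> e"
      have eA: "e \<in> carrier A" "e \<otimes> e = e" using P.e_closed P.idem by auto
      have "e \<otimes> s = (e \<otimes> e) \<otimes> b \<otimes> a \<otimes> e" "s \<otimes> e = e \<otimes> b \<otimes> a \<otimes> (e \<otimes> e)"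
        unfolding s_def using eA(1) a b by (simp_all add: KA.m_assoc)
      then have s: "s \<in> corner A e" using eA a b by (simp add: corner_def s_def)
      have "e \<otimes> t = (e \<otimes> e) \<otimes> b \<otimes> a' \<otimes> e" "t \<otimes> e = e \<otimes> b \<otimes> a' \<otimes> (e \<otimes> e)"
        unfolding t_def using eA(1) a' b by (simp_all add: KA.m_assoc)
      then have t: "t \<in> corner A e" using eA a' b by (simp add: corner_def t_def)
      have "b \<odot>\<^bsub>P\<^esub> (x \<oplus>\<^bsub>P\<^esub> y) = (b \<otimes> a \<oplus> b \<otimes> a') \<odot>\<^bsub>P\<^esub> c"
        using a a' b P.c_closed P.smult_closed by (simp add: P.smult_r_distr P.smult_l_distr P.smult_assoc)
      then have "(b \<otimes> a \<oplus> b \<otimes> a') \<odot>\<^bsub>P\<^esub> c = \<one> \<odot>\<^bsub>P\<^esub> c"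
        using b P.c_closed by (simp add: P.smult_one)
      then have "(b \<otimes> a \<oplus> b \<otimes> a') \<otimes> e = e"
        using P.smult_c_eqD[of "b \<otimes> a \<oplus> b \<otimes> a'" \<one>] a a' b eA by simp
      then have "e \<otimes> ((b \<otimes> a \<oplus> b \<otimes> a') \<otimes> e) = e" using eA by simp
      then have "s \<oplus> t = e"
        unfolding s_def t_def using eA a a' b by (simp add: KA.m_assoc KA.l_distr KA.r_distr)
      then have "\<not> nilpotent A s \<or> \<not> nilpotent A t" by (rule corner_sum_unit[OF prim s t])
      then show False
        using unit_notin[OF a(2,1) b(1)] unit_notin[OF a'(2,1) b(1)] x y by (auto simp: s_def t_def)
    qed
  next
    fix a x assume "a \<in> carrier A" "x \<in> U"
    then show "a \<odot>\<^bsub>P\<^esub> x \<in> U"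
      unfolding U_def using P.smult_closed P.smult_assoc KA.m_closed by (auto simp: P.smult_assoc[symmetric])
  qed
  have cU: "c \<notin> U"
    using P.smult_one[OF P.c_closed] KA.one_closed unfolding U_def by blast
  \<comment> \<open>A submodule with an element outside \<open>U\<close> contains \<open>c\<close> and is everything.\<close>
  have large: "carrier P \<subseteq> V" if V: "submodule V A P" "x \<in> V" "x \<notin> U" for V x
  proof
    note V' = P.submodule_facts[OF V(1)]
    have "x \<in> carrier P" using V V' by blast
    then obtain b where "b \<in> carrier A" "b \<odot>\<^bsub>P\<^esub> x = c" using V(3) by (auto simp: U_def)
    then have "c \<in> V" using V'(4) V(2) by metis
    moreover fix w assume "w \<in> carrier P"
    ultimately show "w \<in> V" using P.generates V'(4) by metis
  qed
  obtain S :: "('a, 'm) module" and q where S: "left_module A S" and q: "q \<in> lmod_hom A P S"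
    and surj: "q ` carrier P = carrier S" and ker: "lmod_ker P S q = U"
    using ex_quotient_module[OF P.left_module_axioms subU] by blast
  interpret q: lmod_hom_pair A P S q using P.left_module_axioms S q by (rule lmod_hom_pairI)
  have kerD: "q w = \<zero>\<^bsub>S\<^esub> \<longleftrightarrow> w \<in> U" if "w \<in> carrier P" for w
    using ker that by (auto simp: lmod_ker_def)
  have "simple_module A S"
    unfolding simple_module_def
  proof (intro conjI allI impI S)
    show "carrier S \<noteq> {\<zero>\<^bsub>S\<^esub>}" using kerD[OF P.c_closed] cU q.hom_closed[OF P.c_closed] by blast
    fix T assume T: "submodule T A S"
    note T' = q.N.submodule_facts[OF T]
    define V where "V = {w \<in> carrier P. q w \<in> T}"
    have V: "submodule V A P"
      by (rule P.submoduleI)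
        (auto simp: V_def q.hom_zero q.hom_add q.hom_smult P.smult_closed T')
    show "T = {\<zero>\<^bsub>S\<^esub>} \<or> T = carrier S"
    proof (cases "V \<subseteq> U")
      case True
      have "t = \<zero>\<^bsub>S\<^esub>" if t: "t \<in> T" for t
      proof -
        obtain w where w: "w \<in> carrier P" "t = q w" using t T'(1) surj by blast
        then have "w \<in> U" using t True by (auto simp: V_def)
        then show ?thesis using kerD w by simp
      qed
      then show ?thesis using T'(2) by blast
    next
      case False
      then obtain x where "x \<in> V" "x \<notin> U" by blast
      then have "carrier P \<subseteq> V" using large[OF V] by blast
      then have "q ` carrier P \<subseteq> T" by (auto simp: V_def)
      then have "carrier S \<subseteq> T" using surj by simp
      then show ?thesis using T'(1) by blast
    qed
  qed
  then show thesis
    using that[of S q] q surj kerD by (simp add: U_def)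
qed

text \<open>Let \<open>P'\<close> be the projective cover of the simple top \<open>S\<close> of \<open>P\<close> and lift \<open>P' \<rightarrow> S\<close> to
  \<open>u : P' \<rightarrow> P\<close>. The image of \<open>u\<close> contains a generator of \<open>P\<close>, so \<open>u\<close> has a section \<open>s\<close>. The image of \<open>s\<close> and
  the superfluous kernel of \<open>P' \<rightarrow> S\<close> together span \<open>P'\<close>, so \<open>s\<close> is onto and \<open>u\<close> is an isomorphism.
  The element \<open>w\<close> is the image under \<open>u\<close> of a nonzero element of the distinguished simple submodule
  of \<open>P'\<close>.\<close>

lemma socle_condition_imp_common_kernel:
  fixes P :: "'a umod"
  assumes pres: "idempotent_presentation A P e c" and prim: "primitive_idempotent A e"
    and soc: "\<forall>S :: 'a umod. simple_module A S \<longrightarrow> socle_condition A S"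
  obtains w where "w \<in> carrier P" "w \<noteq> \<zero>\<^bsub>P\<^esub>"
    "\<And>(W :: 'a umod) f. \<lbrakk>indec_projective A W; \<not> lmod_iso A W P; f \<in> lmod_hom A P W\<rbrakk> \<Longrightarrow> f w = \<zero>\<^bsub>W\<^esub>"
proof -
  interpret P: idempotent_presentation A P e c by fact
  obtain S :: "'a umod" and q where S: "simple_module A S" and q: "q \<in> lmod_hom A P S"
    and qsurj: "q ` carrier P = carrier S"
    and ker: "\<And>w. w \<in> carrier P \<Longrightarrow> q w = \<zero>\<^bsub>S\<^esub> \<longleftrightarrow> (\<forall>b \<in> carrier A. b \<odot>\<^bsub>P\<^esub> w \<noteq> c)"
    by (rule ex_simple_top[OF pres prim]) blast
  have lS: "left_module A S" using S by (simp add: simple_module_def)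
  have "socle_condition A S" using soc S by blast
  then obtain P' :: "'a umod" and p \<Q> S\<^sub>0 T where cover: "projective_cover A P' p S"
    and compl: "complementary_projectives A P' \<Q>"
    and S0: "simple_module A (P'\<lparr>carrier := S\<^sub>0\<rparr>)"
    and T: "internal_direct_sum A (P'\<lparr>carrier := socle A P'\<rparr>) S\<^sub>0 T"
    and kills: "\<forall>W :: 'a umod. in_add A (direct_sum \<Q> (\<lambda>Y. Y)) W \<longrightarrow>
      (\<forall>f \<in> lmod_hom A P' W. S\<^sub>0 \<subseteq> lmod_ker P' W f)"
    unfolding socle_condition_def by (elim exE conjE) (rule that)
  have P': "fg_projective A P'" and p: "p \<in> lmod_hom A P' S" and psurj: "p ` carrier P' = carrier S"
    and super: "\<And>U. \<lbrakk>submodule U A P'; U <+>\<^bsub>P'\<^esub> lmod_ker P' S p = carrier P'\<rbrakk> \<Longrightarrow> U = carrier P'"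
    using cover by (simp_all add: projective_cover_def)
  have lP': "left_module A P'" using P' by (simp add: fg_projective_def)
  interpret P': left_module A P' by (rule lP')
  have gS: "fin_gen A S" by (rule fin_gen_image[OF P.left_module_axioms lS P.fin_gen q qsurj])
  obtain u where u: "u \<in> lmod_hom A P' P" and qu: "\<And>x. x \<in> carrier P' \<Longrightarrow> q (u x) = p x"
    by (rule fg_projective_lift[OF P' P.left_module_axioms P.fin_gen lS gS q p qsurj]) blast
  interpret q: lmod_hom_pair A P S q using P.left_module_axioms lS q by (rule lmod_hom_pairI)
  interpret u: lmod_hom_pair A P' P u using lP' P.left_module_axioms u by (rule lmod_hom_pairI)
  obtain z where z: "z \<in> carrier P'" "p z = q c"
    using psurj q.hom_closed[OF P.c_closed] by (metis imageE)
  have "q c \<noteq> \<zero>\<^bsub>S\<^esub>" using ker[OF P.c_closed] P.smult_one[OF P.c_closed] by blast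
  then have "q (u z) \<noteq> \<zero>\<^bsub>S\<^esub>" using qu z by simp
  then obtain b where b: "b \<in> carrier A" "b \<odot>\<^bsub>P\<^esub> u z = c" using ker u.hom_closed[OF z(1)] by blast
  \<comment> \<open>Multiplication with \<open>e\<close> turns the preimage of \<open>c\<close> into a possible image of \<open>c\<close> under \<open>s\<close>.\<close>
  define z' where "z' = (e \<otimes> b) \<odot>\<^bsub>P'\<^esub> z"
  have z': "z' \<in> carrier P'" "e \<odot>\<^bsub>P'\<^esub> z' = z'" "u z' = c"
  proof -
    show "z' \<in> carrier P'" using z b P.e_closed P'.smult_closed by (simp add: z'_def)
    show "e \<odot>\<^bsub>P'\<^esub> z' = z'"
      using z b P.e_closed P.idem by (simp add: z'_def P'.smult_assoc[symmetric] KA.m_assoc[symmetric])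
    have "u z' = e \<odot>\<^bsub>P\<^esub> (b \<odot>\<^bsub>P\<^esub> u z)"
      using z b P.e_closed u.hom_closed by (simp add: z'_def u.hom_smult P.smult_assoc)
    then show "u z' = c" using b P.e_c by simp
  qed
  obtain s where s: "s \<in> lmod_hom A P P'" "\<And>a. a \<in> carrier A \<Longrightarrow> s (a \<odot>\<^bsub>P\<^esub> c) = a \<odot>\<^bsub>P'\<^esub> z'"
    using P.ex_hom[OF lP' z'(1,2)] by blast
  interpret s: lmod_hom_pair A P P' s using P.left_module_axioms lP' s(1) by (rule lmod_hom_pairI)
  have us: "u (s w) = w" if w: "w \<in> carrier P" for w
  proof -
    obtain a where "a \<in> carrier A" "w = a \<odot>\<^bsub>P\<^esub> c" using P.generates[OF w] by blast
    then show ?thesis using s(2) z' by (simp add: u.hom_smult)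
  qed
  have ssurj: "s ` carrier P = carrier P'"
  proof (rule super)
    show "submodule (s ` carrier P) A P'" by (rule s.submodule_image[OF P.submodule_carrier])
    have "v \<in> s ` carrier P <+>\<^bsub>P'\<^esub> lmod_ker P' S p" if v: "v \<in> carrier P'" for v
    proof -
      have uv: "u v \<in> carrier P" "s (u v) \<in> carrier P'"
        using v u.hom_closed s.hom_closed by auto
      have "u (v \<ominus>\<^bsub>P'\<^esub> s (u v)) = \<zero>\<^bsub>P\<^esub>"
        using v uv by (simp add: u.hom_diff us P.diff_eq_zero_iff)
      then have "p (v \<ominus>\<^bsub>P'\<^esub> s (u v)) = \<zero>\<^bsub>S\<^esub>"
        using qu[of "v \<ominus>\<^bsub>P'\<^esub> s (u v)"] v uv by (simp add: q.hom_zero)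
      then have "v \<ominus>\<^bsub>P'\<^esub> s (u v) \<in> lmod_ker P' S p" using v uv by (simp add: lmod_ker_def)
      then show ?thesis unfolding mem_set_add using P'.decompose_diff[OF v uv(2)] uv(1) by blast
    qed
    moreover have "s ` carrier P <+>\<^bsub>P'\<^esub> lmod_ker P' S p \<subseteq> carrier P'"
      using s.hom_closed by (auto simp: mem_set_add lmod_ker_def)
    ultimately show "s ` carrier P <+>\<^bsub>P'\<^esub> lmod_ker P' S p = carrier P'" by blast
  qed
  have su: "s (u v) = v" if v: "v \<in> carrier P'" for v
  proof -
    obtain w where "w \<in> carrier P" "v = s w" using v ssurj by blast
    then show ?thesis using us by simp
  qed
  have "inj_on u (carrier P')" by (rule inj_on_inverseI[of _ s]) (rule su)
  moreover have "u ` carrier P' = carrier P"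
  proof (rule equalityI; rule subsetI)
    show "w \<in> u ` carrier P'" if "w \<in> carrier P" for w
      by (rule image_eqI[of _ _ "s w"]) (use that us s.hom_closed in auto)
  qed (use u.hom_closed in auto)
  ultimately have ubij: "bij_betw u (carrier P') (carrier P)" by (simp add: bij_betw_def)
  have S0sub: "S\<^sub>0 \<subseteq> carrier P'"
  proof -
    have "submodule S\<^sub>0 A (P'\<lparr>carrier := socle A P'\<rparr>)"
      using T by (simp add: internal_direct_sum_def)
    then have "S\<^sub>0 \<subseteq> socle A P'" by (auto simp: submodule_def subgroup_def)
    moreover have "socle A P' \<subseteq> carrier P'"
    proof -
      have "carrier P' \<in> {U. submodule U A P' \<and>
          (\<forall>T. submodule T A P' \<and> simple_module A (P'\<lparr>carrier := T\<rparr>) \<longrightarrow> T \<subseteq> U)}"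
        using P'.submodule_carrier P'.submodule_facts(1) by blast
      then show ?thesis unfolding socle_def by (rule Inter_lower)
    qed
    ultimately show ?thesis by blast
  qed
  obtain x where x: "x \<in> S\<^sub>0" "x \<noteq> \<zero>\<^bsub>P'\<^esub>"
  proof -
    have "left_module A (P'\<lparr>carrier := S\<^sub>0\<rparr>)" "S\<^sub>0 \<noteq> {\<zero>\<^bsub>P'\<^esub>}"
      using S0 by (auto simp: simple_module_def)
    moreover from this(1) have "\<zero>\<^bsub>P'\<^esub> \<in> S\<^sub>0"
      using abelian_groupE(2)[of "P'\<lparr>carrier := S\<^sub>0\<rparr>"] by (simp add: left_module_def)
    ultimately show thesis using that by blast
  qed
  have xP': "x \<in> carrier P'" using x S0sub by blast
  show thesis
  proof (rule that[of "u x"])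
    show "u x \<in> carrier P" using xP' by (rule u.hom_closed)
    show "u x \<noteq> \<zero>\<^bsub>P\<^esub>" using su[OF xP'] s.hom_zero x by metis
    fix W :: "'a umod" and f
    assume W: "indec_projective A W" "\<not> lmod_iso A W P" and f: "f \<in> lmod_hom A P W"
    have lW: "left_module A W" using W by (simp add: indec_projective_def indecomposable_module_def)
    have "\<not> lmod_iso A W P'"
    proof
      assume "lmod_iso A W P'"
      then obtain g where g: "g \<in> lmod_hom A W P'" "bij_betw g (carrier W) (carrier P')"
        by (auto simp: lmod_iso_def)
      have "bij_betw (\<lambda>x. u (g x)) (carrier W) (carrier P)"
        using bij_betw_trans[OF g(2) ubij] by (simp add: comp_def)
      then show False using W(2) lmod_hom_comp[OF lW g(1) u] unfolding lmod_iso_def by blast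
    qed
    then obtain Y where Y: "Y \<in> \<Q>" "lmod_iso A W Y"
      using compl W(1) unfolding complementary_projectives_def by blast
    have \<Q>: "left_module A Y" if "Y \<in> \<Q>" for Y
      using compl that by (auto simp: complementary_projectives_def indec_projective_def
          indecomposable_module_def)
    have "in_add A (direct_sum \<Q> (\<lambda>Y. Y)) W"
      by (rule in_add_direct_sum[OF KA.ring_axioms lW \<Q> Y])
    then have "S\<^sub>0 \<subseteq> lmod_ker P' W (\<lambda>x. f (u x))"
      using lmod_hom_comp[OF lP' u f] kills by blast
    then show "f (u x) = \<zero>\<^bsub>W\<^esub>" using x by (auto simp: lmod_ker_def)
  qed
qed

end

text \<open>Let \<open>e\<close> be a primitive idempotent of a finite dimensional algebra. The elements of \<open>eA\<close> that do
  not generate \<open>eA\<close> form its largest proper right submodule, and \<open>y\<close> annihilates them; so \<open>ea \<mapsto> ya\<close>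
  embeds the simple top of \<open>eA\<close> into \<open>A\<close> as a right module.\<close>

definition right_top_embeds :: "('a, 'c) ring_scheme \<Rightarrow> 'a \<Rightarrow> bool" where
  "right_top_embeds A e \<longleftrightarrow> (\<exists>y \<in> carrier A. y \<noteq> \<zero>\<^bsub>A\<^esub> \<and> y \<otimes>\<^bsub>A\<^esub> e = y \<and>
     (\<forall>x \<in> carrier A. e \<otimes>\<^bsub>A\<^esub> x = x \<and> (\<forall>a \<in> carrier A. x \<otimes>\<^bsub>A\<^esub> a \<noteq> e) \<longrightarrow> y \<otimes>\<^bsub>A\<^esub> x = \<zero>\<^bsub>A\<^esub>))"

text \<open>The common kernel provides \<open>y\<close> with \<open>y e\<^sub>i A e\<^sub>j = 0\<close> for \<open>j \<noteq> i\<close>, a property that right multiples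
  \<open>yr\<close> with \<open>e\<^sub>i r = r\<close> inherit; choose one that is moreover killed by the nilpotent elements of
  \<open>e\<^sub>iAe\<^sub>i\<close>. For \<open>x\<close> in \<open>e\<^sub>iA\<close> not generating \<open>e\<^sub>iA\<close>, the component \<open>xe\<^sub>i\<close> is not a unit of the corner,
  hence nilpotent, and the components \<open>xe\<^sub>j\<close> correspond to homomorphisms between different
  summands.\<close>

lemma (in fin_dim_algebra_over_field) socle_condition_imp_right_top_embeds:
  fixes P :: "nat \<Rightarrow> 'a umod"
  assumes dec: "basic_decomposition A n P e c"
    and soc: "\<forall>S :: 'a umod. simple_module A S \<longrightarrow> socle_condition A S"
    and i: "i < n"
  shows "right_top_embeds A (e i)"
proof -
  note indec = basic_decompositionD(1)[OF dec] and noniso = basic_decompositionD(2)[OF dec]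
    and pres = basic_decompositionD(3)[OF dec] and one = basic_decompositionD(4)[OF dec]
  interpret P: idempotent_presentation A "P i" "e i" "c i" by (rule pres[OF i])
  have prim: "primitive_idempotent A (e i)" by (rule P.primitive[OF indec[OF i]])
  have eA: "e j \<in> carrier A" if "j < n" for j
    using pres[OF that] by (simp add: idempotent_presentation_def idempotent_presentation_axioms_def)
  obtain w where w: "w \<in> carrier (P i)" "w \<noteq> \<zero>\<^bsub>P i\<^esub>"
    and wf: "\<And>(W :: 'a umod) f. \<lbrakk>indec_projective A W; \<not> lmod_iso A W (P i); f \<in> lmod_hom A (P i) W\<rbrakk> \<Longrightarrow>
      f w = \<zero>\<^bsub>W\<^esub>"
    by (rule socle_condition_imp_common_kernel[OF pres[OF i] prim soc]) (rule that; blast)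
  obtain a where a: "a \<in> carrier A" "w = a \<odot>\<^bsub>P i\<^esub> c i" using P.generates[OF w(1)] by blast
  define y where "y = a \<otimes> e i"
  have y: "y \<in> carrier A" "y \<otimes> e i = y"
    using a P.e_closed P.idem by (simp_all add: y_def KA.m_assoc)
  have "y \<noteq> \<zero>"
  proof
    assume "y = \<zero>"
    then have "(a \<otimes> e i) \<odot>\<^bsub>P i\<^esub> c i = \<zero>\<^bsub>P i\<^esub>"
      using P.smult_l_null[OF P.c_closed] unfolding y_def by simp
    then show False using w(2) a(2) P.smult_e_c[OF a(1)] by simp
  qed
  then obtain r where r: "r \<in> carrier A" "y \<otimes> r \<noteq> \<zero>" "e i \<otimes> r = r" "y \<otimes> r \<otimes> e i = y \<otimes> r"
    and nil: "\<And>x. \<lbrakk>x \<in> corner A (e i); nilpotent A x\<rbrakk> \<Longrightarrow> y \<otimes> r \<otimes> x = \<zero>"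
    using ex_multiple_killed_by_nilpotents[OF prim y] by blast
  have "y \<otimes> r \<otimes> x = \<zero>"
    if x: "x \<in> carrier A" "e i \<otimes> x = x" and nu: "\<And>b. b \<in> carrier A \<Longrightarrow> x \<otimes> b \<noteq> e i" for x
  proof -
    have "y \<otimes> r \<otimes> x \<otimes> e j = \<zero>" if j: "j < n" for j
    proof (cases "j = i")
      case True
      have xe: "x \<otimes> e i \<in> corner A (e i)"
        using x P.e_closed P.idem by (simp add: corner_def KA.m_assoc) (simp add: KA.m_assoc[symmetric])
      have "nilpotent A (x \<otimes> e i)"
      proof (rule ccontr)
        assume "\<not> nilpotent A (x \<otimes> e i)"
        then obtain b where b: "b \<in> corner A (e i)" "x \<otimes> e i \<otimes> b = e i"
          using corner_nilpotent_or_unit[OF prim xe] by blast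
        then have "x \<otimes> (e i \<otimes> b) = e i" using x P.e_closed by (simp add: corner_def KA.m_assoc)
        then show False using nu[of "e i \<otimes> b"] P.e_closed b by (simp add: corner_def)
      qed
      then show ?thesis using nil[OF xe] True x y r P.e_closed by (simp add: KA.m_assoc)
    next
      case False
      interpret Pj: idempotent_presentation A "P j" "e j" "c j" by (rule pres[OF j])
      define t where "t = r \<otimes> x \<otimes> e j"
      have t: "t \<in> carrier A" "e i \<otimes> t = t" "t \<otimes> e j = t"
        using r x Pj.e_closed Pj.idem P.e_closed
        by (simp_all add: t_def KA.m_assoc[symmetric]) (simp add: KA.m_assoc)
      have u: "t \<odot>\<^bsub>P j\<^esub> c j \<in> carrier (P j)" "e i \<odot>\<^bsub>P j\<^esub> (t \<odot>\<^bsub>P j\<^esub> c j) = t \<odot>\<^bsub>P j\<^esub> c j"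
        using t P.e_closed Pj.c_closed Pj.smult_closed by (simp_all add: Pj.smult_assoc[symmetric])
      obtain f where f: "f \<in> lmod_hom A (P i) (P j)"
        "\<And>b. b \<in> carrier A \<Longrightarrow> f (b \<odot>\<^bsub>P i\<^esub> c i) = b \<odot>\<^bsub>P j\<^esub> (t \<odot>\<^bsub>P j\<^esub> c j)"
        using P.ex_hom[OF Pj.left_module_axioms u] by blast
      have "indec_projective A (P j)"
        using indec[OF j] Pj.fg_projective by (simp add: indec_projective_def)
      then have "f w = \<zero>\<^bsub>P j\<^esub>" using wf noniso[OF j i False] f(1) by blast
      then have "(a \<otimes> t) \<odot>\<^bsub>P j\<^esub> c j = \<zero>\<^bsub>P j\<^esub>"
        using a f(2) t Pj.c_closed by (simp add: Pj.smult_assoc)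
      then have "a \<otimes> t \<otimes> e j = \<zero>" using Pj.annihilates a t by simp
      then have "a \<otimes> (e i \<otimes> t) = \<zero>" using a t Pj.e_closed by (simp add: KA.m_assoc)
      then show ?thesis using a r x t Pj.e_closed P.e_closed by (simp add: y_def t_def KA.m_assoc)
    qed
    then have zero: "(\<Oplus>j\<in>{..<n}. y \<otimes> r \<otimes> x \<otimes> e j) = \<zero>"
      using KA.finsum_cong'[of "{..<n}" "{..<n}" "\<lambda>_. \<zero>" "\<lambda>j. y \<otimes> r \<otimes> x \<otimes> e j"]
      by (simp add: KA.finsum_zero)
    have "y \<otimes> r \<otimes> x = y \<otimes> r \<otimes> x \<otimes> (\<Oplus>j\<in>{..<n}. e j)" using y r x by (simp add: one)
    also have "\<dots> = (\<Oplus>j\<in>{..<n}. y \<otimes> r \<otimes> x \<otimes> e j)"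
      using y r x eA by (intro KA.finsum_rdistr) auto
    finally show ?thesis using zero by simp
  qed
  then show ?thesis unfolding right_top_embeds_def using r y by (intro bexI[of _ "y \<otimes> r"]) auto
qed

section \<open>Splitting injections between projective modules\<close>

abbreviation functionals :: "('a, 'c) ring_scheme \<Rightarrow> ('a, 'm) module \<Rightarrow> ('m \<Rightarrow> 'a) set" where
  "functionals A P \<equiv> lmod_hom A P (regular_module A)"

lemma functionalD:
  assumes "\<phi> \<in> functionals A P"
  shows "\<And>x. x \<in> carrier P \<Longrightarrow> \<phi> x \<in> carrier A"
    and "\<And>x y. \<lbrakk>x \<in> carrier P; y \<in> carrier P\<rbrakk> \<Longrightarrow> \<phi> (x \<oplus>\<^bsub>P\<^esub> y) = \<phi> x \<oplus>\<^bsub>A\<^esub> \<phi> y"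
    and "\<And>a x. \<lbrakk>a \<in> carrier A; x \<in> carrier P\<rbrakk> \<Longrightarrow> \<phi> (a \<odot>\<^bsub>P\<^esub> x) = a \<otimes>\<^bsub>A\<^esub> \<phi> x"
  using lmod_homD[OF assms] by (simp_all add: regular_module_simps)

lemma functionalI:
  assumes "\<And>x. x \<in> carrier P \<Longrightarrow> \<phi> x \<in> carrier A"
    and "\<And>x y. \<lbrakk>x \<in> carrier P; y \<in> carrier P\<rbrakk> \<Longrightarrow> \<phi> (x \<oplus>\<^bsub>P\<^esub> y) = \<phi> x \<oplus>\<^bsub>A\<^esub> \<phi> y"
    and "\<And>a x. \<lbrakk>a \<in> carrier A; x \<in> carrier P\<rbrakk> \<Longrightarrow> \<phi> (a \<odot>\<^bsub>P\<^esub> x) = a \<otimes>\<^bsub>A\<^esub> \<phi> x"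
  shows "\<phi> \<in> functionals A P"
  using assms by (intro lmod_homI) (simp_all add: regular_module_simps)

text \<open>Functionals are functions on the whole type of which only the values on the carrier
  matter; the last clause makes membership independent of the other values.\<close>

definition right_submodule ::
  "('a, 'c) ring_scheme \<Rightarrow> ('a, 'm) module \<Rightarrow> ('m \<Rightarrow> 'a) set \<Rightarrow> bool" where
  "right_submodule A P N \<longleftrightarrow> N \<subseteq> functionals A P \<and> (\<lambda>_. \<zero>\<^bsub>A\<^esub>) \<in> N \<and>
     (\<forall>\<phi> \<in> N. \<forall>\<psi> \<in> N. (\<lambda>x. \<phi> x \<oplus>\<^bsub>A\<^esub> \<psi> x) \<in> N) \<and>
     (\<forall>\<phi> \<in> N. \<forall>a \<in> carrier A. (\<lambda>x. \<phi> x \<otimes>\<^bsub>A\<^esub> a) \<in> N) \<and>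
     (\<forall>\<phi> \<in> N. \<forall>\<psi>. (\<forall>x \<in> carrier P. \<psi> x = \<phi> x) \<longrightarrow> \<psi> \<in> N)"

lemma right_submoduleD:
  assumes "right_submodule A P N"
  shows "\<And>\<phi>. \<phi> \<in> N \<Longrightarrow> \<phi> \<in> functionals A P" and "(\<lambda>_. \<zero>\<^bsub>A\<^esub>) \<in> N"
    and "\<And>\<phi> \<psi>. \<lbrakk>\<phi> \<in> N; \<psi> \<in> N\<rbrakk> \<Longrightarrow> (\<lambda>x. \<phi> x \<oplus>\<^bsub>A\<^esub> \<psi> x) \<in> N"
    and "\<And>\<phi> a. \<lbrakk>\<phi> \<in> N; a \<in> carrier A\<rbrakk> \<Longrightarrow> (\<lambda>x. \<phi> x \<otimes>\<^bsub>A\<^esub> a) \<in> N"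
    and "\<And>\<phi> \<psi>. \<lbrakk>\<phi> \<in> N; \<And>x. x \<in> carrier P \<Longrightarrow> \<psi> x = \<phi> x\<rbrakk> \<Longrightarrow> \<psi> \<in> N"
  using assms unfolding right_submodule_def by (blast, blast, blast, blast, metis)

lemma right_submodule_finsum:
  assumes "ring A" and N: "right_submodule A P N" and \<phi>: "\<And>i. i \<in> I \<Longrightarrow> \<phi> i \<in> N"
  shows "(\<lambda>x. \<Oplus>\<^bsub>A\<^esub>i\<in>I. \<phi> i x) \<in> N"
  using \<phi>
proof (induction I rule: infinite_finite_induct)
  interpret ring A by fact
  note N' = right_submoduleD[OF N]
  case (insert i I)
  have "(\<lambda>x. \<phi> i x \<oplus>\<^bsub>A\<^esub> (\<Oplus>\<^bsub>A\<^esub>i\<in>I. \<phi> i x)) \<in> N" using insert by (intro N'(3)) auto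
  then show ?case
  proof (rule N'(5))
    fix x assume "x \<in> carrier P"
    then have "\<phi> j x \<in> carrier A" if "j \<in> insert i I" for j
      using functionalD(1)[OF N'(1)[OF insert.prems[OF that]]] by blast
    then show "(\<Oplus>\<^bsub>A\<^esub>i\<in>insert i I. \<phi> i x) = \<phi> i x \<oplus>\<^bsub>A\<^esub> (\<Oplus>\<^bsub>A\<^esub>i\<in>I. \<phi> i x)"
      using insert.hyps by (intro finsum_insert) auto
  qed
next
  interpret ring A by fact
  case (infinite I)
  then show ?case using right_submoduleD(2)[OF N] by (simp add: finsum_infinite)
next
  interpret ring A by fact
  case empty
  then show ?case using right_submoduleD(2)[OF N] by simp
qed

text \<open>The right submodule \<open>N + vA\<close>, with equality of functionals taken on the carrier.\<close>

definition adjoin ::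
  "('a, 'c) ring_scheme \<Rightarrow> ('a, 'm) module \<Rightarrow> ('m \<Rightarrow> 'a) set \<Rightarrow> ('m \<Rightarrow> 'a) \<Rightarrow> ('m \<Rightarrow> 'a) set" where
  "adjoin A P N v = {\<phi>. \<exists>\<nu> \<in> N. \<exists>a \<in> carrier A. \<forall>x \<in> carrier P. \<phi> x = \<nu> x \<oplus>\<^bsub>A\<^esub> v x \<otimes>\<^bsub>A\<^esub> a}"

lemma adjoinI:
  "\<lbrakk>\<nu> \<in> N; a \<in> carrier A; \<And>x. x \<in> carrier P \<Longrightarrow> \<phi> x = \<nu> x \<oplus>\<^bsub>A\<^esub> v x \<otimes>\<^bsub>A\<^esub> a\<rbrakk> \<Longrightarrow> \<phi> \<in> adjoin A P N v"
  unfolding adjoin_def by blast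

lemma adjoinE:
  assumes "\<phi> \<in> adjoin A P N v"
  obtains \<nu> a where "\<nu> \<in> N" "a \<in> carrier A" "\<And>x. x \<in> carrier P \<Longrightarrow> \<phi> x = \<nu> x \<oplus>\<^bsub>A\<^esub> v x \<otimes>\<^bsub>A\<^esub> a"
  using assms unfolding adjoin_def by blast

lemma right_submodule_adjoin:
  assumes "left_module A P" and N: "right_submodule A P N" and v: "v \<in> functionals A P"
  shows "right_submodule A P (adjoin A P N v)"
    and "N \<subseteq> adjoin A P N v" and "v \<in> adjoin A P N v"
proof -
  interpret left_module A P by fact
  note N' = right_submoduleD[OF N]
  note v' = functionalD[OF v]
  have NA: "\<nu> x \<in> carrier A" if "\<nu> \<in> N" "x \<in> carrier P" for \<nu> x
    using functionalD(1)[OF N'(1)[OF that(1)] that(2)] .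
  show "N \<subseteq> adjoin A P N v"
    by (rule subsetI, rule adjoinI[of _ _ "\<zero>\<^bsub>A\<^esub>"]) (use NA v' in auto)
  show "v \<in> adjoin A P N v"
    by (rule adjoinI[OF N'(2), of "\<one>\<^bsub>A\<^esub>"]) (use v' in auto)
  show "right_submodule A P (adjoin A P N v)"
    unfolding right_submodule_def
  proof (intro conjI ballI allI impI)
    show "(\<lambda>_. \<zero>\<^bsub>A\<^esub>) \<in> adjoin A P N v"
      by (rule adjoinI[OF N'(2), of "\<zero>\<^bsub>A\<^esub>"]) (use v' in auto)
    show "adjoin A P N v \<subseteq> functionals A P"
    proof
      fix \<phi> assume "\<phi> \<in> adjoin A P N v"
      then obtain \<nu> a where \<nu>: "\<nu> \<in> N" "a \<in> carrier A"
        "\<And>x. x \<in> carrier P \<Longrightarrow> \<phi> x = \<nu> x \<oplus>\<^bsub>A\<^esub> v x \<otimes>\<^bsub>A\<^esub> a" by (rule adjoinE) (rule that; blast)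
      note \<nu>' = functionalD[OF N'(1)[OF \<nu>(1)]]
      show "\<phi> \<in> functionals A P"
        by (rule functionalI)
          (use \<nu> \<nu>' v' in \<open>simp_all add: M.a_closed smult_closed R.l_distr R.r_distr R.m_assoc R.a_ac\<close>)
    qed
    fix \<phi> assume "\<phi> \<in> adjoin A P N v"
    then obtain \<nu> a where \<nu>: "\<nu> \<in> N" "a \<in> carrier A"
      "\<And>x. x \<in> carrier P \<Longrightarrow> \<phi> x = \<nu> x \<oplus>\<^bsub>A\<^esub> v x \<otimes>\<^bsub>A\<^esub> a" by (rule adjoinE) (rule that; blast)
    show "(\<lambda>x. \<phi> x \<otimes>\<^bsub>A\<^esub> b) \<in> adjoin A P N v" if b: "b \<in> carrier A" for b
      by (rule adjoinI[OF N'(4)[OF \<nu>(1) b], of "a \<otimes>\<^bsub>A\<^esub> b"])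
        (use b \<nu> v' NA in \<open>auto simp: R.l_distr R.m_assoc\<close>)
    show "\<psi> \<in> adjoin A P N v" if "\<forall>x \<in> carrier P. \<psi> x = \<phi> x" for \<psi>
      by (rule adjoinI[OF \<nu>(1,2)]) (use that \<nu>(3) in simp)
    fix \<psi> assume "\<psi> \<in> adjoin A P N v"
    then obtain \<mu> b where \<mu>: "\<mu> \<in> N" "b \<in> carrier A"
      "\<And>x. x \<in> carrier P \<Longrightarrow> \<psi> x = \<mu> x \<oplus>\<^bsub>A\<^esub> v x \<otimes>\<^bsub>A\<^esub> b" by (rule adjoinE) (rule that; blast)
    show "(\<lambda>x. \<phi> x \<oplus>\<^bsub>A\<^esub> \<psi> x) \<in> adjoin A P N v"
      by (rule adjoinI[OF N'(3)[OF \<nu>(1) \<mu>(1)], of "a \<oplus>\<^bsub>A\<^esub> b"])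
        (use \<mu> \<nu> v' NA in \<open>auto simp: R.r_distr R.a_ac\<close>)
  qed
qed

lemma adjoin_mem_subset:
  assumes N: "right_submodule A P N" and v: "v \<in> N"
  shows "adjoin A P N v \<subseteq> N"
proof
  fix \<phi> assume "\<phi> \<in> adjoin A P N v"
  then obtain \<nu> a where \<nu>: "\<nu> \<in> N" "a \<in> carrier A"
    "\<And>x. x \<in> carrier P \<Longrightarrow> \<phi> x = \<nu> x \<oplus>\<^bsub>A\<^esub> v x \<otimes>\<^bsub>A\<^esub> a" by (rule adjoinE) (rule that; blast)
  note N' = right_submoduleD[OF N]
  show "\<phi> \<in> N" by (rule N'(5)[OF N'(3)[OF \<nu>(1) N'(4)[OF v \<nu>(2)]]]) (rule \<nu>(3))
qed

text \<open>Adjoin the members of \<open>V\<close> to \<open>N\<close> one after another and stop just before the first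
  step that captures all of \<open>V\<close>.\<close>

lemma ex_right_submodule_missing_one_generator:
  assumes P: "left_module A P" and "finite V" and "V \<subseteq> functionals A P"
    and "right_submodule A P N" and "\<not> V \<subseteq> N"
  shows "\<exists>N' v. right_submodule A P N' \<and> N \<subseteq> N' \<and> v \<in> V \<and> v \<notin> N' \<and> V \<subseteq> adjoin A P N' v"
  using assms(2-)
proof (induction V arbitrary: N rule: finite_induct)
  case empty
  then show ?case by simp
next
  case (insert u V)
  have u: "u \<in> functionals A P" and V: "V \<subseteq> functionals A P" using insert.prems by auto
  note adj = right_submodule_adjoin[OF P insert.prems(2) u]
  show ?case
  proof (cases "V \<subseteq> adjoin A P N u")
    case True
    then have "u \<notin> N" using adjoin_mem_subset[OF insert.prems(2)] insert.prems(3) by blast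
    then show ?thesis using True adj(3) insert.prems(2) by blast
  next
    case False
    obtain N' v where N': "right_submodule A P N'" "adjoin A P N u \<subseteq> N'" "v \<in> V" "v \<notin> N'"
      "V \<subseteq> adjoin A P N' v"
      using insert.IH[OF V adj(1) False] by blast
    have "v \<in> functionals A P" using N'(3) V by blast
    then have "N' \<subseteq> adjoin A P N' v" by (rule right_submodule_adjoin(2)[OF P N'(1)])
    then have "insert u V \<subseteq> adjoin A P N' v" using N'(2,5) adj(3) by blast
    then show ?thesis using N' adj(2) by blast
  qed
qed

text \<open>The assignment \<open>\<nu> + va \<mapsto> ya\<close> is well defined on \<open>P\<^sup>* = N + vA\<close>: if \<open>va\<close> is in \<open>N\<close>, then \<open>ea\<close>
  does not generate \<open>eA\<close>, since otherwise \<open>v = ve\<close> would be in \<open>N\<close>; hence \<open>ya = yea = 0\<close>. The element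
  of \<open>P\<close> at which this homomorphism is evaluation has coordinates \<open>y a k\<close>, its values at the
  functionals \<open>\<pi> k = \<nu> k + v a k\<close> of the dual basis. It is nonzero because \<open>v\<close> is sent to \<open>y\<close>.\<close>

lemma ex_common_zero_of_functionals:
  fixes P :: "('a, 'm) module" and A :: "('a, 'c) ring_scheme"
  assumes P: "left_module A P" and N: "right_submodule A P N"
    and p: "\<And>k. k < (m::nat) \<Longrightarrow> p k \<in> carrier P" and \<pi>: "\<And>k. k < m \<Longrightarrow> \<pi> k \<in> adjoin A P N v"
    and basis: "\<And>x. x \<in> carrier P \<Longrightarrow> x = (\<Oplus>\<^bsub>P\<^esub>k\<in>{..<m}. \<pi> k x \<odot>\<^bsub>P\<^esub> p k)"
    and v: "v \<in> functionals A P" "v \<notin> N" and e: "e \<in> carrier A" "e \<otimes>\<^bsub>A\<^esub> e = e"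
    and ve: "\<And>x. x \<in> carrier P \<Longrightarrow> v x \<otimes>\<^bsub>A\<^esub> e = v x" and kill: "right_top_embeds A e"
  shows "\<exists>z \<in> carrier P. z \<noteq> \<zero>\<^bsub>P\<^esub> \<and> (\<forall>\<phi> \<in> N. \<phi> z = \<zero>\<^bsub>A\<^esub>)"
proof -
  interpret P: left_module A P by (rule P)
  note N' = right_submoduleD[OF N]
  note v' = functionalD[OF v(1)]
  obtain y where y: "y \<in> carrier A" "y \<noteq> \<zero>\<^bsub>A\<^esub>" "y \<otimes>\<^bsub>A\<^esub> e = y"
    and yx: "\<And>x. \<lbrakk>x \<in> carrier A; e \<otimes>\<^bsub>A\<^esub> x = x; \<And>a. a \<in> carrier A \<Longrightarrow> x \<otimes>\<^bsub>A\<^esub> a \<noteq> e\<rbrakk> \<Longrightarrow>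
      y \<otimes>\<^bsub>A\<^esub> x = \<zero>\<^bsub>A\<^esub>"
    using kill unfolding right_top_embeds_def by blast
  have kills: "y \<otimes>\<^bsub>A\<^esub> x = \<zero>\<^bsub>A\<^esub>" if x: "x \<in> carrier A" "(\<lambda>w. v w \<otimes>\<^bsub>A\<^esub> x) \<in> N" for x
  proof -
    have "y \<otimes>\<^bsub>A\<^esub> (e \<otimes>\<^bsub>A\<^esub> x) = \<zero>\<^bsub>A\<^esub>"
    proof (rule yx)
      show "e \<otimes>\<^bsub>A\<^esub> x \<in> carrier A" "e \<otimes>\<^bsub>A\<^esub> (e \<otimes>\<^bsub>A\<^esub> x) = e \<otimes>\<^bsub>A\<^esub> x"
        using x e by (simp_all add: P.R.m_assoc[symmetric])
      fix a assume a: "a \<in> carrier A"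
      show "e \<otimes>\<^bsub>A\<^esub> x \<otimes>\<^bsub>A\<^esub> a \<noteq> e"
      proof
        assume eq: "e \<otimes>\<^bsub>A\<^esub> x \<otimes>\<^bsub>A\<^esub> a = e"
        have "v \<in> N"
        proof (rule N'(5)[OF N'(4)[OF x(2) a]])
          fix w assume w: "w \<in> carrier P"
          have "v w = v w \<otimes>\<^bsub>A\<^esub> (e \<otimes>\<^bsub>A\<^esub> x \<otimes>\<^bsub>A\<^esub> a)" using ve[OF w] by (simp add: eq)
          also have "\<dots> = v w \<otimes>\<^bsub>A\<^esub> e \<otimes>\<^bsub>A\<^esub> x \<otimes>\<^bsub>A\<^esub> a"
            using v'(1)[OF w] e x a by (simp add: P.R.m_assoc)
          finally show "v w = v w \<otimes>\<^bsub>A\<^esub> x \<otimes>\<^bsub>A\<^esub> a" using ve[OF w] by simp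
        qed
        then show False using v(2) by blast
      qed
    qed
    then show ?thesis using y x e by (simp add: P.R.m_assoc[symmetric])
  qed
  have "\<forall>k. \<exists>\<nu> a. k < m \<longrightarrow> \<nu> \<in> N \<and> a \<in> carrier A \<and>
      (\<forall>x \<in> carrier P. \<pi> k x = \<nu> x \<oplus>\<^bsub>A\<^esub> v x \<otimes>\<^bsub>A\<^esub> a)"
    using \<pi> unfolding adjoin_def by blast
  then obtain \<nu> a where \<nu>: "\<And>k. k < m \<Longrightarrow> \<nu> k \<in> N" and a: "\<And>k. k < m \<Longrightarrow> a k \<in> carrier A"
    and split: "\<And>k x. \<lbrakk>k < m; x \<in> carrier P\<rbrakk> \<Longrightarrow> \<pi> k x = \<nu> k x \<oplus>\<^bsub>A\<^esub> v x \<otimes>\<^bsub>A\<^esub> a k"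
    by metis
  define z where "z = (\<Oplus>\<^bsub>P\<^esub>k\<in>{..<m}. (y \<otimes>\<^bsub>A\<^esub> a k) \<odot>\<^bsub>P\<^esub> p k)"
  have inz: "(\<lambda>k. (y \<otimes>\<^bsub>A\<^esub> a k) \<odot>\<^bsub>P\<^esub> p k) \<in> {..<m} \<rightarrow> carrier P"
    using y a p P.smult_closed by auto
  have z: "z \<in> carrier P" unfolding z_def by (rule P.M.finsum_closed[OF inz])
  have lR: "left_module A (regular_module A)" by (rule left_module_regular[OF P.R.ring_axioms])
  define \<xi> where "\<xi> \<phi> = (\<Oplus>\<^bsub>A\<^esub>k\<in>{..<m}. a k \<otimes>\<^bsub>A\<^esub> \<phi> (p k))" for \<phi>
  define n where "n \<phi> = (\<lambda>x. \<Oplus>\<^bsub>A\<^esub>k\<in>{..<m}. \<nu> k x \<otimes>\<^bsub>A\<^esub> \<phi> (p k))" for \<phi>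
  have \<xi>: "\<xi> \<phi> \<in> carrier A" if "\<phi> \<in> functionals A P" for \<phi>
    unfolding \<xi>_def using a functionalD(1)[OF that] p by (intro P.R.finsum_closed) auto
  have n: "n \<phi> \<in> N" if "\<phi> \<in> functionals A P" for \<phi>
    unfolding n_def using functionalD(1)[OF that] p \<nu>
    by (intro right_submodule_finsum[OF P.R.ring_axioms N] N'(4)) auto
  have eval_z: "\<phi> z = y \<otimes>\<^bsub>A\<^esub> \<xi> \<phi>" if \<phi>: "\<phi> \<in> functionals A P" for \<phi>
  proof -
    note \<phi>' = functionalD[OF \<phi>]
    interpret \<phi>: lmod_hom_pair A P "regular_module A" \<phi> using P lR \<phi> by (rule lmod_hom_pairI)
    have in1: "(\<lambda>k. a k \<otimes>\<^bsub>A\<^esub> \<phi> (p k)) \<in> {..<m} \<rightarrow> carrier A" using a \<phi>'(1) p by auto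
    have "\<phi> z = (\<Oplus>\<^bsub>A\<^esub>k\<in>{..<m}. \<phi> ((y \<otimes>\<^bsub>A\<^esub> a k) \<odot>\<^bsub>P\<^esub> p k))"
      using \<phi>.hom_finsum[OF inz] by (simp add: z_def finsum_regular_module)
    also have "\<dots> = (\<Oplus>\<^bsub>A\<^esub>k\<in>{..<m}. y \<otimes>\<^bsub>A\<^esub> (a k \<otimes>\<^bsub>A\<^esub> \<phi> (p k)))"
      using y a p \<phi>' in1 by (intro P.R.finsum_cong') (auto simp: P.R.m_assoc)
    also have "\<dots> = y \<otimes>\<^bsub>A\<^esub> \<xi> \<phi>"
      unfolding \<xi>_def using in1 y by (intro P.R.finsum_rdistr[symmetric]) auto
    finally show ?thesis .
  qed
  have expand: "\<phi> x = n \<phi> x \<oplus>\<^bsub>A\<^esub> v x \<otimes>\<^bsub>A\<^esub> \<xi> \<phi>" if \<phi>: "\<phi> \<in> functionals A P" and x: "x \<in> carrier P" for \<phi> x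
  proof -
    note \<phi>' = functionalD[OF \<phi>]
    interpret \<phi>: lmod_hom_pair A P "regular_module A" \<phi> using P lR \<phi> by (rule lmod_hom_pairI)
    have \<nu>A: "\<nu> k x \<in> carrier A" if "k < m" for k using functionalD(1)[OF N'(1)[OF \<nu>[OF that]] x] .
    have in1: "(\<lambda>k. a k \<otimes>\<^bsub>A\<^esub> \<phi> (p k)) \<in> {..<m} \<rightarrow> carrier A" using a \<phi>'(1) p by auto
    have in2: "(\<lambda>k. \<nu> k x \<otimes>\<^bsub>A\<^esub> \<phi> (p k)) \<in> {..<m} \<rightarrow> carrier A" using \<nu>A \<phi>'(1) p by auto
    have in3: "(\<lambda>k. v x \<otimes>\<^bsub>A\<^esub> (a k \<otimes>\<^bsub>A\<^esub> \<phi> (p k))) \<in> {..<m} \<rightarrow> carrier A" using v'(1)[OF x] in1 by auto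
    have \<pi>A: "\<pi> k x \<in> carrier A" if "k < m" for k using split[OF that x] \<nu>A[OF that] v'(1)[OF x] a[OF that] by simp
    have in4: "(\<lambda>k. \<pi> k x \<odot>\<^bsub>P\<^esub> p k) \<in> {..<m} \<rightarrow> carrier P" using \<pi>A p P.smult_closed by auto
    have "\<phi> x = \<phi> (\<Oplus>\<^bsub>P\<^esub>k\<in>{..<m}. \<pi> k x \<odot>\<^bsub>P\<^esub> p k)" by (rule arg_cong[OF basis[OF x]])
    also have "\<dots> = (\<Oplus>\<^bsub>A\<^esub>k\<in>{..<m}. \<phi> (\<pi> k x \<odot>\<^bsub>P\<^esub> p k))"
      using \<phi>.hom_finsum[OF in4] by (simp add: finsum_regular_module)
    also have "\<dots> = (\<Oplus>\<^bsub>A\<^esub>k\<in>{..<m}. \<nu> k x \<otimes>\<^bsub>A\<^esub> \<phi> (p k) \<oplus>\<^bsub>A\<^esub> v x \<otimes>\<^bsub>A\<^esub> (a k \<otimes>\<^bsub>A\<^esub> \<phi> (p k)))"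
    proof (rule P.R.finsum_cong'[OF refl])
      show "(\<lambda>k. \<nu> k x \<otimes>\<^bsub>A\<^esub> \<phi> (p k) \<oplus>\<^bsub>A\<^esub> v x \<otimes>\<^bsub>A\<^esub> (a k \<otimes>\<^bsub>A\<^esub> \<phi> (p k))) \<in> {..<m} \<rightarrow> carrier A"
        using in2 in3 by auto
      fix k assume "k \<in> {..<m}"
      then have k: "k < m" by simp
      show "\<phi> (\<pi> k x \<odot>\<^bsub>P\<^esub> p k) = \<nu> k x \<otimes>\<^bsub>A\<^esub> \<phi> (p k) \<oplus>\<^bsub>A\<^esub> v x \<otimes>\<^bsub>A\<^esub> (a k \<otimes>\<^bsub>A\<^esub> \<phi> (p k))"
        using \<phi>'(3)[OF \<pi>A[OF k] p[OF k]] split[OF k x] \<nu>A[OF k] v'(1)[OF x] a[OF k] \<phi>'(1)[OF p[OF k]]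
        by (simp add: P.R.l_distr P.R.m_assoc)
    qed
    also have "\<dots> = n \<phi> x \<oplus>\<^bsub>A\<^esub> (\<Oplus>\<^bsub>A\<^esub>k\<in>{..<m}. v x \<otimes>\<^bsub>A\<^esub> (a k \<otimes>\<^bsub>A\<^esub> \<phi> (p k)))"
      unfolding n_def by (rule P.R.finsum_addf[OF in2 in3])
    also have "(\<Oplus>\<^bsub>A\<^esub>k\<in>{..<m}. v x \<otimes>\<^bsub>A\<^esub> (a k \<otimes>\<^bsub>A\<^esub> \<phi> (p k))) = v x \<otimes>\<^bsub>A\<^esub> \<xi> \<phi>"
      unfolding \<xi>_def using in1 v'(1)[OF x] by (intro P.R.finsum_rdistr[symmetric]) auto
    finally show ?thesis .
  qed
  have nA: "n \<phi> x \<in> carrier A" if "\<phi> \<in> functionals A P" "x \<in> carrier P" for \<phi> x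
    using functionalD(1)[OF N'(1)[OF n[OF that(1)]] that(2)] .
  have "\<phi> z = \<zero>\<^bsub>A\<^esub>" if \<phi>: "\<phi> \<in> N" for \<phi>
  proof -
    have \<phi>F: "\<phi> \<in> functionals A P" using N'(1)[OF \<phi>] .
    note \<phi>' = functionalD[OF \<phi>F]
    have "(\<lambda>x. \<phi> x \<oplus>\<^bsub>A\<^esub> n \<phi> x \<otimes>\<^bsub>A\<^esub> (\<ominus>\<^bsub>A\<^esub> \<one>\<^bsub>A\<^esub>)) \<in> N"
      by (intro N'(3)[OF \<phi>] N'(4)[OF n[OF \<phi>F]]) simp
    then have "(\<lambda>w. v w \<otimes>\<^bsub>A\<^esub> \<xi> \<phi>) \<in> N"
    proof (rule N'(5))
      fix x assume x: "x \<in> carrier P"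
      show "v x \<otimes>\<^bsub>A\<^esub> \<xi> \<phi> = \<phi> x \<oplus>\<^bsub>A\<^esub> n \<phi> x \<otimes>\<^bsub>A\<^esub> (\<ominus>\<^bsub>A\<^esub> \<one>\<^bsub>A\<^esub>)"
        using expand[OF \<phi>F x] nA[OF \<phi>F x] v'(1)[OF x] \<xi>[OF \<phi>F]
        by (simp add: P.R.r_minus P.R.a_ac P.R.r_neg2)
    qed
    then show ?thesis using eval_z[OF \<phi>F] kills[OF \<xi>[OF \<phi>F]] by simp
  qed
  moreover have "z \<noteq> \<zero>\<^bsub>P\<^esub>"
  proof
    assume z0: "z = \<zero>\<^bsub>P\<^esub>"
    have "v z = \<zero>\<^bsub>A\<^esub>"
      using v'(3)[of "\<zero>\<^bsub>A\<^esub>" "\<zero>\<^bsub>P\<^esub>"] v'(1)[of "\<zero>\<^bsub>P\<^esub>"] z0 by (simp add: P.smult_l_null)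
    then have y\<xi>: "y \<otimes>\<^bsub>A\<^esub> \<xi> v = \<zero>\<^bsub>A\<^esub>" using eval_z[OF v(1)] by simp
    have "(\<lambda>w. v w \<otimes>\<^bsub>A\<^esub> (e \<ominus>\<^bsub>A\<^esub> \<xi> v)) \<in> N"
    proof (rule N'(5)[OF n[OF v(1)]])
      fix x assume x: "x \<in> carrier P"
      have "v x \<otimes>\<^bsub>A\<^esub> (e \<ominus>\<^bsub>A\<^esub> \<xi> v) = v x \<ominus>\<^bsub>A\<^esub> v x \<otimes>\<^bsub>A\<^esub> \<xi> v"
        using v'(1)[OF x] e \<xi>[OF v(1)] ve[OF x] by (simp add: a_minus_def P.R.r_distr P.R.r_minus)
      also have "\<dots> = n v x \<oplus>\<^bsub>A\<^esub> v x \<otimes>\<^bsub>A\<^esub> \<xi> v \<ominus>\<^bsub>A\<^esub> v x \<otimes>\<^bsub>A\<^esub> \<xi> v"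
        using expand[OF v(1) x] by simp
      also have "\<dots> = n v x"
        using nA[OF v(1) x] v'(1)[OF x] \<xi>[OF v(1)] by (simp add: a_minus_def P.R.a_assoc P.R.r_neg)
      finally show "v x \<otimes>\<^bsub>A\<^esub> (e \<ominus>\<^bsub>A\<^esub> \<xi> v) = n v x" .
    qed
    then have "y \<otimes>\<^bsub>A\<^esub> (e \<ominus>\<^bsub>A\<^esub> \<xi> v) = \<zero>\<^bsub>A\<^esub>" using kills e \<xi>[OF v(1)] by simp
    then have "y = \<zero>\<^bsub>A\<^esub>"
      using y e \<xi>[OF v(1)] y\<xi> by (simp add: a_minus_def P.R.r_distr P.R.r_minus)
    then show False using y(2) by blast
  qed
  ultimately show ?thesis using z by blast
qed

text \<open>The functionals on \<open>P\<close> that extend along \<open>f\<close> form a right submodule \<open>N\<close> of \<open>P\<^sup>*\<close>. A nonzero common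
  zero \<open>z\<close> of \<open>N\<close> would satisfy \<open>f z = 0\<close>, as the functionals on \<open>Q\<close> separate points. So \<open>N\<close> is all of
  \<open>P\<^sup>*\<close>, and extensions of the coordinate functionals are the coordinates of a retraction.\<close>

lemma injective_hom_of_projectives_splits:
  fixes P Q :: "'a umod" and A :: "('a, 'c) ring_scheme"
  assumes e: "\<And>i. i < (l::nat) \<Longrightarrow> e i \<in> carrier A" "\<And>i. i < l \<Longrightarrow> e i \<otimes>\<^bsub>A\<^esub> e i = e i"
    and one: "(\<Oplus>\<^bsub>A\<^esub>i\<in>{..<l}. e i) = \<one>\<^bsub>A\<^esub>" and kill: "\<And>i. i < l \<Longrightarrow> right_top_embeds A (e i)"
    and P: "fg_projective A P" and Q: "fg_projective A Q"
    and f: "f \<in> lmod_hom A P Q" and inj: "inj_on f (carrier P)"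
  shows "\<exists>r \<in> lmod_hom A Q P. \<forall>x \<in> carrier P. r (f x) = x"
proof -
  have lP: "left_module A P" and lQ: "left_module A Q" using P Q by (auto simp: fg_projective_def)
  interpret f: lmod_hom_pair A P Q f using lP lQ f by (rule lmod_hom_pairI)
  have rA: "ring A" by (rule f.M.R.ring_axioms)
  obtain m p \<pi> where "dual_basis A P m p \<pi>" by (rule fg_projective_dual_basis[OF P])
  note p = dual_basisD(1)[OF this] and \<pi> = dual_basisD(2)[OF this]
    and basisP = dual_basisD(3)[OF this]
  obtain m' p' \<rho> where "dual_basis A Q m' p' \<rho>" by (rule fg_projective_dual_basis[OF Q])
  note p' = dual_basisD(1)[OF this] and \<rho> = dual_basisD(2)[OF this]
    and basisQ = dual_basisD(3)[OF this]
  note \<pi>' = functionalD[OF \<pi>]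
  define v where "v k i x = \<pi> k x \<otimes>\<^bsub>A\<^esub> e i" for k i x
  \<comment> \<open>The generators are cut down by the idempotents, so that each one satisfies \<open>v = v e\<close> for some \<open>e\<close>.\<close>
  define V where "V = (\<lambda>(k, i). v k i) ` ({..<m} \<times> {..<l})"
  have v: "v k i \<in> functionals A P" if "k < m" "i < l" for k i
    by (rule functionalI)
      (use that e(1) \<pi>' in \<open>auto simp: v_def f.M.R.l_distr f.M.R.m_assoc\<close>)
  have V: "finite V" "V \<subseteq> functionals A P" using v by (auto simp: V_def)
  have sumv: "\<pi> k x = (\<Oplus>\<^bsub>A\<^esub>i\<in>{..<l}. v k i x)" if "k < m" "x \<in> carrier P" for k x
  proof -
    have "\<pi> k x = \<pi> k x \<otimes>\<^bsub>A\<^esub> (\<Oplus>\<^bsub>A\<^esub>i\<in>{..<l}. e i)" using that \<pi>'(1) by (simp add: one)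
    also have "\<dots> = (\<Oplus>\<^bsub>A\<^esub>i\<in>{..<l}. v k i x)"
      unfolding v_def using that \<pi>'(1) e(1) by (intro f.M.R.finsum_rdistr) auto
    finally show ?thesis .
  qed
  have \<pi>_mem: "\<pi> k \<in> N" if N: "right_submodule A P N" "V \<subseteq> N" and k: "k < m" for N k
  proof (rule right_submoduleD(5)[OF N(1)])
    show "(\<lambda>x. \<Oplus>\<^bsub>A\<^esub>i\<in>{..<l}. v k i x) \<in> N"
      by (rule right_submodule_finsum[OF rA N(1)]) (use N(2) k in \<open>auto simp: V_def\<close>)
  qed (rule sumv[OF k])
  define N where "N = {\<phi>. \<exists>\<psi> \<in> functionals A Q. \<forall>x \<in> carrier P. \<phi> x = \<psi> (f x)}"
  have NI: "\<phi> \<in> N" if "\<psi> \<in> functionals A Q" "\<And>x. x \<in> carrier P \<Longrightarrow> \<phi> x = \<psi> (f x)" for \<phi> \<psi>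
    using that unfolding N_def by blast
  have NE: "\<exists>\<psi> \<in> functionals A Q. \<forall>x \<in> carrier P. \<phi> x = \<psi> (f x)" if "\<phi> \<in> N" for \<phi>
    using that unfolding N_def by blast
  have N: "right_submodule A P N"
    unfolding right_submodule_def
  proof (intro conjI ballI allI impI)
    show "(\<lambda>_. \<zero>\<^bsub>A\<^esub>) \<in> N" by (rule NI[of "\<lambda>_. \<zero>\<^bsub>A\<^esub>"]) (auto intro: functionalI)
    show "N \<subseteq> functionals A P"
    proof
      fix \<phi> assume "\<phi> \<in> N"
      then obtain \<psi> where \<psi>: "\<psi> \<in> functionals A Q" "\<forall>x \<in> carrier P. \<phi> x = \<psi> (f x)" using NE by blast
      note \<psi>' = functionalD[OF \<psi>(1)]
      show "\<phi> \<in> functionals A P"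
        by (rule functionalI)
          (use \<psi>(2) \<psi>' f.hom_closed in \<open>auto simp: f.hom_add f.hom_smult f.M.smult_closed\<close>)
    qed
    fix \<phi> assume "\<phi> \<in> N"
    then obtain \<psi> where \<psi>: "\<psi> \<in> functionals A Q" "\<forall>x \<in> carrier P. \<phi> x = \<psi> (f x)" using NE by blast
    note \<psi>' = functionalD[OF \<psi>(1)]
    show "(\<lambda>x. \<phi> x \<otimes>\<^bsub>A\<^esub> a) \<in> N" if "a \<in> carrier A" for a
    proof (rule NI[of "\<lambda>x. \<psi> x \<otimes>\<^bsub>A\<^esub> a"])
      show "(\<lambda>x. \<psi> x \<otimes>\<^bsub>A\<^esub> a) \<in> functionals A Q"
        by (rule functionalI) (use that \<psi>' in \<open>auto simp: f.M.R.l_distr f.M.R.m_assoc\<close>)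
    qed (use \<psi> in simp)
    show "\<phi>' \<in> N" if "\<forall>x \<in> carrier P. \<phi>' x = \<phi> x" for \<phi>'
      by (rule NI[OF \<psi>(1)]) (use that \<psi>(2) in simp)
    fix \<phi>2 assume "\<phi>2 \<in> N"
    then obtain \<psi>2 where \<psi>2: "\<psi>2 \<in> functionals A Q" "\<forall>x \<in> carrier P. \<phi>2 x = \<psi>2 (f x)" using NE by blast
    note \<psi>2' = functionalD[OF \<psi>2(1)]
    show "(\<lambda>x. \<phi> x \<oplus>\<^bsub>A\<^esub> \<phi>2 x) \<in> N"
    proof (rule NI[of "\<lambda>x. \<psi> x \<oplus>\<^bsub>A\<^esub> \<psi>2 x"])
      show "(\<lambda>x. \<psi> x \<oplus>\<^bsub>A\<^esub> \<psi>2 x) \<in> functionals A Q"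
        by (rule functionalI) (use \<psi>' \<psi>2' in \<open>auto simp: f.M.R.r_distr f.M.R.a_ac\<close>)
    qed (use \<psi> \<psi>2 in simp)
  qed
  have "V \<subseteq> N"
  proof (rule ccontr)
    assume "\<not> V \<subseteq> N"
    then obtain N' w where N': "right_submodule A P N'" "N \<subseteq> N'" "w \<in> V" "w \<notin> N'" "V \<subseteq> adjoin A P N' w"
      using ex_right_submodule_missing_one_generator[OF lP V N] by blast
    obtain k i where ki: "k < m" "i < l" "w = v k i" using N'(3) by (auto simp: V_def)
    have wF: "w \<in> functionals A P" using V(2) N'(3) by blast
    have \<pi>N: "\<pi> j \<in> adjoin A P N' w" if "j < m" for j
      by (rule \<pi>_mem[OF right_submodule_adjoin(1)[OF lP N'(1) wF] N'(5) that])
    have we: "w x \<otimes>\<^bsub>A\<^esub> e i = w x" if "x \<in> carrier P" for x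
      using that ki \<pi>'(1) e by (simp add: v_def f.M.R.m_assoc)
    have "\<exists>z \<in> carrier P. z \<noteq> \<zero>\<^bsub>P\<^esub> \<and> (\<forall>\<phi> \<in> N'. \<phi> z = \<zero>\<^bsub>A\<^esub>)"
      by (rule ex_common_zero_of_functionals[OF lP N'(1) p \<pi>N basisP wF N'(4)
            e(1)[OF ki(2)] e(2)[OF ki(2)] we kill[OF ki(2)]])
    then obtain z where z: "z \<in> carrier P" "z \<noteq> \<zero>\<^bsub>P\<^esub>" "\<And>\<phi>. \<phi> \<in> N' \<Longrightarrow> \<phi> z = \<zero>\<^bsub>A\<^esub>" by blast
    have \<rho>z: "\<rho> j (f z) = \<zero>\<^bsub>A\<^esub>" if "j < m'" for j
    proof -
      have "(\<lambda>x. \<rho> j (f x)) \<in> N" by (rule NI[OF \<rho>[OF that]]) (rule refl)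
      then have "(\<lambda>x. \<rho> j (f x)) \<in> N'" by (rule subsetD[OF N'(2)])
      then show ?thesis by (rule z(3))
    qed
    have "f z = (\<Oplus>\<^bsub>Q\<^esub>j\<in>{..<m'}. \<zero>\<^bsub>Q\<^esub>)"
    proof (rule trans[OF basisQ[OF f.hom_closed[OF z(1)]]])
      show "(\<Oplus>\<^bsub>Q\<^esub>k\<in>{..<m'}. \<rho> k (f z) \<odot>\<^bsub>Q\<^esub> p' k) = (\<Oplus>\<^bsub>Q\<^esub>j\<in>{..<m'}. \<zero>\<^bsub>Q\<^esub>)"
        by (rule f.N.M.finsum_cong') (auto simp: \<rho>z p' f.N.smult_l_null)
    qed
    then have "f z = \<zero>\<^bsub>Q\<^esub>" by (simp add: f.N.M.finsum_zero)
    then show False using inj z(1,2) by (simp add: f.inj_on_iff)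
  qed
  then have "\<pi> k \<in> N" if "k < m" for k using \<pi>_mem[OF N] that by blast
  then have "\<forall>k. \<exists>\<psi>. k < m \<longrightarrow> \<psi> \<in> functionals A Q \<and> (\<forall>x \<in> carrier P. \<pi> k x = \<psi> (f x))"
    using NE by blast
  then obtain \<psi> where \<psi>: "\<And>k. k < m \<Longrightarrow> \<psi> k \<in> functionals A Q"
    and \<pi>\<psi>: "\<And>k x. \<lbrakk>k < m; x \<in> carrier P\<rbrakk> \<Longrightarrow> \<pi> k x = \<psi> k (f x)"
    by metis
  show ?thesis
  proof (intro bexI[of _ "\<lambda>q. \<Oplus>\<^bsub>P\<^esub>k\<in>{..<m}. \<psi> k q \<odot>\<^bsub>P\<^esub> p k"] ballI)
    show "(\<lambda>q. \<Oplus>\<^bsub>P\<^esub>k\<in>{..<m}. \<psi> k q \<odot>\<^bsub>P\<^esub> p k) \<in> lmod_hom A Q P"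
      by (rule lmod_hom_combination[OF lQ lP]) (use \<psi> p in auto)
    fix x assume x: "x \<in> carrier P"
    have "(\<Oplus>\<^bsub>P\<^esub>k\<in>{..<m}. \<psi> k (f x) \<odot>\<^bsub>P\<^esub> p k) = (\<Oplus>\<^bsub>P\<^esub>k\<in>{..<m}. \<pi> k x \<odot>\<^bsub>P\<^esub> p k)"
      by (rule f.M.M.finsum_cong')
        (use x p \<pi>'(1) in \<open>auto simp: \<pi>\<psi>[symmetric] intro!: f.M.smult_closed\<close>)
    then show "(\<Oplus>\<^bsub>P\<^esub>k\<in>{..<m}. \<psi> k (f x) \<odot>\<^bsub>P\<^esub> p k) = x" using basisP[OF x] by simp
  qed
qed

section \<open>Modules with finite projective resolutions\<close>

lemma fg_projective_zero_module:
  fixes M :: "('a, 'm) module"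
  assumes M: "fg_projective A M" shows "fg_projective A (M\<lparr>carrier := {\<zero>\<^bsub>M\<^esub>}\<rparr>)"
proof -
  have lM: "left_module A M" using M by (simp add: fg_projective_def)
  interpret left_module A M by (rule lM)
  show ?thesis
  proof (rule fg_projective_retract[OF M left_module_submodule[OF submodule_zero]])
    show "(\<lambda>x. x) \<in> lmod_hom A (M\<lparr>carrier := {\<zero>\<^bsub>M\<^esub>}\<rparr>) M" by (rule lmod_homI) simp_all
    show "(\<lambda>_. \<zero>\<^bsub>M\<^esub>) \<in> lmod_hom A M (M\<lparr>carrier := {\<zero>\<^bsub>M\<^esub>}\<rparr>)"
      by (rule lmod_homI) (simp_all add: smult_r_null)
  qed simp
qed

definition projective_injections_split :: "('a, 'c) ring_scheme \<Rightarrow> bool" where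
  "projective_injections_split A \<longleftrightarrow>
     (\<forall>(P :: 'a umod) (Q :: 'a umod). \<forall>f \<in> lmod_hom A P Q.
        fg_projective A P \<and> fg_projective A Q \<and> inj_on f (carrier P) \<longrightarrow>
        (\<exists>r \<in> lmod_hom A Q P. \<forall>x \<in> carrier P. r (f x) = x))"

text \<open>If \<open>r\<close> retracts \<open>P\<close> onto the kernel of \<open>p\<close>, then \<open>x - r x\<close> depends on \<open>p x\<close> only and defines a
  section of \<open>p\<close>; so \<open>M\<close> is a retract of \<open>P\<close>.\<close>

lemma fg_projective_quotient_by_projective:
  fixes P M :: "'a umod"
  assumes split: "projective_injections_split A"
    and P: "fg_projective A P" and M: "left_module A M" and p: "p \<in> lmod_hom A P M"
    and surj: "p ` carrier P = carrier M"
    and ker: "fg_projective A (P\<lparr>carrier := lmod_ker P M p\<rparr>)"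
  shows "fg_projective A M"
proof -
  have lP: "left_module A P" using P by (simp add: fg_projective_def)
  interpret p: lmod_hom_pair A P M p using lP M p by (rule lmod_hom_pairI)
  let ?K = "P\<lparr>carrier := lmod_ker P M p\<rparr>"
  have incl: "(\<lambda>x. x) \<in> lmod_hom A ?K P" by (rule lmod_homI) (auto simp: lmod_ker_def)
  obtain r where r: "r \<in> lmod_hom A P ?K" and r_id: "\<And>x. x \<in> lmod_ker P M p \<Longrightarrow> r x = x"
    using split[unfolded projective_injections_split_def, rule_format, OF incl] ker P by auto
  have r1: "r x \<in> carrier P" "p (r x) = \<zero>\<^bsub>M\<^esub>" if "x \<in> carrier P" for x
    using lmod_homD(1)[OF r that] by (auto simp: lmod_ker_def)
  have rP: "r \<in> lmod_hom A P P" using lmod_hom_comp[OF lP r incl] by simp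
  interpret r: lmod_hom_pair A P P r using lP lP rP by (rule lmod_hom_pairI)
  define s where "s x = x \<ominus>\<^bsub>P\<^esub> r x" for x
  have s_closed: "s x \<in> carrier P" if "x \<in> carrier P" for x
    using that r1[OF that] by (simp add: s_def)
  have ps: "p (s x) = p x" if "x \<in> carrier P" for x
  proof -
    have "p (s x) = p x \<ominus>\<^bsub>M\<^esub> \<zero>\<^bsub>M\<^esub>" using that r1[OF that] by (simp add: s_def p.hom_diff)
    then show ?thesis using p.hom_closed[OF that] by (simp add: a_minus_def)
  qed
  have s_cong: "s x = s y" if xy: "x \<in> carrier P" "y \<in> carrier P" "p x = p y" for x y
  proof -
    have "x \<ominus>\<^bsub>P\<^esub> y \<in> lmod_ker P M p"
      using xy p.hom_closed by (simp add: lmod_ker_def p.hom_diff p.N.diff_eq_zero_iff)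
    then have "r x \<ominus>\<^bsub>P\<^esub> r y = x \<ominus>\<^bsub>P\<^esub> y" using r_id xy by (metis r.hom_diff)
    moreover have "s x \<ominus>\<^bsub>P\<^esub> s y = (x \<ominus>\<^bsub>P\<^esub> y) \<ominus>\<^bsub>P\<^esub> (r x \<ominus>\<^bsub>P\<^esub> r y)"
      using xy r1 by (simp add: s_def a_minus_def p.M.M.minus_add p.M.M.a_ac)
    ultimately have "s x \<ominus>\<^bsub>P\<^esub> s y = \<zero>\<^bsub>P\<^esub>" using xy by (simp add: a_minus_def p.M.M.r_neg)
    then show ?thesis using s_closed xy by (simp add: p.M.diff_eq_zero_iff)
  qed
  have s_add: "s (x \<oplus>\<^bsub>P\<^esub> y) = s x \<oplus>\<^bsub>P\<^esub> s y" if "x \<in> carrier P" "y \<in> carrier P" for x y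
    using that r1 by (simp add: s_def r.hom_add a_minus_def p.M.M.minus_add p.M.M.a_ac)
  have s_smult: "s (a \<odot>\<^bsub>P\<^esub> x) = a \<odot>\<^bsub>P\<^esub> s x" if ax: "a \<in> carrier A" "x \<in> carrier P" for a x
  proof -
    have "a \<odot>\<^bsub>P\<^esub> (\<ominus>\<^bsub>P\<^esub> r x) = (a \<otimes>\<^bsub>A\<^esub> (\<ominus>\<^bsub>A\<^esub> \<one>\<^bsub>A\<^esub>)) \<odot>\<^bsub>P\<^esub> r x"
      using ax r1 by (simp add: p.M.minus_eq_smult p.M.smult_assoc)
    also have "\<dots> = \<ominus>\<^bsub>P\<^esub> (a \<odot>\<^bsub>P\<^esub> r x)"
      using ax r1 by (simp add: p.M.R.r_minus p.M.smult_l_minus)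
    finally show ?thesis using ax r1 by (simp add: s_def r.hom_smult a_minus_def p.M.smult_r_distr)
  qed
  define lift where "lift y = (SOME x. x \<in> carrier P \<and> p x = y)" for y
  have lift: "lift y \<in> carrier P \<and> p (lift y) = y" if "y \<in> carrier M" for y
    unfolding lift_def by (rule someI_ex) (use that in \<open>unfold surj[symmetric], blast\<close>)
  have t: "s (lift (p x)) = s x" if "x \<in> carrier P" for x
    using lift[OF p.hom_closed[OF that]] that by (intro s_cong) auto
  have pre: "\<exists>x \<in> carrier P. y = p x" if "y \<in> carrier M" for y using lift[OF that] by metis
  have thom: "(\<lambda>y. s (lift y)) \<in> lmod_hom A M P"
  proof (rule lmod_homI)
    show "s (lift y) \<in> carrier P" if "y \<in> carrier M" for y using lift[OF that] s_closed by blast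
    fix y assume "y \<in> carrier M"
    then obtain x where x: "x \<in> carrier P" "y = p x" using pre by blast
    show "s (lift (a \<odot>\<^bsub>M\<^esub> y)) = a \<odot>\<^bsub>P\<^esub> s (lift y)" if "a \<in> carrier A" for a
      using t[of "a \<odot>\<^bsub>P\<^esub> x"] t[of x] x that by (simp add: p.hom_smult p.M.smult_closed s_smult)
    fix y' assume "y' \<in> carrier M"
    then obtain x' where x': "x' \<in> carrier P" "y' = p x'" using pre by blast
    show "s (lift (y \<oplus>\<^bsub>M\<^esub> y')) = s (lift y) \<oplus>\<^bsub>P\<^esub> s (lift y')"
      using t[of "x \<oplus>\<^bsub>P\<^esub> x'"] t[of x] t[of x'] x x' by (simp add: p.hom_add s_add)
  qed
  show ?thesis
    by (rule fg_projective_retract[OF P M thom p]) (use lift ps in auto)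
qed

lemma projective_resolutionD:
  assumes "projective_resolution A M n P d p"
  shows "fg_projective A (P i)" "i > n \<Longrightarrow> carrier (P i) = {\<zero>\<^bsub>P i\<^esub>}"
    and "d i \<in> lmod_hom A (P (Suc i)) (P i)" "p \<in> lmod_hom A (P 0) M"
    and "p ` carrier (P 0) = carrier M" "lmod_ker (P 0) M p = d 0 ` carrier (P 1)"
    and "lmod_ker (P (Suc i)) (P i) (d i) = d (Suc i) ` carrier (P (Suc (Suc i)))"
  using assms by (simp_all add: projective_resolution_def)

text \<open>A resolution of \<open>M\<close> of length \<open>n + 1\<close> restricts to one of length \<open>n\<close> of the first syzygy, which
  is projective by induction. A resolution of length \<open>0\<close> has the zero module as first syzygy.\<close>

lemma fg_projective_if_finite_resolution:
  fixes M :: "'a umod" and P :: "nat \<Rightarrow> 'a umod"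
  assumes split: "projective_injections_split A"
    and "left_module A M" and "projective_resolution A M n P d p"
  shows "fg_projective A M"
  using assms(2,3)
proof (induction n arbitrary: M P d p)
  case (0 M P d p)
  note res = projective_resolutionD[OF 0(2)]
  note P = res(1)[of 0] res(1)[of 1] and d = res(3)[of 0] and p = res(4) and surj = res(5)
    and ker = res(6) and z = res(2)[of 1, OF zero_less_one]
  have l: "left_module A (P 0)" "left_module A (P 1)" using P by (simp_all add: fg_projective_def)
  interpret d: lmod_hom_pair A "P 1" "P 0" "d 0"
    using l(2,1) d by (intro lmod_hom_pairI) simp_all
  have "lmod_ker (P 0) M p = {\<zero>\<^bsub>P 0\<^esub>}" unfolding ker z using d.hom_zero by simp
  then have "fg_projective A ((P 0)\<lparr>carrier := lmod_ker (P 0) M p\<rparr>)"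
    using fg_projective_zero_module[OF P(1)] by simp
  then show ?case by (rule fg_projective_quotient_by_projective[OF split P(1) 0(1) p surj])
next
  case (Suc n M P d p)
  note res = projective_resolutionD[OF Suc(3)]
  note P = res(1) and z = res(2) and d = res(3) and p = res(4) and surj = res(5) and ker = res(6)
    and exact = res(7)
  have l: "left_module A (P 0)" using P by (simp add: fg_projective_def)
  interpret p: lmod_hom_pair A "P 0" M p using l Suc(2) p by (rule lmod_hom_pairI)
  let ?K = "(P 0)\<lparr>carrier := lmod_ker (P 0) M p\<rparr>"
  have lK: "left_module A ?K" by (rule p.M.left_module_submodule[OF p.submodule_ker])
  have "projective_resolution A ?K n (\<lambda>i. P (Suc i)) (\<lambda>i. d (Suc i)) (d 0)"
    unfolding projective_resolution_def
  proof (intro conjI allI impI)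
    show "d 0 \<in> lmod_hom A (P (Suc 0)) ?K"
      by (rule lmod_homI) (use ker lmod_homD[OF d[of 0]] in auto)
    show "d 0 ` carrier (P (Suc 0)) = carrier ?K" using ker by simp
    show "lmod_ker (P (Suc 0)) ?K (d 0) = d (Suc 0) ` carrier (P (Suc 1))"
      using exact[of 0] by (simp add: lmod_ker_def)
  qed (use P d exact z in auto)
  then have "fg_projective A ?K" by (rule Suc.IH[OF lK])
  then show ?case by (rule fg_projective_quotient_by_projective[OF split P Suc(2) p surj])
qed

lemma proj_dim_fg_projective:
  fixes M :: "'a umod"
  assumes M: "fg_projective A M" shows "proj_dim A M = 0"
proof -
  have lM: "left_module A M" using M by (simp add: fg_projective_def)
  interpret left_module A M by (rule lM)
  define Z where "Z = M\<lparr>carrier := {\<zero>\<^bsub>M\<^esub>}\<rparr>"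
  define P where "P i = (if i = 0 then M else Z)" for i :: nat
  have Z: "fg_projective A Z" unfolding Z_def by (rule fg_projective_zero_module[OF M])
  have P: "P 0 = M" "P (Suc i) = Z" for i by (simp_all add: P_def)
  have "projective_resolution A M 0 P (\<lambda>_ _. \<zero>\<^bsub>M\<^esub>) (\<lambda>x. x)"
    unfolding projective_resolution_def
  proof (intro conjI allI impI)
    show "fg_projective A (P i)" for i using M Z by (simp add: P_def)
    show "carrier (P i) = {\<zero>\<^bsub>P i\<^esub>}" if "0 < i" for i using that by (simp add: P_def Z_def)
    show "(\<lambda>_. \<zero>\<^bsub>M\<^esub>) \<in> lmod_hom A (P (Suc i)) (P i)" for i
      by (rule lmod_homI) (auto simp: P_def Z_def smult_r_null)
    show "(\<lambda>x. x) \<in> lmod_hom A (P 0) M" by (rule lmod_homI) (simp_all add: P)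
    show "(\<lambda>x. x) ` carrier (P 0) = carrier M" by (simp add: P)
    show "lmod_ker (P 0) M (\<lambda>x. x) = (\<lambda>_. \<zero>\<^bsub>M\<^esub>) ` carrier (P 1)"
      by (auto simp: P_def Z_def lmod_ker_def)
    show "lmod_ker (P (Suc i)) (P i) (\<lambda>_. \<zero>\<^bsub>M\<^esub>) = (\<lambda>_. \<zero>\<^bsub>M\<^esub>) ` carrier (P (Suc (Suc i)))" for i
      by (auto simp: P_def Z_def lmod_ker_def)
  qed
  then have "proj_dim A M \<le> enat 0" unfolding proj_dim_def by (intro Inf_lower) blast
  then show ?thesis by (simp add: zero_enat_def[symmetric])
qed

theorem proposition2p9:
  fixes K :: "('k, 'c) ring_scheme" and A :: "('k, 'a) module"
  assumes "algebraically_closed K"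
    and "fin_dim_algebra K A"
    and "basic_algebra A"
    and "connected_algebra K A"
    and "\<forall>S :: 'a umod. simple_module A S \<longrightarrow> socle_condition A S"
  shows "finitistic_dimension A = 0"
proof -
  have "field K" using assms(1) by (simp add: algebraically_closed_def)
  then interpret fin_dim_algebra_over_field K A
    using assms(2) by (simp add: fin_dim_algebra_over_field_def)
  obtain n and P :: "nat \<Rightarrow> 'a umod" and e c where dec: "basic_decomposition A n P e c"
    by (rule ex_basic_decomposition[OF KA.ring_axioms assms(3)])
  note indec = basic_decompositionD(1)[OF dec] and pres = basic_decompositionD(3)[OF dec]
    and one = basic_decompositionD(4)[OF dec]
  have e: "e i \<in> carrier A" "e i \<otimes>\<^bsub>A\<^esub> e i = e i" if "i < n" for i
    using idempotent_presentation.primitive[OF pres[OF that] indec[OF that]]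
    by (simp_all add: primitive_idempotent_def)
  have kill: "right_top_embeds A (e i)" if "i < n" for i
    by (rule socle_condition_imp_right_top_embeds[OF dec assms(5) that])
  have split: "projective_injections_split A"
    unfolding projective_injections_split_def
  proof (intro allI ballI impI; elim conjE)
    fix P Q :: "'a umod" and f
    assume *: "fg_projective A P" "fg_projective A Q" "f \<in> lmod_hom A P Q" "inj_on f (carrier P)"
    show "\<exists>r \<in> lmod_hom A Q P. \<forall>x \<in> carrier P. r (f x) = x"
      by (rule injective_hom_of_projectives_splits[OF e one kill *])
  qed
  have "proj_dim A M = 0" if M: "left_module A M" "proj_dim A M < \<infinity>" for M :: "'a umod"
  proof -
    have "{enat n | n. \<exists>(P :: nat \<Rightarrow> 'a umod) d p. projective_resolution A M n P d p} \<noteq> {}"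
    proof
      assume "{enat n | n. \<exists>(P :: nat \<Rightarrow> 'a umod) d p. projective_resolution A M n P d p} = {}"
      then have "proj_dim A M = \<infinity>" unfolding proj_dim_def by (simp add: Inf_enat_def)
      then show False using M(2) by simp
    qed
    then obtain m and P :: "nat \<Rightarrow> 'a umod" and d p where "projective_resolution A M m P d p" by blast
    then show ?thesis
      using fg_projective_if_finite_resolution[OF split M(1)] proj_dim_fg_projective by blast
  qed
  then have "finitistic_dimension A \<le> 0"
    unfolding finitistic_dimension_def by (intro Sup_least) auto
  then show ?thesis by simp
qed

end
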